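(* Let $Q$ and $Q'$ be two quivers with the same vertex set $I$ and the same underlying undirected graph (i.e. $Q'$ is obtained from $Q$ by reversing some arrows), and fix arbitrary total orderings at each vertex for $\bar Q$ and for $\bar Q'$. Then the quasi-Hamiltonian algebras $(A_Q,\{\!\{-,-\}\!\},\Phi)$ and $(A_{Q'},\{\!\{-,-\}\!\}',\Phi')$ described in the context are isomorphic as quasi-Hamiltonian algebras over $B=\bigoplus_{s\in I}\Bbbk e_s$. In particular, up to isomorphism, this quasi-Hamiltonian algebra only depends on $Q$ seen as an undirected graph.
   Context: $\Bbbk$ is a field of characteristic $0$, $\otimes=\otimes_\Bbbk$, algebras are associative, unital, finitely generated. $B=\bigoplus_{s\in I}\Bbbk e_s$ with orthogonal idempotents summing to $1$; a $B$-algebra is an algebra with a map $B\to A$. Sweedler notation $d=d'\otimes d''$, $(d'\otimes d'')^\circ=d''\otimes d'$, outer bimodule structure $a(d'\otimes d'')b=ad'\otimes d''b$. A ($B$-linear) double bracket is a bilinear map $\{\!\{-,-\}\!\}:A\times A\to A\otimes A$ with $\{\!\{a,b\}\!\}=-\{\!\{b,a\}\!\}^\circ$, $\{\!\{a,bc\}\!\}=\{\!\{a,b\}\!\}c+b\{\!\{a,c\}\!\}$, vanishing if an argument lies in $B$. Its triple bracket: $\{\!\{a,b,c\}\!\}=\{\!\{a,\{\!\{b,c\}\!\}'\}\!\}\otimes\{\!\{b,c\}\!\}''+\tau(\{\!\{b,\{\!\{c,a\}\!\}'\}\!\}\otimes\{\!\{c,a\}\!\}'')+\tau^2(\{\!\{c,\{\!\{a,b\}\!\}'\}\!\}\otimes\{\!\{a,b\}\!\}'')$,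 $\tau(a_1\otimes a_2\otimes a_3)=a_3\otimes a_1\otimes a_2$. It is a double quasi-Poisson bracket if for all $a,b,c$: $\{\!\{a,b,c\}\!\}=\frac14\sum_{s\in I}\big(ce_sa\otimes e_sb\otimes e_s-ce_sa\otimes e_s\otimes be_s-ce_s\otimes ae_sb\otimes e_s+ce_s\otimes ae_s\otimes be_s-e_sa\otimes e_sb\otimes e_sc+e_sa\otimes e_s\otimes be_sc+e_s\otimes ae_sb\otimes e_sc-e_s\otimes ae_s\otimes be_sc\big)$. A multiplicative moment map is an invertible $\Phi=\sum_s\Phi_s$, $\Phi_s\in e_sAe_s$, with $\{\!\{\Phi_s,a\}\!\}=\frac12(ae_s\otimes\Phi_s-e_s\otimes\Phi_sa+a\Phi_s\otimes e_s-\Phi_s\otimes e_sa)$ for all $a\in A$, $s\in I$; a quasi-Hamiltonian algebra is $(A,\{\!\{-,-\}\!\},\Phi)$ with a double quasi-Poisson bracket and a multiplicative moment map. An isomorphism of quasi-Hamiltonian algebras is a $B$-algebra isomorphism $\psi$ with $\{\!\{\psi a,\psi b\}\!\}_2=(\psi\otimes\psi)\{\!\{a,b\}\!\}_1$ and $\psi(\Phi_1)=\Phi_2$. Quivers: arrows $a:t(a)\to h(a)$, double $\bar Q$ adds $a^*:h(a)\to t(a)$, $(a^* )^*=a$; path algebra with $a=e_{t(a)}ae_{h(a)}$, paths read left to right. $A_Q$ is the universal localisation of $\Bbbk\bar Q$ at $S=\{1+aa^*\mid a\in\bar Q\}$ (equivalently, adjoining inverses of $e_{t(a)}+aa^*$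 in $e_{t(a)}A_Qe_{t(a)}$). For each $s\in I$ fix a total order $<_s$ on $T_s=\{a\in\bar Q\mid t(a)=s\}$ and let $o_s(a,b)=1$ if $a<_sb$, $-1$ if $b<_sa$, and $0$ otherwise (i.e. if $a=b$ or $a\notin T_s$ or $b\notin T_s$). The double quasi-Poisson bracket on $A_Q$ is the $B$-linear double bracket determined by: $\{\!\{a,a\}\!\}=\frac12o_{t(a)}(a,a^* )(a^2\otimes e_{t(a)}-e_{h(a)}\otimes a^2)$ for $a\in\bar Q$; $\{\!\{a,a^*\}\!\}=e_{h(a)}\otimes e_{t(a)}+\frac12a^*a\otimes e_{t(a)}+\frac12e_{h(a)}\otimes aa^*+\frac12o_{t(a)}(a,a^* )(a^*\otimes a-a\otimes a^* )$ for $a\in Q$; and for $b,c\in\bar Q$ with $c\neq b,b^*$: $\{\!\{b,c\}\!\}=-\frac12o_{t(b)}(b,c)\,b\otimes c-\frac12o_{h(b)}(b^*,c^* )\,c\otimes b+\frac12o_{t(b)}(b,c^* )\,cb\otimes e_{t(b)}+\frac12o_{h(b)}(b^*,c)\,e_{h(b)}\otimes bc$. The multiplicative moment map is $\Phi=\sum_s\Phi_s$, $\Phi_s=\prod_{a\in T_s}(e_s+aa^* )^{\epsilon(a)}$, the product taken from left to right in increasing order for $<_s$, with $\epsilon(a)=+1$ if $a\in Q$ and $-1$ if $a\in\bar Q\setminus Q$. *)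

theory Defs
  imports "HOL-Library.Poly_Mapping" "HOL-Library.Product_Plus"
begin

datatype 'x word = Word (letters: "'x list")

instantiation word :: (type) monoid_add
begin
definition zero_word_def: "0 = Word []"
definition plus_word_def: "u + v = Word (letters u @ letters v)"
instance by standard (auto simp: zero_word_def plus_word_def)
end

text \<open>The free algebra on an alphabet 'x over 'k is ('x word =>0 'k) (multiplication
  = convolution w.r.t. concatenation).  Its tensor square F \<otimes> F is
  (pairs of words =>0 'k), whose ring structure is the componentwise product
  (a \<otimes> b)(c \<otimes> d) = ac \<otimes> bd.\<close>

type_synonym ('k, 'x) falg = "'x word \<Rightarrow>\<^sub>0 'k"
type_synonym ('k, 'x) ftens = "('x word \<times> 'x word) \<Rightarrow>\<^sub>0 'k"

definition sm :: "'k::semiring_0 \<Rightarrow> ('a \<Rightarrow>\<^sub>0 'k) \<Rightarrow> ('a \<Rightarrow>\<^sub>0 'k)" where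
  "sm c p = Poly_Mapping.map (\<lambda>x. c * x) p"

definition ltr :: "'x \<Rightarrow> ('k::{zero,one}, 'x) falg" where
  "ltr x = Poly_Mapping.single (Word [x]) 1"

lift_definition tens :: "('k::semiring_0, 'x) falg \<Rightarrow> ('k, 'x) falg \<Rightarrow> ('k, 'x) ftens"
  is "\<lambda>p q (u, v). p u * q v"
proof -
  fix p q :: "'x word \<Rightarrow> 'k"
  assume "finite {x. p x \<noteq> 0}" "finite {x. q x \<noteq> 0}"
  then have "finite ({x. p x \<noteq> 0} \<times> {x. q x \<noteq> 0})" by simp
  moreover have "{x. (case x of (u, v) \<Rightarrow> p u * q v) \<noteq> 0} \<subseteq> {x. p x \<noteq> 0} \<times> {x. q x \<noteq> 0}"
    by auto
  ultimately show "finite {x. (case x of (u, v) \<Rightarrow> p u * q v) \<noteq> 0}"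
    by (rule finite_subset[rotated])
qed

lift_definition tswap :: "('k::zero, 'x) ftens \<Rightarrow> ('k, 'x) ftens"
  is "\<lambda>T (u, v). T (v, u)"
proof -
  fix T :: "'x word \<times> 'x word \<Rightarrow> 'k"
  assume "finite {x. T x \<noteq> 0}"
  then have "finite (prod.swap ` {x. T x \<noteq> 0})" by simp
  moreover have "{x. (case x of (u, v) \<Rightarrow> T (v, u)) \<noteq> 0} \<subseteq> prod.swap ` {x. T x \<noteq> 0}"
    by (auto simp: image_iff)
  ultimately show "finite {x. (case x of (u, v) \<Rightarrow> T (v, u)) \<noteq> 0}"
    by (rule finite_subset[rotated])
qed

inductive_set tideal :: "('a::ring) set \<Rightarrow> 'a set" for R where
  gen: "r \<in> R \<Longrightarrow> r \<in> tideal R"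
| zero: "0 \<in> tideal R"
| add: "p \<in> tideal R \<Longrightarrow> q \<in> tideal R \<Longrightarrow> p + q \<in> tideal R"
| mult: "p \<in> tideal R \<Longrightarrow> u * p * v \<in> tideal R"

text \<open>The subspace J \<otimes> F + F \<otimes> J of F \<otimes> F (kernel of F \<otimes> F \<rightarrow> (F/J) \<otimes> (F/J)).\<close>
inductive_set tens_ker :: "('k::field, 'x) falg set \<Rightarrow> ('k, 'x) ftens set" for J where
  left: "j \<in> J \<Longrightarrow> tens j q \<in> tens_ker J"
| right: "j \<in> J \<Longrightarrow> tens q j \<in> tens_ker J"
| zero: "0 \<in> tens_ker J"
| add: "S \<in> tens_ker J \<Longrightarrow> T \<in> tens_ker J \<Longrightarrow> S + T \<in> tens_ker J"
| smul: "S \<in> tens_ker J \<Longrightarrow> sm c S \<in> tens_ker J"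

definition fhom :: "('x \<Rightarrow> ('k::ring_1, 'y) falg) \<Rightarrow> ('k, 'x) falg \<Rightarrow> ('k, 'y) falg" where
  "fhom \<phi> p = (\<Sum>w\<in>Poly_Mapping.keys p. sm (Poly_Mapping.lookup p w) (prod_list (map \<phi> (letters w))))"

definition thom :: "('x \<Rightarrow> ('k::ring_1, 'y) falg) \<Rightarrow> ('k, 'x) ftens \<Rightarrow> ('k, 'y) ftens" where
  "thom \<phi> T = (\<Sum>uv\<in>Poly_Mapping.keys T. sm (Poly_Mapping.lookup T uv)
       (tens (prod_list (map \<phi> (letters (fst uv)))) (prod_list (map \<phi> (letters (snd uv))))))"

text \<open>A quiver: vertex set I, arrow set Ar, tail t and head h.  The double quiver has arrows
  (a, True) = a and (a, False) = a*.  Generators of A_Q: V s = e_s, E b = b (b in the double),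
  Z b = inverse of e_{t(b)} + b b* in e_{t(b)} A e_{t(b)}.\<close>

datatype ('v, 'a) gen = V 'v | E "'a \<times> bool" | Z "'a \<times> bool"

definition quiver :: "'v set \<Rightarrow> 'a set \<Rightarrow> ('a \<Rightarrow> 'v) \<Rightarrow> ('a \<Rightarrow> 'v) \<Rightarrow> bool" where
  "quiver I Ar t h \<longleftrightarrow> finite I \<and> finite Ar \<and> (\<forall>a\<in>Ar. t a \<in> I \<and> h a \<in> I)"

definition darrows :: "'a set \<Rightarrow> ('a \<times> bool) set" where
  "darrows Ar = Ar \<times> UNIV"

definition dstar :: "'a \<times> bool \<Rightarrow> 'a \<times> bool" where
  "dstar b = (fst b, \<not> snd b)"

definition dtl :: "('a \<Rightarrow> 'v) \<Rightarrow> ('a \<Rightarrow> 'v) \<Rightarrow> 'a \<times> bool \<Rightarrow> 'v" where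
  "dtl t h b = (if snd b then t (fst b) else h (fst b))"

definition dhd :: "('a \<Rightarrow> 'v) \<Rightarrow> ('a \<Rightarrow> 'v) \<Rightarrow> 'a \<times> bool \<Rightarrow> 'v" where
  "dhd t h b = (if snd b then h (fst b) else t (fst b))"

definition Tset :: "'a set \<Rightarrow> ('a \<Rightarrow> 'v) \<Rightarrow> ('a \<Rightarrow> 'v) \<Rightarrow> 'v \<Rightarrow> ('a \<times> bool) set" where
  "Tset Ar t h s = {b \<in> darrows Ar. dtl t h b = s}"

definition rels :: "'v set \<Rightarrow> 'a set \<Rightarrow> ('a \<Rightarrow> 'v) \<Rightarrow> ('a \<Rightarrow> 'v) \<Rightarrow> ('k::ring_1, ('v, 'a) gen) falg set" where
  "rels I Ar t h =
     {1 - (\<Sum>s\<in>I. ltr (V s))}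
   \<union> {ltr (V s) * ltr (V s') - (if s = s' then ltr (V s) else 0) | s s'. s \<in> I \<and> s' \<in> I}
   \<union> {ltr (V s) | s. s \<notin> I}
   \<union> {ltr (E b) | b. b \<notin> darrows Ar}
   \<union> {ltr (Z b) | b. b \<notin> darrows Ar}
   \<union> {ltr (E b) - ltr (V (dtl t h b)) * ltr (E b) * ltr (V (dhd t h b)) | b. b \<in> darrows Ar}
   \<union> {ltr (Z b) - ltr (V (dtl t h b)) * ltr (Z b) * ltr (V (dtl t h b)) | b. b \<in> darrows Ar}
   \<union> {ltr (Z b) * (ltr (V (dtl t h b)) + ltr (E b) * ltr (E (dstar b))) - ltr (V (dtl t h b))
       | b. b \<in> darrows Ar}
   \<union> {(ltr (V (dtl t h b)) + ltr (E b) * ltr (E (dstar b))) * ltr (Z b) - ltr (V (dtl t h b))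
       | b. b \<in> darrows Ar}"

text \<open>A_Q = F / JQ.\<close>
definition JQ :: "'v set \<Rightarrow> 'a set \<Rightarrow> ('a \<Rightarrow> 'v) \<Rightarrow> ('a \<Rightarrow> 'v) \<Rightarrow> ('k::ring_1, ('v, 'a) gen) falg set" where
  "JQ I Ar t h = tideal (rels I Ar t h)"

text \<open>A total order at each vertex s is given by a list ol s enumerating T_s increasingly.\<close>
definition orderings :: "'v set \<Rightarrow> 'a set \<Rightarrow> ('a \<Rightarrow> 'v) \<Rightarrow> ('a \<Rightarrow> 'v) \<Rightarrow> ('v \<Rightarrow> ('a \<times> bool) list) \<Rightarrow> bool" where
  "orderings I Ar t h ol \<longleftrightarrow> (\<forall>s\<in>I. distinct (ol s) \<and> set (ol s) = Tset Ar t h s)"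

definition precedes :: "'b list \<Rightarrow> 'b \<Rightarrow> 'b \<Rightarrow> bool" where
  "precedes xs b c \<longleftrightarrow> (\<exists>i j. i < j \<and> j < length xs \<and> xs ! i = b \<and> xs ! j = c)"

definition oo :: "('v \<Rightarrow> ('a \<times> bool) list) \<Rightarrow> 'v \<Rightarrow> 'a \<times> bool \<Rightarrow> 'a \<times> bool \<Rightarrow> int" where
  "oo ol s b c = (if precedes (ol s) b c then 1 else if precedes (ol s) c b then -1 else 0)"

definition Phi :: "'v set \<Rightarrow> ('a \<Rightarrow> 'v) \<Rightarrow> ('a \<Rightarrow> 'v) \<Rightarrow> ('v \<Rightarrow> ('a \<times> bool) list) \<Rightarrow> ('k::ring_1, ('v, 'a) gen) falg" where
  "Phi I t h ol = (\<Sum>s\<in>I. ltr (V s) * prod_list (map (\<lambda>b. if snd b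
        then ltr (V s) + ltr (E b) * ltr (E (dstar b)) else ltr (Z b)) (ol s)))"

text \<open>A B-linear double bracket on A = F/J, given on representatives.\<close>
definition is_dbracket :: "'v set \<Rightarrow> ('k::field, 'x) falg set \<Rightarrow> ('v \<Rightarrow> 'x)
    \<Rightarrow> (('k, 'x) falg \<Rightarrow> ('k, 'x) falg \<Rightarrow> ('k, 'x) ftens) \<Rightarrow> bool" where
  "is_dbracket I J vx br \<longleftrightarrow>
     (\<forall>p p' q q'. p - p' \<in> J \<longrightarrow> q - q' \<in> J \<longrightarrow> br p q - br p' q' \<in> tens_ker J)
   \<and> (\<forall>p p' q. br (p + p') q - (br p q + br p' q) \<in> tens_ker J)
   \<and> (\<forall>p q q'. br p (q + q') - (br p q + br p q') \<in> tens_ker J)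
   \<and> (\<forall>c p q. br (sm c p) q - sm c (br p q) \<in> tens_ker J)
   \<and> (\<forall>c p q. br p (sm c q) - sm c (br p q) \<in> tens_ker J)
   \<and> (\<forall>p q. br p q + tswap (br q p) \<in> tens_ker J)
   \<and> (\<forall>p q r. br p (q * r) - (br p q * tens 1 r + tens q 1 * br p r) \<in> tens_ker J)
   \<and> (\<forall>c q. br (\<Sum>s\<in>I. sm (c s) (ltr (vx s))) q \<in> tens_ker J
          \<and> br q (\<Sum>s\<in>I. sm (c s) (ltr (vx s))) \<in> tens_ker J)"

definition bracket_gens :: "'v set \<Rightarrow> 'a set \<Rightarrow> ('a \<Rightarrow> 'v) \<Rightarrow> ('a \<Rightarrow> 'v) \<Rightarrow> ('v \<Rightarrow> ('a \<times> bool) list)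
    \<Rightarrow> (('k::field, ('v, 'a) gen) falg \<Rightarrow> ('k, ('v, 'a) gen) falg \<Rightarrow> ('k, ('v, 'a) gen) ftens) \<Rightarrow> bool" where
  "bracket_gens I Ar t h ol br \<longleftrightarrow>
    (let J = JQ I Ar t h; K = tens_ker J; e = (\<lambda>s. ltr (V s)); x = (\<lambda>b. ltr (E b));
         tl = dtl t h; hd = dhd t h; ow = (\<lambda>s b c. of_int (oo ol s b c) / 2) in
     (\<forall>b\<in>darrows Ar.
        br (x b) (x b) - sm (ow (tl b) b (dstar b))
           (tens (x b * x b) (e (tl b)) - tens (e (hd b)) (x b * x b)) \<in> K)
   \<and> (\<forall>a\<in>Ar. let b = (a, True) in
        br (x b) (x (dstar b)) -
          (tens (e (hd b)) (e (tl b)) + sm (1/2) (tens (x (dstar b) * x b) (e (tl b)))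
           + sm (1/2) (tens (e (hd b)) (x b * x (dstar b)))
           + sm (ow (tl b) b (dstar b)) (tens (x (dstar b)) (x b) - tens (x b) (x (dstar b)))) \<in> K)
   \<and> (\<forall>b\<in>darrows Ar. \<forall>c\<in>darrows Ar. c \<noteq> b \<and> c \<noteq> dstar b \<longrightarrow>
        br (x b) (x c) -
          (- sm (ow (tl b) b c) (tens (x b) (x c))
           - sm (ow (hd b) (dstar b) (dstar c)) (tens (x c) (x b))
           + sm (ow (tl b) b (dstar c)) (tens (x c * x b) (e (tl b)))
           + sm (ow (hd b) (dstar b) c) (tens (e (hd b)) (x b * x c))) \<in> K))"

text \<open>Isomorphism of quasi-Hamiltonian algebras A_Q \<rightarrow> A_Q', given by the images of the
  generators (a lift to free algebras; it exists for any algebra map since F is free).\<close>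
definition qham_iso ::
  "'v set \<Rightarrow> ('k::field, 'x) falg set \<Rightarrow> ('k, 'y) falg set \<Rightarrow> ('v \<Rightarrow> 'x) \<Rightarrow> ('v \<Rightarrow> 'y)
   \<Rightarrow> (('k, 'x) falg \<Rightarrow> ('k, 'x) falg \<Rightarrow> ('k, 'x) ftens)
   \<Rightarrow> (('k, 'y) falg \<Rightarrow> ('k, 'y) falg \<Rightarrow> ('k, 'y) ftens)
   \<Rightarrow> ('k, 'x) falg \<Rightarrow> ('k, 'y) falg \<Rightarrow> ('x \<Rightarrow> ('k, 'y) falg) \<Rightarrow> bool" where
  "qham_iso I J J' vx vy br br' \<Phi> \<Phi>' \<phi> \<longleftrightarrow>
     (\<forall>p\<in>J. fhom \<phi> p \<in> J')
   \<and> (\<forall>s\<in>I. fhom \<phi> (ltr (vx s)) - ltr (vy s) \<in> J')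
   \<and> (\<forall>p. fhom \<phi> p \<in> J' \<longrightarrow> p \<in> J)
   \<and> (\<forall>q. \<exists>p. fhom \<phi> p - q \<in> J')
   \<and> (\<forall>p q. br' (fhom \<phi> p) (fhom \<phi> q) - thom \<phi> (br p q) \<in> tens_ker J')
   \<and> fhom \<phi> \<Phi> - \<Phi>' \<in> J'"

end

theory Submission
  imports Defs "HOL-Library.Multiset" "HOL.Vector_Spaces"
begin

text \<open>
  Write \<open>\<phi>\<^sub>b = (e + b b\<^sup>* )\<^bsup>\<epsilon>(b)\<^esup>\<close> for the factor of \<open>b\<close> in the moment map. Two orders at a vertex differ
  by exchanges of neighbours. If \<open>c\<close> immediately precedes \<open>b\<close>, then replacing the generators \<open>b\<close> and
  \<open>b\<^sup>*\<close> by \<open>\<phi>\<^sub>c b\<close> and \<open>b\<^sup>* \<phi>\<^sub>c\<^sup>-\<^sup>1\<close> fixes \<open>\<phi>\<^sub>c\<close> and conjugates \<open>\<phi>\<^sub>b\<close> by it, so the product with \<open>b\<close> before \<open>c\<close>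
  becomes the old moment map; the brackets of the new generators are those prescribed by the new order,
  because \<open>\<phi>\<^sub>c\<close> acts on every arrow like a moment map for the half-edge \<open>c\<close>. This covers \<open>c = b\<^sup>*\<close> as well.
  Reversing an arrow \<open>b\<close> is realised by \<open>b\<^sup>* \<mapsto> - b\<^sup>* (e + b b\<^sup>* )\<^sup>-\<^sup>1\<close>, which leaves every factor of the moment map
  unchanged. Finally, a double bracket is determined by its values on arrows.
\<close>

section \<open>Free algebras and their tensor squares\<close>

text \<open>No double bracket is constructed for an intermediate order or orientation. The source
  algebra stays fixed, and the current data are recorded as a statement about the target: some
  isomorphism onto the algebra of \<open>Q'\<close> sends the arrows to elements whose given
  brackets follow the formula for the current order and orientation, and the current moment map to
  that of \<open>Q'\<close>. An exchange or a reversal precomposes this isomorphism with an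
  automorphism of the source. Only when the order and orientation of \<open>Q\<close> itself are
  reached does the given bracket on the source enter, through uniqueness.

  The obstacle is to compute in quotients by ideals that depend on parameters. Membership in an
  ideal is turned into an equation in a ring representing the quotient, where noncommutative
  products can be normalised by rewriting. The representation need not send 1 to 1, so each
  absorption of an idempotent by a neighbouring letter is justified separately. Doubling the
  brackets turns the coefficients 1/2 into integers.\<close>

lemma poly_mapping_additive_induct [case_names zero single add]:
  fixes p :: "'m \<Rightarrow>\<^sub>0 'k::comm_monoid_add"
  assumes "P 0" "\<And>w c. P (Poly_Mapping.single w c)" "\<And>p q. P p \<Longrightarrow> P q \<Longrightarrow> P (p + q)"
  shows "P p"
proof (induction p rule: update_induct)
  case const
  show ?case by fact
next
  case (update f a b)
  have "Poly_Mapping.update a b f = Poly_Mapping.single a b + f"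
    using update(1) by (intro poly_mapping_eqI)
      (auto simp: lookup_update lookup_add lookup_single when_def in_keys_iff)
  then show ?case using assms update by simp
qed

lemma sm_eq_mult: "sm c p = Poly_Mapping.single 0 c * (p :: 'm::monoid_add \<Rightarrow>\<^sub>0 'k::field)"
  unfolding sm_def by (rule mult_map_scale_conv_mult)

lemma scalar_commute:
  "p * Poly_Mapping.single 0 c = Poly_Mapping.single 0 c * (p :: 'm::monoid_add \<Rightarrow>\<^sub>0 'k::field)"
  by (induction p rule: poly_mapping_additive_induct)
     (auto simp: mult_single algebra_simps)

lemma sm_add: "sm c (p + q) = sm c p + sm c (q :: 'm::monoid_add \<Rightarrow>\<^sub>0 'k::field)"
  by (simp add: sm_eq_mult algebra_simps)

lemma sm_add_left: "sm (c + d) p = sm c p + sm d (p :: 'm::monoid_add \<Rightarrow>\<^sub>0 'k::field)"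
  by (simp add: sm_eq_mult single_add algebra_simps)

lemma sm_mult_left: "sm c p * q = sm c (p * q :: 'm::monoid_add \<Rightarrow>\<^sub>0 'k::field)"
  by (simp add: sm_eq_mult algebra_simps)

lemma sm_mult_right: "p * sm c q = sm c (p * q :: 'm::monoid_add \<Rightarrow>\<^sub>0 'k::field)"
  by (metis (no_types) sm_eq_mult scalar_commute mult.assoc)

lemma sm_sm: "sm c (sm d p) = sm (c * d) (p :: 'm::monoid_add \<Rightarrow>\<^sub>0 'k::field)"
  by (simp add: sm_eq_mult mult.assoc[symmetric] mult_single)

lemma sm_one [simp]: "sm 1 p = (p :: 'm::monoid_add \<Rightarrow>\<^sub>0 'k::field)"
  by (simp add: sm_eq_mult)

lemma sm_zero [simp]: "sm c 0 = (0 :: 'm::monoid_add \<Rightarrow>\<^sub>0 'k::field)"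
  by (simp add: sm_eq_mult)

lemma sm_zero_left [simp]: "sm 0 p = (0 :: 'm::monoid_add \<Rightarrow>\<^sub>0 'k::field)"
  by (simp add: sm_eq_mult)

lemma sm_single: "sm c (Poly_Mapping.single w d) = Poly_Mapping.single w (c * d :: 'k::field)"
  for w :: "'m::monoid_add"
  by (simp add: sm_eq_mult mult_single)

lemma sm_of_int: "sm (of_int n) p = of_int n * (p :: 'm::monoid_add \<Rightarrow>\<^sub>0 'k::field)"
  by (simp add: sm_eq_mult)

definition linext :: "('m \<Rightarrow> 'n::monoid_add \<Rightarrow>\<^sub>0 'k::field) \<Rightarrow> ('m \<Rightarrow>\<^sub>0 'k) \<Rightarrow> 'n \<Rightarrow>\<^sub>0 'k" where
  "linext f p = (\<Sum>w\<in>Poly_Mapping.keys p. sm (Poly_Mapping.lookup p w) (f w))"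

lemma linext_add: "linext f (p + q) = linext f p + linext f q"
  unfolding linext_def by (rule setsum_keys_plus_distrib) (simp_all add: sm_add_left)

lemma linext_single: "linext f (Poly_Mapping.single w c) = sm c (f w)"
  by (simp add: linext_def)

lemma linext_zero [simp]: "linext f 0 = 0"
  by (simp add: linext_def)

lemma linext_mult:
  fixes p q :: "'m::monoid_add \<Rightarrow>\<^sub>0 'k::field"
  assumes "\<And>u v. f (u + v) = f u * f v"
  shows "linext f (p * q) = linext f p * linext f q"
proof (induction p rule: poly_mapping_additive_induct)
  case (single w c)
  show ?case
    by (induction q rule: poly_mapping_additive_induct)
       (auto simp: mult_single linext_single linext_add assms sm_mult_left sm_mult_right sm_sm
         algebra_simps)
qed (auto simp: linext_add algebra_simps)

lemma fhom_eq_linext: "fhom \<phi> = linext (\<lambda>w. prod_list (map \<phi> (letters w)))"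
  by (simp add: fun_eq_iff fhom_def linext_def)

lemma fhom_add: "fhom \<phi> (p + q) = fhom \<phi> p + fhom \<phi> (q :: ('k::field, 'x) falg)"
  by (simp add: fhom_eq_linext linext_add)

lemma fhom_zero [simp]: "fhom \<phi> 0 = (0 :: ('k::field, 'x) falg)"
  by (simp add: fhom_eq_linext)

lemma fhom_mult: "fhom \<phi> (p * q) = fhom \<phi> p * fhom \<phi> (q :: ('k::field, 'x) falg)"
  unfolding fhom_eq_linext by (rule linext_mult) (simp add: plus_word_def)

lemma fhom_sm: "fhom \<phi> (sm c p) = sm c (fhom \<phi> (p :: ('k::field, 'x) falg))"
  by (simp add: sm_eq_mult fhom_mult)
     (simp add: fhom_eq_linext linext_single zero_word_def sm_eq_mult)

lemma fhom_one [simp]: "fhom \<phi> 1 = (1 :: ('k::field, 'x) falg)"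
  by (simp flip: single_one add: fhom_eq_linext linext_single zero_word_def)

lemma fhom_ltr [simp]: "fhom \<phi> (ltr x) = (\<phi> x :: ('k::field, 'y) falg)"
  by (simp add: ltr_def fhom_eq_linext linext_single)

lemma fhom_uminus: "fhom \<phi> (- p) = - fhom \<phi> (p :: ('k::field, 'x) falg)"
  by (metis add.inverse_unique fhom_add fhom_zero right_minus)

lemma fhom_diff: "fhom \<phi> (p - q) = fhom \<phi> p - fhom \<phi> (q :: ('k::field, 'x) falg)"
  by (metis diff_conv_add_uminus fhom_add fhom_uminus)

lemma fhom_sum: "fhom \<phi> (sum f A) = (\<Sum>x\<in>A. fhom \<phi> (f x :: ('k::field, 'x) falg))"
  by (induction A rule: infinite_finite_induct) (auto simp: fhom_add)

lemma fhom_prod_list: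
  "fhom \<phi> (prod_list xs) = prod_list (map (fhom \<phi>) (xs :: ('k::field, 'x) falg list))"
  by (induction xs) (auto simp: fhom_mult)

lemmas fhom_simps = fhom_add fhom_mult fhom_sm fhom_uminus fhom_diff fhom_sum fhom_prod_list

lemma falg_induct [case_names one ltr add mult scale]:
  fixes p :: "('k::field, 'x) falg"
  assumes one: "P 1" and ltr: "\<And>x. P (ltr x)"
    and add: "\<And>p q. P p \<Longrightarrow> P q \<Longrightarrow> P (p + q)"
    and mult: "\<And>p q. P p \<Longrightarrow> P q \<Longrightarrow> P (p * q)" and scale: "\<And>c p. P p \<Longrightarrow> P (sm c p)"
  shows "P p"
proof (induction p rule: poly_mapping_additive_induct)
  case zero
  from scale[OF one, of 0] show ?case by simp
next
  case (single w c)
  have "P (Poly_Mapping.single (Word xs) 1)" for xs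
  proof (induction xs)
    case Nil
    from one show ?case by (metis single_one zero_word_def)
  next
    case (Cons x xs)
    have "Poly_Mapping.single (Word (x # xs)) 1 = ltr x * Poly_Mapping.single (Word xs) (1::'k)"
      by (simp add: ltr_def mult_single plus_word_def)
    then show ?case using mult[OF ltr Cons] by simp
  qed
  from scale[OF this, of c "letters w"] show ?case by (simp add: sm_single)
qed (use add in auto)

lemma fhom_comp: "fhom \<phi> (fhom \<psi> p) = fhom (\<lambda>x. fhom \<phi> (\<psi> x)) (p :: ('k::field, 'x) falg)"
  by (induction p rule: falg_induct) (simp_all add: fhom_simps)

lemma fhom_id: "fhom ltr p = (p :: ('k::field, 'x) falg)"
  by (induction p rule: falg_induct) (simp_all add: fhom_simps)

section \<open>Tensor squares of free algebras\<close>

lemma tens_add_left: "tens (p + p') q = tens p q + tens p' (q :: ('k::field, 'x) falg)"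
  by (intro poly_mapping_eqI) (auto simp: tens.rep_eq lookup_add algebra_simps)

lemma tens_add_right: "tens p (q + q') = tens p q + tens p (q' :: ('k::field, 'x) falg)"
  by (intro poly_mapping_eqI) (auto simp: tens.rep_eq lookup_add algebra_simps)

lemma tens_zero_left [simp]: "tens 0 q = (0 :: ('k::field, 'x) ftens)"
  by (intro poly_mapping_eqI) (auto simp: tens.rep_eq)

lemma tens_zero_right [simp]: "tens q 0 = (0 :: ('k::field, 'x) ftens)"
  by (intro poly_mapping_eqI) (auto simp: tens.rep_eq)

lemma tens_single:
  "tens (Poly_Mapping.single u a) (Poly_Mapping.single v b) = Poly_Mapping.single (u, v) (a * b :: 'k::field)"
  by (intro poly_mapping_eqI) (auto simp: tens.rep_eq lookup_single when_def split: if_splits)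

lemma tens_mult: "tens p q * tens p' q' = tens (p * p') (q * q' :: ('k::field, 'x) falg)"
proof (induction p rule: poly_mapping_additive_induct)
  case (single w c)
  show ?case
  proof (induction q rule: poly_mapping_additive_induct)
    case (single v d)
    show ?case
    proof (induction p' rule: poly_mapping_additive_induct)
      case (single w' c')
      show ?case
        by (induction q' rule: poly_mapping_additive_induct)
           (auto simp: tens_single mult_single tens_add_right algebra_simps)
    qed (auto simp: tens_add_left algebra_simps)
  qed (auto simp: tens_add_right algebra_simps)
qed (auto simp: tens_add_left algebra_simps)

lemma sm_tens_left: "tens (sm c p) q = sm c (tens p (q :: ('k::field, 'x) falg))"
proof (induction p rule: poly_mapping_additive_induct)
  case (single w d)
  show ?case by (induction q rule: poly_mapping_additive_induct)
    (auto simp: sm_single tens_single tens_add_right sm_add mult.assoc)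
qed (auto simp: tens_add_left sm_add)

lemma sm_tens_right: "tens p (sm c q) = sm c (tens p (q :: ('k::field, 'x) falg))"
proof (induction p rule: poly_mapping_additive_induct)
  case (single w d)
  show ?case by (induction q rule: poly_mapping_additive_induct)
    (auto simp: sm_single tens_single tens_add_right sm_add algebra_simps)
qed (auto simp: tens_add_left sm_add)

lemma ftens_induct [case_names tens add]:
  fixes S :: "('k::field, 'x) ftens"
  assumes tens: "\<And>p q. P (tens p q)" and add: "\<And>S T. P S \<Longrightarrow> P T \<Longrightarrow> P (S + T)"
  shows "P S"
proof (induction S rule: poly_mapping_additive_induct)
  case zero
  from tens[of 0 0] show ?case by simp
next
  case (single w c)
  have "Poly_Mapping.single w c
      = tens (Poly_Mapping.single (fst w) c) (Poly_Mapping.single (snd w) 1)"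
    by (simp add: tens_single)
  then show ?case using tens by simp
qed (use add in auto)

lemma tswap_add: "tswap (S + T) = tswap S + tswap (T :: ('k::field, 'x) ftens)"
  by (intro poly_mapping_eqI) (auto simp: tswap.rep_eq lookup_add)

lemma tswap_zero [simp]: "tswap 0 = (0 :: ('k::field, 'x) ftens)"
  by (intro poly_mapping_eqI) (auto simp: tswap.rep_eq)

lemma tswap_uminus: "tswap (- S) = - tswap (S :: ('k::field, 'x) ftens)"
  by (intro poly_mapping_eqI) (auto simp: tswap.rep_eq)

lemma tswap_diff: "tswap (S - T) = tswap S - tswap (T :: ('k::field, 'x) ftens)"
  by (intro poly_mapping_eqI) (auto simp: tswap.rep_eq lookup_minus)

lemma tswap_tens [simp]: "tswap (tens p q) = tens q (p :: ('k::field, 'x) falg)"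
  by (intro poly_mapping_eqI) (auto simp: tswap.rep_eq tens.rep_eq)

lemma tswap_mult: "tswap (S * T) = tswap S * tswap (T :: ('k::field, 'x) ftens)"
proof (induction S rule: ftens_induct)
  case (tens p q)
  show ?case by (induction T rule: ftens_induct) (auto simp: tens_mult tswap_add algebra_simps)
qed (auto simp: tswap_add algebra_simps)

lemma tswap_sm: "tswap (sm c S) = sm c (tswap (S :: ('k::field, 'x) ftens))"
  by (induction S rule: ftens_induct)
     (auto simp: tswap_add sm_add sm_tens_right simp flip: sm_tens_left)

lemma thom_eq_linext: "thom \<phi> = linext (\<lambda>uv. tens (prod_list (map \<phi> (letters (fst uv))))
    (prod_list (map \<phi> (letters (snd uv)))))"
  by (simp add: fun_eq_iff thom_def linext_def)

lemma thom_add: "thom \<phi> (S + T) = thom \<phi> S + thom \<phi> (T :: ('k::field, 'x) ftens)"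
  by (simp add: thom_eq_linext linext_add)

lemma thom_zero [simp]: "thom \<phi> 0 = (0 :: ('k::field, 'x) ftens)"
  by (simp add: thom_eq_linext)

lemma thom_mult: "thom \<phi> (S * T) = thom \<phi> S * thom \<phi> (T :: ('k::field, 'x) ftens)"
  unfolding thom_eq_linext by (rule linext_mult) (simp add: plus_word_def tens_mult)

lemma thom_tens [simp]: "thom \<phi> (tens p q) = tens (fhom \<phi> p) (fhom \<phi> (q :: ('k::field, 'x) falg))"
proof (induction p rule: poly_mapping_additive_induct)
  case (single w d)
  show ?case by (induction q rule: poly_mapping_additive_induct)
    (auto simp: tens_single thom_eq_linext fhom_eq_linext linext_single linext_add
      tens_add_right sm_tens_left sm_tens_right sm_sm mult.commute)
qed (auto simp: tens_add_left thom_add fhom_add)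

lemma thom_sm: "thom \<phi> (sm c S) = sm c (thom \<phi> (S :: ('k::field, 'x) ftens))"
  by (induction S rule: ftens_induct)
     (auto simp: thom_add sm_add fhom_sm simp flip: sm_tens_left)

lemma thom_tswap: "thom \<phi> (tswap S) = tswap (thom \<phi> (S :: ('k::field, 'x) ftens))"
  by (induction S rule: ftens_induct) (auto simp: thom_add tswap_add)

section \<open>Ideals\<close>

definition is_ideal :: "'a::ring set \<Rightarrow> bool" where
  "is_ideal J \<longleftrightarrow> 0 \<in> J \<and> (\<forall>p\<in>J. \<forall>q\<in>J. p + q \<in> J) \<and> (\<forall>p\<in>J. \<forall>u. u * p \<in> J \<and> p * u \<in> J)"

lemma is_idealD:
  assumes "is_ideal J"
  shows "0 \<in> J" "p \<in> J \<Longrightarrow> q \<in> J \<Longrightarrow> p + q \<in> J" "p \<in> J \<Longrightarrow> u * p \<in> J" "p \<in> J \<Longrightarrow> p * u \<in> J"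
  using assms by (auto simp: is_ideal_def)

lemma is_ideal_uminus:
  fixes J :: "'a::ring_1 set"
  assumes "is_ideal J" "p \<in> J"
  shows "- p \<in> J"
  using is_idealD(3)[OF assms, of "-1"] by simp

lemma is_ideal_diff:
  fixes J :: "'a::ring_1 set"
  assumes "is_ideal J" "p \<in> J" "q \<in> J"
  shows "p - q \<in> J"
  using is_idealD(2)[OF assms(1,2) is_ideal_uminus[OF assms(1,3)]] by simp

lemma is_ideal_tideal: "is_ideal (tideal (R :: 'a::ring_1 set))"
  unfolding is_ideal_def
  using tideal.zero[of R] tideal.add[of _ R] tideal.mult[of _ R _ 1] tideal.mult[of _ R 1]
  by auto

lemma fhom_tideal_subset:
  assumes "is_ideal J" "\<And>r. r \<in> R \<Longrightarrow> fhom \<phi> r \<in> J" "p \<in> tideal R"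
  shows "fhom \<phi> (p :: ('k::field, 'x) falg) \<in> J"
  using assms(3)
  by (induction rule: tideal.induct) (auto simp: fhom_simps assms(2) is_idealD[OF assms(1)])

text \<open>Pure tensors span the tensor square and multiply generators of the kernel slot by slot,
  so closure reduces to \<open>J\<close> being an ideal. The quotient by the kernel can therefore be
  represented in the same way as the quotient by \<open>J\<close>.\<close>

lemma is_ideal_tens_ker:
  fixes J :: "('k::field, 'x) falg set"
  assumes J: "is_ideal J"
  shows "is_ideal (tens_ker J)"
proof -
  have left: "U * S \<in> tens_ker J" if "S \<in> tens_ker J" for U S
  proof (induction U rule: ftens_induct)
    case (tens p q)
    from that show ?case
      by (induction rule: tens_ker.induct)
         (auto simp: tens_mult sm_mult_right distrib_left intro: tens_ker.intros is_idealD[OF J])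
  qed (auto simp: distrib_right intro: tens_ker.intros)
  have right: "S * U \<in> tens_ker J" if "S \<in> tens_ker J" for U S
  proof (induction U rule: ftens_induct)
    case (tens p q)
    from that show ?case
      by (induction rule: tens_ker.induct)
         (auto simp: tens_mult sm_mult_left distrib_right intro: tens_ker.intros is_idealD[OF J])
  qed (auto simp: distrib_left intro: tens_ker.intros)
  from left right show ?thesis by (auto simp: is_ideal_def intro: tens_ker.intros)
qed

lemma tswap_tens_ker: "S \<in> tens_ker J \<Longrightarrow> tswap S \<in> tens_ker J"
  by (induction rule: tens_ker.induct) (auto simp: tswap_add tswap_sm intro: tens_ker.intros)

lemma thom_tens_ker:
  assumes "\<And>p. p \<in> J \<Longrightarrow> fhom \<phi> p \<in> J'" "S \<in> tens_ker J"
  shows "thom \<phi> S \<in> tens_ker J'"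
  using assms(2)
  by (induction rule: tens_ker.induct) (auto simp: thom_add thom_sm assms(1) intro: tens_ker.intros)

section \<open>Representing quotients by additive endomorphisms\<close>

typedef (overloaded) 'a endo = "{f :: 'a::ab_group_add \<Rightarrow> 'a. \<forall>x y. f (x + y) = f x + f y}"
  morphisms app_endo Abs_endo by (rule exI[of _ "\<lambda>x. x"]) auto

setup_lifting type_definition_endo

instantiation endo :: (ab_group_add) ring
begin
lift_definition zero_endo :: "'a endo" is "\<lambda>x. 0" by simp
lift_definition plus_endo :: "'a endo \<Rightarrow> 'a endo \<Rightarrow> 'a endo" is "\<lambda>f g x. f x + g x"
  by (simp add: algebra_simps)
lift_definition uminus_endo :: "'a endo \<Rightarrow> 'a endo" is "\<lambda>f x. - f x" by simp
lift_definition minus_endo :: "'a endo \<Rightarrow> 'a endo \<Rightarrow> 'a endo" is "\<lambda>f g x. f x - g x"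
  by (simp add: algebra_simps)
lift_definition times_endo :: "'a endo \<Rightarrow> 'a endo \<Rightarrow> 'a endo" is "\<lambda>f g x. f (g x)"
  by simp
instance by standard (transfer; simp add: fun_eq_iff algebra_simps)+
end

instantiation endo :: ("{ab_group_add,zero_neq_one}") ring_1
begin
lift_definition one_endo :: "'a endo" is "\<lambda>x. x" by simp
text \<open>\<open>ring_1\<close> demands that 0 and 1 differ; the zero map and the identity are
  separated by their values at 1.\<close>

instance by standard (transfer; auto simp: fun_eq_iff intro!: exI[of _ 1])+
end

text \<open>A quotient \<open>A/J\<close> has no type of its own, since \<open>J\<close> depends on parameters. Instead \<open>A/J\<close>
  acts on the image of a linear projection \<open>A \<rightarrow> A\<close> with kernel \<open>J\<close>, which represents it faithfully
  (but without preserving the unit) in the additive endomorphisms of \<open>A\<close>.\<close>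

lemma ideal_eq_kernel:
  fixes J :: "('m::monoid_add \<Rightarrow>\<^sub>0 'k::field) set"
  assumes J: "is_ideal J"
  obtains \<Lambda> :: "('m \<Rightarrow>\<^sub>0 'k) \<Rightarrow> ('m \<Rightarrow>\<^sub>0 'k) endo"
  where "\<And>p q. \<Lambda> (p + q) = \<Lambda> p + \<Lambda> q" "\<And>p q. \<Lambda> (p * q) = \<Lambda> p * \<Lambda> q"
    "\<And>p. \<Lambda> p = 0 \<longleftrightarrow> p \<in> J"
proof -
  interpret vs: vector_space "sm :: 'k \<Rightarrow> ('m \<Rightarrow>\<^sub>0 'k) \<Rightarrow> _"
    by standard (auto simp: sm_add sm_add_left sm_sm)
  interpret vp: vector_space_pair "sm :: 'k \<Rightarrow> ('m \<Rightarrow>\<^sub>0 'k) \<Rightarrow> _" "sm :: 'k \<Rightarrow> ('m \<Rightarrow>\<^sub>0 'k) \<Rightarrow> _" ..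
  have sub: "vs.subspace J"
    by (auto simp: vs.subspace_def is_idealD[OF J] sm_eq_mult)
  \<comment> \<open>A left inverse on \<open>J\<close> of the identity map is a linear retraction
    \<open>g\<close> onto \<open>J\<close>; the map \<open>v - g v\<close> then has kernel exactly
    \<open>J\<close>.\<close>
  have "\<exists>g. g ` UNIV \<subseteq> J \<and> Vector_Spaces.linear sm sm g \<and> (\<forall>v\<in>J. g (id v) = v)"
    by (rule vp.linear_exists_left_inverse_on[OF vs.linear_id sub]) auto
  then obtain g where g: "range g \<subseteq> J" "Vector_Spaces.linear sm sm g" "\<And>v. v \<in> J \<Longrightarrow> g v = v"
    by auto
  interpret g: Vector_Spaces.linear sm sm g by fact
  define \<pi> where "\<pi> v = v - g v" for v
  have \<pi>_add: "\<pi> (x + y) = \<pi> x + \<pi> y" for x y by (simp add: \<pi>_def g.add)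
  have \<pi>_diff: "\<pi> (x - y) = \<pi> x - \<pi> y" for x y by (simp add: \<pi>_def g.diff)
  have \<pi>_0: "\<pi> v = 0 \<longleftrightarrow> v \<in> J" for v
    using g(1,3) by (force simp: \<pi>_def)
  have diff_J: "v - \<pi> v \<in> J" for v using g(1) by (auto simp: \<pi>_def)
  have \<pi>_mult: "\<pi> (p * \<pi> v) = \<pi> (p * v)" for p v
  proof -
    have "\<pi> (p * v) - \<pi> (p * \<pi> v) = \<pi> (p * (v - \<pi> v))"
      by (simp add: \<pi>_diff algebra_simps)
    moreover have "\<pi> (p * (v - \<pi> v)) = 0"
      unfolding \<pi>_0 by (intro is_idealD(3)[OF J] diff_J)
    ultimately show ?thesis by simp
  qed
  define \<Lambda> where "\<Lambda> p = Abs_endo (\<lambda>v. \<pi> (p * \<pi> v))" for p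
  have app: "app_endo (\<Lambda> p) v = \<pi> (p * v)" for p v
    by (simp add: \<Lambda>_def Abs_endo_inverse \<pi>_add distrib_left \<pi>_mult)
  show thesis
  proof
    show "\<Lambda> (p + q) = \<Lambda> p + \<Lambda> q" for p q
      by (simp add: app_endo_inject[symmetric] fun_eq_iff app plus_endo.rep_eq distrib_right \<pi>_add)
    show "\<Lambda> (p * q) = \<Lambda> p * \<Lambda> q" for p q
      by (simp add: app_endo_inject[symmetric] fun_eq_iff app times_endo.rep_eq mult.assoc \<pi>_mult)
    show "\<Lambda> p = 0 \<longleftrightarrow> p \<in> J" for p
    proof
      assume "\<Lambda> p = 0"
      \<comment> \<open>Evaluation at 1 recovers \<open>\<pi> p\<close>, which vanishes only for
        \<open>p\<close> in \<open>J\<close>.\<close>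
      then have "\<pi> (p * 1) = 0" by (metis app zero_endo.rep_eq)
      then show "p \<in> J" by (simp add: \<pi>_0)
    next
      assume "p \<in> J"
      then show "\<Lambda> p = 0"
        by (simp add: app_endo_inject[symmetric] fun_eq_iff app zero_endo.rep_eq \<pi>_0
            is_idealD[OF J])
    qed
  qed
qed

section \<open>Calculus of double brackets\<close>

text \<open>In the following locale \<open>L p\<close> and \<open>R p\<close> stand for \<open>p \<otimes> 1\<close> and \<open>1 \<otimes> p\<close> in a ring
  representing \<open>(A/J) \<otimes> (A/J)\<close>, \<open>D\<close> is twice a double bracket (so that all coefficients below are
  integers), and \<open>S\<close> is the graph of the exchange of the two tensor factors.\<close>

locale double_bracket_rep =
  fixes J :: "'r::ring_1 set" and L R :: "'r \<Rightarrow> 't::ring_1"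
    and D :: "'r \<Rightarrow> 'r \<Rightarrow> 't" and S :: "'t \<Rightarrow> 't \<Rightarrow> bool"
  assumes L_add: "L (p + q) = L p + L q" and L_mult: "L (p * q) = L p * L q"
    and L_J: "p \<in> J \<Longrightarrow> L p = 0"
    and R_add: "R (p + q) = R p + R q" and R_mult: "R (p * q) = R p * R q"
    and R_J: "p \<in> J \<Longrightarrow> R p = 0"
    and R_L: "R q * L p = L p * R q"
    and D_add_left: "D (p + p') q = D p q + D p' q"
    and D_add_right: "D p (q + q') = D p q + D p q'"
    and D_J_left: "p \<in> J \<Longrightarrow> D p q = 0" and D_J_right: "q \<in> J \<Longrightarrow> D p q = 0"
    and D_mult_right: "D p (q * r) = D p q * R r + L q * D p r"
    and D_mult_left: "D (p * q) r = D p r * L q + R p * D q r"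
    and S_tens: "S (L p * R q) (L q * R p)"
    and S_add: "S u u' \<Longrightarrow> S v v' \<Longrightarrow> S (u + v) (u' + v')"
    and S_uminus: "S u u' \<Longrightarrow> S (- u) (- u')"
    and S_unique: "S u v \<Longrightarrow> S u v' \<Longrightarrow> v = v'"
    and S_D: "S (D p q) (- D q p)"
begin

lemma S_tens3: "S (L p * (L q * R r)) (L r * (R p * R q))" "S (L r * (R p * R q)) (L p * (L q * R r))"
  using S_tens[of "p * q" r] S_tens[of r "p * q"] by (simp_all add: L_mult R_mult mult.assoc)

lemma S_diff: "S u u' \<Longrightarrow> S v v' \<Longrightarrow> S (u - v) (u' - v')"
  using S_add[of u u' "- v" "- v'"] S_uminus[of v v'] by simp

lemma S_of_int:
  assumes "S u u'"
  shows "S (of_int n * u) (of_int n * u')"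
proof (induction n rule: int_induct[where k = 0])
  case base
  from S_diff[OF assms assms] show ?case by simp
next
  case (step1 i)
  from S_add[OF step1(2) assms] show ?case by (simp add: algebra_simps)
next
  case (step2 i)
  from S_diff[OF step2(2) assms] show ?case by (simp add: algebra_simps)
qed

lemma S_zero: "S 0 0"
  using S_of_int[OF S_tens, of 0] by simp

lemma R_L_left: "R q * (L p * u) = L p * (R q * u)"
  by (metis R_L mult.assoc)

lemma L_of_int_left: "L p * (of_int n * u) = of_int n * (L p * u)"
  by (metis mult.assoc mult_of_int_commute)

lemma R_of_int_left: "R p * (of_int n * u) = of_int n * (R p * u)"
  by (metis mult.assoc mult_of_int_commute)

text \<open>Brings every monomial into the shape integer, factors \<open>L\<close>, factors
  \<open>R\<close>, nested to the right. Brackets of generators are then compared as integer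
  combinations of such monomials.\<close>

lemmas tensor_nf = mult.assoc R_L R_L_left L_of_int_left R_of_int_left
  distrib_left distrib_right left_diff_distrib right_diff_distrib

lemma L_cong: "p - q \<in> J \<Longrightarrow> L p = L q"
  using L_add[of "p - q" q] L_J by simp

lemma R_cong: "p - q \<in> J \<Longrightarrow> R p = R q"
  using R_add[of "p - q" q] R_J by simp

lemma D_cong_left: "p - q \<in> J \<Longrightarrow> D p r = D q r"
  using D_add_left[of "p - q" q] D_J_left by simp

lemma D_cong_right: "p - q \<in> J \<Longrightarrow> D r p = D r q"
  using D_add_right[of _ "p - q" q] D_J_right by simp

lemma L_zero [simp]: "L 0 = 0" using L_add[of 0 0] by simp
lemma R_zero [simp]: "R 0 = 0" using R_add[of 0 0] by simp
lemma L_uminus [simp]: "L (- p) = - L p"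
  using L_add[of "- p" p] by (simp add: eq_neg_iff_add_eq_0)
lemma R_uminus [simp]: "R (- p) = - R p"
  using R_add[of "- p" p] by (simp add: eq_neg_iff_add_eq_0)
lemma D_zero [simp]: "D 0 q = 0" "D q 0 = 0"
  using D_add_left[of 0 0 q] D_add_right[of q 0 0] by simp_all
lemma D_uminus [simp]: "D (- p) q = - D p q" "D q (- p) = - D q p"
  using D_add_left[of "- p" p q] D_add_right[of q "- p" p] by (simp_all add: eq_neg_iff_add_eq_0)

end

text \<open>\<open>f\<close> is a unit of the corner at \<open>e\<close> modulo \<open>J\<close>,
  with inverse \<open>w\<close>; in the applications it is a factor of the moment map. Since
  \<open>L\<close> and \<open>R\<close> need not preserve 1, the idempotent cannot be simplified
  away globally, only by absorption into \<open>f\<close>, \<open>w\<close> or itself.\<close>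

locale local_unit = double_bracket_rep J L R D S
  for J :: "'r::ring_1 set" and L R :: "'r \<Rightarrow> 't::ring_1" and D S +
  fixes e f w :: 'r
  assumes ee: "e * e - e \<in> J" and ef: "e * f - f \<in> J" and fe: "f * e - f \<in> J"
    and ew: "e * w - w \<in> J" and we: "w * e - w \<in> J"
    and fw: "f * w - e \<in> J" and wf: "w * f - e \<in> J"
    and De: "D e q = 0" "D q e = 0"
begin

lemma L_unit:
  "L e * L e = L e" "L e * L f = L f" "L f * L e = L f" "L e * L w = L w" "L w * L e = L w"
  "L f * L w = L e" "L w * L f = L e"
  "L e * (L e * u) = L e * u" "L e * (L f * u) = L f * u" "L f * (L e * u) = L f * u"
  "L e * (L w * u) = L w * u" "L w * (L e * u) = L w * u"
  "L f * (L w * u) = L e * u" "L w * (L f * u) = L e * u"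
  using L_cong[OF ee] L_cong[OF ef] L_cong[OF fe] L_cong[OF ew] L_cong[OF we] L_cong[OF fw] L_cong[OF wf]
  by (simp_all add: L_mult flip: mult.assoc)

lemma R_unit:
  "R e * R e = R e" "R e * R f = R f" "R f * R e = R f" "R e * R w = R w" "R w * R e = R w"
  "R f * R w = R e" "R w * R f = R e"
  "R e * (R e * u) = R e * u" "R e * (R f * u) = R f * u" "R f * (R e * u) = R f * u"
  "R e * (R w * u) = R w * u" "R w * (R e * u) = R w * u"
  "R f * (R w * u) = R e * u" "R w * (R f * u) = R e * u"
  using R_cong[OF ee] R_cong[OF ef] R_cong[OF fe] R_cong[OF ew] R_cong[OF we] R_cong[OF fw] R_cong[OF wf]
  by (simp_all add: R_mult flip: mult.assoc)

text \<open>Apply the derivation in the first argument to \<open>f * w = e\<close>. The result is 0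
  because \<open>D\<close> kills \<open>e\<close>; multiplication by \<open>R w\<close> isolates
  \<open>R e * D w y\<close>, and \<open>R e\<close> is absorbed because \<open>e * w\<close>
  represents \<open>w\<close>.\<close>

lemma D_inverse_left: "D w y = - (R w * D f y * L w)"
proof -
  have "D f y * L w + R f * D w y = 0"
    using D_cong_left[OF fw, of y] by (simp add: D_mult_left De)
  then have "R w * (D f y * L w + R f * D w y) = 0" by simp
  moreover have "R e * D w y = D w y"
    using D_cong_left[OF ew, of y] by (simp add: D_mult_left De)
  ultimately show ?thesis
    by (simp add: distrib_left R_unit mult.assoc eq_neg_iff_add_eq_0 add.commute)
qed

lemma D_inverse_right: "D y w = - (L w * D y f * R w)"
proof -
  have "D y f * R w + L f * D y w = 0"
    using D_cong_right[OF fw, of y] by (simp add: D_mult_right De)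
  then have "L w * (D y f * R w + L f * D y w) = 0" by simp
  moreover have "L e * D y w = D y w"
    using D_cong_right[OF ew, of y] by (simp add: D_mult_right De)
  ultimately show ?thesis
    by (simp add: distrib_left L_unit mult.assoc eq_neg_iff_add_eq_0 add.commute)
qed

lemma local_unit_inverse: "local_unit J L R D S e w f"
  by unfold_locales (fact ee ef fe ew we fw wf De)+

end

text \<open>Twice the prescribed value of \<open>{{b, c}}\<close>. The four order terms run over the pairs of half-edges of
  \<open>b\<close> and \<open>c\<close>; since the signs vanish unless both half-edges sit at the given vertex, they also account for
  the cases \<open>c = b\<close> and \<open>c = b\<^sup>*\<close>.\<close>

definition bracket_formula :: "('r \<Rightarrow> 't) \<Rightarrow> ('r \<Rightarrow> 't) \<Rightarrow> ('d \<Rightarrow> 'd) \<Rightarrow> ('d \<Rightarrow> 'v) \<Rightarrow> ('v \<Rightarrow> 'r)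
    \<Rightarrow> ('d \<Rightarrow> bool) \<Rightarrow> ('v \<Rightarrow> 'd \<Rightarrow> 'd \<Rightarrow> int) \<Rightarrow> ('d \<Rightarrow> 'r) \<Rightarrow> 'd \<Rightarrow> 'd \<Rightarrow> 't::ring_1" where
  "bracket_formula L R star tail e pos os y b c =
     - (of_int (os (tail b) b c) * (L (y b) * R (y c)))
     - of_int (os (tail (star b)) (star b) (star c)) * (L (y c) * R (y b))
     + of_int (os (tail b) b (star c)) * (L (y c) * (L (y b) * R (e (tail b))))
     + of_int (os (tail (star b)) (star b) c) * (L (e (tail (star b))) * (R (y b) * R (y c)))
     + (if c = star b then of_int (if pos b then 1 else -1) *
          (L (e (tail (star b))) * R (e (tail b)) + L (e (tail (star b))) * R (e (tail b))
           + L (y c) * (L (y b) * R (e (tail b))) + L (e (tail (star b))) * (R (y b) * R (y c)))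
        else 0)"

text \<open>The generators of the localised path algebra as seen by a double bracket with values in
  an arbitrary ring. The head of an arrow is the tail of its star. The same axioms serve for a
  bracket pulled back from another algebra, where \<open>L\<close>, \<open>R\<close> and
  \<open>D\<close> are evaluated on images of the generators.\<close>

locale quiver_family = double_bracket_rep J L R D S
  for J :: "'r::ring_1 set" and L R :: "'r \<Rightarrow> 't::ring_1" and D S +
  fixes H :: "'d set" and star :: "'d \<Rightarrow> 'd" and tl :: "'d \<Rightarrow> 'v"
    and e :: "'v \<Rightarrow> 'r" and x z :: "'d \<Rightarrow> 'r"
  assumes star_star [simp]: "star (star b) = b" and star_neq [simp]: "star b \<noteq> b"
    and star_H [simp]: "b \<in> H \<Longrightarrow> star b \<in> H"
    and ee: "b \<in> H \<Longrightarrow> e (tl b) * e (tl b) - e (tl b) \<in> J"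
    and ex: "b \<in> H \<Longrightarrow> e (tl b) * x b - x b \<in> J"
    and xe: "b \<in> H \<Longrightarrow> x b * e (tl (star b)) - x b \<in> J"
    and ez: "b \<in> H \<Longrightarrow> e (tl b) * z b - z b \<in> J"
    and ze: "b \<in> H \<Longrightarrow> z b * e (tl b) - z b \<in> J"
    and eg: "b \<in> H \<Longrightarrow> e (tl b) * (e (tl b) + x b * x (star b)) - (e (tl b) + x b * x (star b)) \<in> J"
    and ge: "b \<in> H \<Longrightarrow> (e (tl b) + x b * x (star b)) * e (tl b) - (e (tl b) + x b * x (star b)) \<in> J"
    and zg: "b \<in> H \<Longrightarrow> z b * (e (tl b) + x b * x (star b)) - e (tl b) \<in> J"
    and gz: "b \<in> H \<Longrightarrow> (e (tl b) + x b * x (star b)) * z b - e (tl b) \<in> J"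
    and De: "b \<in> H \<Longrightarrow> D (e (tl b)) q = 0" "b \<in> H \<Longrightarrow> D q (e (tl b)) = 0"
begin

lemma neq_star [simp]: "b \<noteq> star b"
  using star_neq[of b] by metis

lemma L_arrow:
  assumes "b \<in> H"
  shows "L (e (tl b)) * L (x b) = L (x b)" "L (x b) * L (e (tl (star b))) = L (x b)"
    "L (e (tl b)) * (L (x b) * u) = L (x b) * u" "L (x b) * (L (e (tl (star b))) * u) = L (x b) * u"
    "L (e (tl b)) * L (e (tl b)) = L (e (tl b))"
  using L_cong[OF ex[OF assms]] L_cong[OF xe[OF assms]] L_cong[OF ee[OF assms]]
  by (simp_all add: L_mult flip: mult.assoc)

lemma R_arrow:
  assumes "b \<in> H"
  shows "R (e (tl b)) * R (x b) = R (x b)" "R (x b) * R (e (tl (star b))) = R (x b)"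
    "R (e (tl b)) * (R (x b) * u) = R (x b) * u" "R (x b) * (R (e (tl (star b))) * u) = R (x b) * u"
    "R (e (tl b)) * R (e (tl b)) = R (e (tl b))"
  using R_cong[OF ex[OF assms]] R_cong[OF xe[OF assms]] R_cong[OF ee[OF assms]]
  by (simp_all add: R_mult flip: mult.assoc)

text \<open>Orientations vary in the proof: \<open>pos b\<close> says that \<open>b\<close> counts as an arrow of the quiver itself, that is,
  \<open>\<epsilon>(b) = 1\<close>; \<open>mfac\<close> is the factor of \<open>b\<close> in the moment map.\<close>

definition mfac :: "('d \<Rightarrow> bool) \<Rightarrow> 'd \<Rightarrow> 'r" where
  "mfac pos b = (if pos b then e (tl b) + x b * x (star b) else z b)"

definition mfac_inv :: "('d \<Rightarrow> bool) \<Rightarrow> 'd \<Rightarrow> 'r" where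
  "mfac_inv pos b = (if pos b then z b else e (tl b) + x b * x (star b))"

lemma local_unit_mfac:
  assumes "b \<in> H"
  shows "local_unit J L R D S (e (tl b)) (mfac pos b) (mfac_inv pos b)"
  by unfold_locales
     (use assms in \<open>auto simp: mfac_def mfac_inv_def ee ez ze eg ge zg gz De\<close>)

abbreviation "gen_bracket \<equiv> bracket_formula L R star tl e"

definition gens_ok :: "('d \<Rightarrow> bool) \<Rightarrow> ('v \<Rightarrow> 'd \<Rightarrow> 'd \<Rightarrow> int) \<Rightarrow> ('d \<Rightarrow> 'r) \<Rightarrow> bool" where
  "gens_ok pos os y \<longleftrightarrow> (\<forall>b\<in>H. \<forall>c\<in>H. D (y b) (y c) = gen_bracket pos os y b c)"

text \<open>What the computations take from the total orders: skew-symmetry, and vanishing unless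
  both half-edges start at the vertex. The second condition lets one formula cover pairs of arrows
  that do not meet.\<close>

definition order_sign :: "('v \<Rightarrow> 'd \<Rightarrow> 'd \<Rightarrow> int) \<Rightarrow> bool" where
  "order_sign os \<longleftrightarrow> (\<forall>s b c. os s c b = - os s b c \<and> (os s b c \<noteq> 0 \<longrightarrow> tl b = s \<and> tl c = s))"

definition orient :: "('d \<Rightarrow> bool) \<Rightarrow> bool" where
  "orient pos \<longleftrightarrow> (\<forall>b. pos (star b) = (\<not> pos b))"

lemma order_sign_self:
  assumes "order_sign os"
  shows "os s b b = 0"
proof -
  have "os s b b = - os s b b" using assms unfolding order_sign_def by blast
  then show ?thesis by simp
qed

text \<open>The two sides may name different vertices, but each vanishes unless \<open>b\<close> and
  \<open>c\<close> have the same tail.\<close>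

lemma order_sign_skew: "order_sign os \<Longrightarrow> os (tl b) b c = - os (tl c) c b"
  unfolding order_sign_def by (metis add.inverse_neutral)

lemma order_sign_tl: "order_sign os \<Longrightarrow> os s b c \<noteq> 0 \<Longrightarrow> tl b = s \<and> tl c = s"
  unfolding order_sign_def by blast

text \<open>The prescribed values obey the skew-symmetry of a double bracket, so a bracket of two
  generators has to be verified for one order of the arguments only.\<close>

lemma S_gen_bracket:
  assumes "order_sign os" "orient pos" "b \<in> H" "c \<in> H"
  shows "S (gen_bracket pos os y b c) (- gen_bracket pos os y c b)"
proof -
  define F where "F b c = - (of_int (os (tl b) b c) * (L (y b) * R (y c)))
     - of_int (os (tl (star b)) (star b) (star c)) * (L (y c) * R (y b))
     + of_int (os (tl b) b (star c)) * (L (y c) * (L (y b) * R (e (tl b))))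
     + of_int (os (tl (star b)) (star b) c) * (L (e (tl (star b))) * (R (y b) * R (y c)))" for b c
  define G where "G b c = (if c = star b then of_int (if pos b then 1 else -1) *
          (L (e (tl (star b))) * R (e (tl b)) + L (e (tl (star b))) * R (e (tl b))
           + L (y c) * (L (y b) * R (e (tl b))) + L (e (tl (star b))) * (R (y b) * R (y c)))
        else 0)" for b c
  have "S (F b c) (- (of_int (os (tl b) b c) * (L (y c) * R (y b)))
     - of_int (os (tl (star b)) (star b) (star c)) * (L (y b) * R (y c))
     + of_int (os (tl b) b (star c)) * (L (e (tl b)) * (R (y c) * R (y b)))
     + of_int (os (tl (star b)) (star b) c) * (L (y b) * (L (y c) * R (e (tl (star b))))))"
    unfolding F_def by (intro S_add S_diff S_uminus S_of_int S_tens S_tens3)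
  also have "\<dots> = - F c b"
  proof -
    \<comment> \<open>A non-zero sign forces equal tails, so the idempotent at \<open>tl b\<close>
      may be renamed as the one at \<open>tl (star c)\<close>. This matches the third term of one
      formula with the fourth of the other.\<close>
    have "of_int (os (tl b) b (star c)) * (L (e (tl b)) * u)
        = - (of_int (os (tl (star c)) (star c) b) * (L (e (tl (star c))) * u))" for u
      using order_sign_skew[OF assms(1), of b "star c"] order_sign_tl[OF assms(1), of "tl b" b "star c"]
      by (cases "os (tl b) b (star c) = 0") auto
    moreover have "of_int (os (tl (star b)) (star b) c) * (u * (v * R (e (tl (star b)))))
        = - (of_int (os (tl c) c (star b)) * (u * (v * R (e (tl c)))))" for u v
      using order_sign_skew[OF assms(1), of "star b" c] order_sign_tl[OF assms(1), of "tl (star b)" "star b" c]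
      by (cases "os (tl (star b)) (star b) c = 0") auto
    ultimately show ?thesis
      unfolding F_def
      using order_sign_skew[OF assms(1), of b c] order_sign_skew[OF assms(1), of "star b" "star c"]
      by (simp add: add_ac)
  qed
  finally have 1: "S (F b c) (- F c b)" .
  have 2: "S (G b c) (- G c b)"
  proof (cases "c = star b")
    case True
    have *: "S (L p * R q + L p * R q + L r * (L r' * R q) + L p * (R r' * R r))
        (L q * R p + L q * R p + L q * (R r * R r') + L r' * (L r * R p))" for p q r r'
      by (intro S_add S_tens S_tens3)
    show ?thesis
    proof -
      \<comment> \<open>The pairing terms are symmetric under the exchange; the minus sign comes
        from the opposite orientation of \<open>star b\<close>.\<close>
      have "pos (star b) = (\<not> pos b)"
        using assms(2) by (simp add: orient_def)
      then show ?thesis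
        using S_of_int[OF *, of "if pos b then 1 else -1" "e (tl (star b))" "e (tl b)" "y (star b)" "y b"]
        unfolding G_def True by (cases "pos b") (simp_all add: algebra_simps)
    qed
  next
    case False
    then have "b \<noteq> star c" by (metis star_star)
    with False S_zero show ?thesis by (simp add: G_def)
  qed
  from S_add[OF 1 2] have "S (F b c + G b c) (- (F c b + G c b))" by simp
  then show ?thesis unfolding bracket_formula_def F_def G_def .
qed

end

section \<open>Brackets with a factor of the moment map\<close>

context quiver_family
begin

text \<open>Twice the moment map identity, resolved into the half-edges of the arrow
  \<open>y\<close>: its start contributes the two terms with \<open>x y\<close> in the right tensor
  factor, its end those with \<open>x y\<close> in the left one. A half-edge equal to
  \<open>c\<close> has weight \<open>k\<close>, any other one only its order sign. The weight
  depends on the orientation because \<open>g\<close> is either the factor of \<open>c\<close> or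
  its inverse.\<close>

lemma D_one_plus_loop:
  assumes ok: "gens_ok pos os x" and os: "order_sign os" and pos: "orient pos"
    and c: "c \<in> H" and y: "y \<in> H"
  defines "s \<equiv> tl c" and "g \<equiv> e (tl c) + x c * x (star c)"
    and "k \<equiv> \<lambda>d. (if d = c then if pos c then 1 else -1 else 0)"
  shows "D g (x y) =
      - (of_int (k y - os s c y) * (L (e s) * (R g * R (x y))))
      - of_int (k y + os s c y) * (L g * R (x y))
      + of_int (k (star y) - os s c (star y)) * (L (x y) * R g)
      + of_int (k (star y) + os s c (star y)) * (L (x y) * (L g * R (e s)))"
proof -
  \<comment> \<open>A non-zero sign places the half-edge at \<open>s\<close>, where the arrow
    absorbs the idempotent; for sign 0 both sides vanish.\<close>
  have absorb: "of_int (os s c y) * (u * (R (e s) * R (x y))) = of_int (os s c y) * (u * R (x y))"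
    "of_int (os s c (star y)) * (L (x y) * (L (e s) * u)) = of_int (os s c (star y)) * (L (x y) * u)" for u
    using order_sign_tl[OF os, of s c y] order_sign_tl[OF os, of s c "star y"] R_arrow[OF y] L_arrow[OF y]
    by (cases "os s c y = 0"; cases "os s c (star y) = 0"; force)+
  have "D g (x y) = D (x c) (x y) * L (x (star c)) + R (x c) * D (x (star c)) (x y)"
    by (simp add: g_def D_add_left De c D_mult_left)
  also have "\<dots> = gen_bracket pos os x c y * L (x (star c)) + R (x c) * gen_bracket pos os x (star c) y"
    using ok c y by (simp add: gens_ok_def)
  finally have Dg: "D g (x y) = \<dots>" .
  have skew: "os (tl (star c)) (star c) c = - os s c (star c)"
    using order_sign_skew[OF os, of "star c" c] by (simp add: s_def)
  have pos_star: "pos (star c) = (\<not> pos c)" using pos by (simp add: orient_def)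
  note arr = L_arrow[OF c] R_arrow[OF c] L_arrow[OF star_H[OF c], simplified]
    R_arrow[OF star_H[OF c], simplified]
  consider "y = c" | "y = star c" | "y \<noteq> c" "y \<noteq> star c" by blast
  then show ?thesis
  proof cases
    case 1
    show ?thesis
      unfolding Dg using absorb arr
      by (simp add: 1 bracket_formula_def g_def s_def k_def pos_star order_sign_self[OF os] skew[unfolded s_def]
         L_add R_add L_mult R_mult tensor_nf add_ac)
  next
    case 2
    show ?thesis
      unfolding Dg using absorb arr
      by (simp add: 2 bracket_formula_def g_def s_def k_def pos_star order_sign_self[OF os] skew[unfolded s_def]
         L_add R_add L_mult R_mult tensor_nf add_ac)
  next
    case 3
    then have 4: "star y \<noteq> c" by auto
    show ?thesis
      unfolding Dg using absorb arr
      by (simp add: 3 4 bracket_formula_def g_def s_def k_def pos_star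
         L_add R_add L_mult R_mult tensor_nf add_ac)
  qed
qed

text \<open>Passing from \<open>g\<close> to its inverse exchanges the two terms of each half-edge
  and changes their signs. This reverses the weight and keeps the order sign, so for the factor
  itself the weight is 1 in either orientation.\<close>

lemma D_mfac:
  assumes ok: "gens_ok pos os x" and os: "order_sign os" and pos: "orient pos"
    and c: "c \<in> H" and y: "y \<in> H"
  defines "s \<equiv> tl c" and "f \<equiv> mfac pos c"
    and "k \<equiv> \<lambda>d. (if d = c then 1 else 0)"
  shows "D f (x y) =
      - (of_int (k y - os s c y) * (L (e s) * (R f * R (x y))))
      - of_int (k y + os s c y) * (L f * R (x y))
      + of_int (k (star y) - os s c (star y)) * (L (x y) * R f)
      + of_int (k (star y) + os s c (star y)) * (L (x y) * (L f * R (e s)))"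
proof (cases "pos c")
  case True
  then show ?thesis
    using D_one_plus_loop[OF ok os pos c y]
    by (simp add: f_def mfac_def s_def k_def)
next
  case False
  define g where "g = e (tl c) + x c * x (star c)"
  have f: "f = z c" "mfac_inv pos c = g" using False by (simp_all add: f_def mfac_def mfac_inv_def g_def)
  interpret local_unit J L R D S "e s" g "z c"
    using local_unit.local_unit_inverse[OF local_unit_mfac[OF c, of pos]] f by (simp add: s_def f_def)
  have absorb: "of_int (os s c y) * (u * (R (e s) * R (x y))) = of_int (os s c y) * (u * R (x y))"
    "of_int (os s c (star y)) * (L (x y) * (L (e s) * u)) = of_int (os s c (star y)) * (L (x y) * u)"
    "of_int (k y) * (u * (R (e s) * R (x y))) = of_int (k y) * (u * R (x y))"
    "of_int (k (star y)) * (L (x y) * (L (e s) * u)) = of_int (k (star y)) * (L (x y) * u)" for u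
    using order_sign_tl[OF os, of s c y] order_sign_tl[OF os, of s c "star y"] R_arrow[OF y] L_arrow[OF y]
    by ((cases "os s c y = 0"; cases "os s c (star y) = 0"; force)+, auto simp: k_def s_def)
  have "D g (x y) =
      - (of_int (- k y - os s c y) * (L (e s) * (R g * R (x y))))
      - of_int (- k y + os s c y) * (L g * R (x y))
      + of_int (- k (star y) - os s c (star y)) * (L (x y) * R g)
      + of_int (- k (star y) + os s c (star y)) * (L (x y) * (L g * R (e s)))"
    using D_one_plus_loop[OF ok os pos c y] False
    unfolding k_def g_def s_def by (auto split: if_splits)
  then show ?thesis
    unfolding f D_inverse_left using absorb
    by (simp add: tensor_nf L_unit R_unit add_ac)
qed

text \<open>The loop element \<open>g\<close> at \<open>c\<close> is put into the second argument
  and expanded by the derivation rule. The mixed terms \<open>L g * R f - L f * R g\<close> cancel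
  for \<open>f = g\<close>. If \<open>f\<close> is the inverse of \<open>g\<close>, the rule for
  inverses turns exactly these terms into the claim, and the other two cancel.\<close>

lemma D_mfac_self:
  assumes ok: "gens_ok pos os x" and os: "order_sign os" and pos: "orient pos" and c: "c \<in> H"
  defines "s \<equiv> tl c" and "f \<equiv> mfac pos c"
  shows "D f f = L f * (L f * R (e s)) - L (e s) * (R f * R f)"
proof -
  define g where "g = e s + x c * x (star c)"
  have absorb: "of_int (os s c (star c)) * (u * (R (e s) * R (x (star c)))) = of_int (os s c (star c)) * (u * R (x (star c)))"
    "of_int (os s c (star c)) * (L (x c) * (L (e s) * u)) = of_int (os s c (star c)) * (L (x c) * u)" for u
    using order_sign_tl[OF os, of s c "star c"] R_arrow[OF star_H[OF c]] L_arrow[OF c]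
    by (cases "os s c (star c) = 0"; force)+
  interpret local_unit J L R D S "e s" f "mfac_inv pos c"
    unfolding s_def f_def by (rule local_unit_mfac[OF c])
  note arr = L_arrow[OF c] R_arrow[OF c] L_arrow[OF star_H[OF c], simplified]
    R_arrow[OF star_H[OF c], simplified]
  have xx: "L (x c) * L (x (star c)) = L g - L (e s)" "R (x c) * R (x (star c)) = R g - R (e s)"
    "L (x c) * (L (x (star c)) * u) = (L g - L (e s)) * u" "R (x c) * (R (x (star c)) * u) = (R g - R (e s)) * u" for u
    by (simp_all add: g_def L_add R_add L_mult R_mult algebra_simps)
  have "D f g = D f (x c) * R (x (star c)) + L (x c) * D f (x (star c))"
    by (simp add: g_def D_add_right De D_mult_right)
  also have "\<dots> = - (L (e s) * (R f * R g)) - L f * R g + L g * R f + L g * (L f * R (e s))"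
    unfolding f_def D_mfac[OF ok os pos c c] D_mfac[OF ok os pos c star_H[OF c]]
    using absorb absorb(1)[of "L (x c) * L (mfac pos c)", unfolded mult.assoc] arr
    by (simp add: order_sign_self[OF os] tensor_nf xx L_unit[unfolded f_def] R_unit[unfolded f_def] flip: s_def)
  finally have Dfg: "D f g = \<dots>" .
  show ?thesis
  proof (cases "pos c")
    case True
    then have "f = g" by (simp add: f_def g_def mfac_def s_def)
    with Dfg show ?thesis by simp
  next
    case False
    then have "mfac_inv pos c = g" by (simp add: g_def mfac_inv_def s_def)
    then interpret inv: local_unit J L R D S "e s" g f
      using local_unit_inverse by simp
    show ?thesis
      using inv.D_inverse_right[of f] Dfg
      by (simp add: tensor_nf inv.L_unit inv.R_unit)
  qed
qed

end

text \<open>Here \<open>c\<close> immediately precedes \<open>b\<close> in the order at \<open>s\<close> with signs \<open>os\<close>, and \<open>os'\<close> are the signs after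
  their exchange.\<close>

locale swap_move = quiver_family J L R D S H star tl e x z
  for J :: "'r::ring_1 set" and L R :: "'r \<Rightarrow> 't::ring_1" and D S
    and H :: "'d set" and star tl and e :: "'v \<Rightarrow> 'r" and x z +
  fixes pos :: "'d \<Rightarrow> bool" and os os' :: "'v \<Rightarrow> 'd \<Rightarrow> 'd \<Rightarrow> int" and b c :: 'd and s :: 'v
  assumes ok: "gens_ok pos os x" and os: "order_sign os" and pos: "orient pos"
    and b: "b \<in> H" and c: "c \<in> H" and bc: "b \<noteq> c" and tl_b: "tl b = s" and tl_c: "tl c = s"
    and os_cb: "os s c b = 1" and adj: "d \<noteq> b \<Longrightarrow> d \<noteq> c \<Longrightarrow> os s b d = os s c d"
    and os': "os' u p q = (if u = s \<and> p = b \<and> q = c then 1 else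
       if u = s \<and> p = c \<and> q = b then -1 else os u p q)"
begin

abbreviation "f \<equiv> mfac pos c"
abbreviation "w \<equiv> mfac_inv pos c"

definition y :: "'d \<Rightarrow> 'r" where
  "y d = (if d = b then f * x b else if d = star b then x (star b) * w else x d)"

sublocale fw: local_unit J L R D S "e s" f w
  using local_unit_mfac[OF c] tl_c by simp

lemma os_skew: "os u p q = - os u q p"
  using os unfolding order_sign_def by blast

lemma order_sign_os': "order_sign os'"
  unfolding order_sign_def
proof (intro allI conjI impI)
  fix u p q
  show "os' u q p = - os' u p q"
    using os_skew[of u q p] bc by (auto simp: os')
  assume "os' u p q \<noteq> 0"
  then show "tl p = u" "tl q = u"
    using order_sign_tl[OF os, of u p q] tl_b tl_c by (auto simp: os' split: if_splits)
qed

lemma os_c_self: "os u c c = 0" and os_b_self: "os u b b = 0"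
  using order_sign_self[OF os] by auto

lemma os_bc: "os s b c = -1"
  using os_skew[of s b c] os_cb by simp

text \<open>Expresses every sign of \<open>b\<close> by that of its neighbour \<open>c\<close>, with
  corrections at \<open>c\<close> and \<open>b\<close> themselves. The exchange changes only the
  correction at \<open>c\<close>, by 2, and this amount is supplied by the moment map terms of the
  brackets with \<open>f\<close>.\<close>

lemma os_b: "os s b d = os s c d - (if d = c then 1 else 0) - (if d = b then 1 else 0)"
  using adj[of d] os_bc os_cb bc by (auto simp: os_c_self os_b_self)

lemma os'_b: "os' s b d = os s c d + (if d = c then 1 else 0) - (if d = b then 1 else 0)"
  using adj[of d] os_cb bc by (auto simp: os' os_c_self os_b_self)

lemma D_b_other:
  assumes d: "d \<in> H" "d \<noteq> b" "d \<noteq> star b"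
  shows "D (y b) (y d) = gen_bracket pos os' y b d"
proof -
  have sd: "star d \<noteq> b" "star d \<noteq> star b" using d by (metis star_star)+
  have y: "y b = f * x b" "y d = x d" using d by (simp_all add: y_def)
  have o: "os' (tl (star b)) (star b) (star d) = os (tl (star b)) (star b) (star d)"
    "os' (tl (star b)) (star b) d = os (tl (star b)) (star b) d"
    using d sd by (auto simp: os')
  have "D (y b) (y d) = D f (x d) * L (x b) + R f * gen_bracket pos os x b d"
    using ok b d unfolding y D_mult_left by (simp add: gens_ok_def)
  then show ?thesis
    unfolding D_mfac[OF ok os pos c d(1)]
    using d(2-) sd L_arrow[OF b] R_arrow[OF b]
    by (simp add: bracket_formula_def y o os_b os'_b tl_b tl_c L_mult R_mult tensor_nf fw.L_unit fw.R_unit add_ac)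
qed

lemma D_bs_other:
  assumes d: "d \<in> H" "d \<noteq> b" "d \<noteq> star b"
  shows "D (y (star b)) (y d) = gen_bracket pos os' y (star b) d"
proof -
  have sd: "star d \<noteq> b" "star d \<noteq> star b" using d by (metis star_star)+
  have y: "y (star b) = x (star b) * w" "y d = x d" using d by (simp_all add: y_def)
  have o: "os' (tl (star b)) (star b) (star d) = os (tl (star b)) (star b) (star d)"
    "os' (tl (star b)) (star b) d = os (tl (star b)) (star b) d"
    using d sd by (auto simp: os')
  have absorb: "of_int (os s c d) * (u * (v * (R (e s) * R (x d)))) = of_int (os s c d) * (u * (v * R (x d)))"
    "of_int (os s c (star d)) * (L (x d) * (L (e s) * u)) = of_int (os s c (star d)) * (L (x d) * u)" for u v
    using order_sign_tl[OF os, of s c d] order_sign_tl[OF os, of s c "star d"] R_arrow[OF d(1)] L_arrow[OF d(1)]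
    by (cases "os s c d = 0"; cases "os s c (star d) = 0"; force)+
  have absorb_c: "u * (v * (R (e s) * R (x c))) = u * (v * R (x c))"
    "L (x (star c)) * (L (e s) * u) = L (x (star c)) * u" for u v
    using R_arrow[OF c] L_arrow[OF star_H[OF c]] tl_c by simp_all
  have "D (y (star b)) (y d) = gen_bracket pos os x (star b) d * L w + R (x (star b)) * D w (x d)"
    using ok b d unfolding y D_mult_left by (simp add: gens_ok_def)
  then show ?thesis
    unfolding fw.D_inverse_left D_mfac[OF ok os pos c d(1)]
    using d(2-) sd L_arrow[OF b] R_arrow[OF b] L_arrow[OF star_H[OF b]] R_arrow[OF star_H[OF b]] absorb absorb_c
    by (auto simp add: bracket_formula_def y o os_b os'_b tl_b tl_c L_mult R_mult tensor_nf fw.L_unit fw.R_unit add_ac)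
qed

definition k :: int where "k = (if star b = c then 1 else 0)"
definition m :: int where "m = os s c (star b)"

text \<open>If \<open>b\<close> is not a loop, \<open>star b\<close> is neither equal to
  \<open>c\<close> nor compared with it, and both constants vanish. If \<open>b\<close> is a loop,
  the idempotents at its two ends coincide. The brackets among \<open>b\<close> and
  \<open>star b\<close> need different absorption rules in the two cases.\<close>

lemma loop_cases: "tl (star b) = s \<or> k = 0 \<and> m = 0"
  using order_sign_tl[OF os, of s c "star b"] tl_c by (auto simp: k_def m_def)

lemma os_loop:
  "os s b (star b) = m - k" "os (tl (star b)) (star b) b = k - m"
  "os' s b (star b) = m + k" "os' (tl (star b)) (star b) b = - m - k"
  using order_sign_skew[OF os, of "star b" b] order_sign_skew[OF order_sign_os', of "star b" b]
  by (simp_all add: os_b os'_b k_def m_def tl_b)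

lemma D_f_b: "D f (x b) = L (e s) * (R f * R (x b)) - L f * R (x b)
    + of_int (k - m) * (L (x b) * R f) + of_int (k + m) * (L (x b) * (L f * R (e s)))"
  unfolding D_mfac[OF ok os pos c b] using bc by (simp add: k_def m_def tl_c os_cb)

lemma D_f_bs: "D f (x (star b)) = - (of_int (k - m) * (L (e s) * (R f * R (x (star b)))))
    - of_int (k + m) * (L f * R (x (star b)))
    - L (x (star b)) * R f + L (x (star b)) * (L f * R (e s))"
  unfolding D_mfac[OF ok os pos c star_H[OF b]] using bc by (simp add: k_def m_def tl_c os_cb)

text \<open>Skew-symmetry carries over the value with \<open>f\<close> in the first argument. The
  exchange is known only as a relation, so the exchanged value is built term by term and identified
  by \<open>S_unique\<close>.\<close>

lemma D_b_f: "D (x b) f = - (L f * (L (x b) * R (e s)) - L (x b) * R f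
    + of_int (k - m) * (L f * R (x b)) + of_int (k + m) * (L (e s) * (R (x b) * R f)))"
proof -
  have "S (D f (x b)) (L f * (L (x b) * R (e s)) - L (x b) * R f
    + of_int (k - m) * (L f * R (x b)) + of_int (k + m) * (L (e s) * (R (x b) * R f)))"
    unfolding D_f_b by (intro S_add S_diff S_of_int S_tens S_tens3)
  from S_unique[OF S_D this] show ?thesis by (metis minus_minus)
qed

lemma D_bs_f: "D (x (star b)) f = - (- (of_int (k - m) * (L f * (L (x (star b)) * R (e s))))
    - of_int (k + m) * (L (x (star b)) * R f)
    - L f * R (x (star b)) + L (e s) * (R (x (star b)) * R f))"
proof -
  have "S (D f (x (star b))) (- (of_int (k - m) * (L f * (L (x (star b)) * R (e s))))
    - of_int (k + m) * (L (x (star b)) * R f)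
    - L f * R (x (star b)) + L (e s) * (R (x (star b)) * R f))"
    unfolding D_f_bs by (intro S_add S_diff S_uminus S_of_int S_tens S_tens3)
  from S_unique[OF S_D this] show ?thesis by (metis minus_minus)
qed

lemma D_f_f: "D f f = L f * (L f * R (e s)) - L (e s) * (R f * R f)"
  using D_mfac_self[OF ok os pos c] tl_c by simp

lemmas arr = L_arrow[OF b, unfolded tl_b] R_arrow[OF b, unfolded tl_b]
  L_arrow[OF star_H[OF b], simplified, unfolded tl_b] R_arrow[OF star_H[OF b], simplified, unfolded tl_b]

lemma y_b: "y b = f * x b" "y (star b) = x (star b) * w"
  by (simp_all add: y_def)

lemma D_gen: "p \<in> H \<Longrightarrow> q \<in> H \<Longrightarrow> D (x p) (x q) = gen_bracket pos os x p q"
  using ok by (simp add: gens_ok_def)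

lemma os'_self: "os' u d d = 0"
  using order_sign_self[OF order_sign_os'] .

lemmas expand = D_mult_left D_mult_right fw.D_inverse_left fw.D_inverse_right D_f_f D_f_b D_b_f D_f_bs D_bs_f
  D_gen b bracket_formula_def y_b tl_b os_loop order_sign_self[OF os] os'_self L_mult R_mult tensor_nf
  fw.L_unit fw.R_unit

lemma D_b_b: "D (y b) (y b) = gen_bracket pos os' y b b"
  using loop_cases
proof
  assume t: "tl (star b) = s"
  show ?thesis using arr[unfolded t] by (simp add: expand t os_loop[unfolded t])
next
  assume km: "k = 0 \<and> m = 0"
  show ?thesis using arr by (simp add: expand km)
qed

lemma D_bs_bs: "D (y (star b)) (y (star b)) = gen_bracket pos os' y (star b) (star b)"
  using loop_cases
proof
  assume t: "tl (star b) = s"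
  show ?thesis using arr[unfolded t] by (simp add: expand t os_loop[unfolded t])
next
  assume km: "k = 0 \<and> m = 0"
  show ?thesis using arr by (simp add: expand km)
qed

lemma D_b_bs: "D (y b) (y (star b)) = gen_bracket pos os' y b (star b)"
  using loop_cases
proof
  assume t: "tl (star b) = s"
  show ?thesis using arr[unfolded t] by (simp add: expand t os_loop[unfolded t])
next
  assume km: "k = 0 \<and> m = 0"
  show ?thesis using arr by (simp add: expand km)
qed

lemma D_swap_args:
  assumes "p \<in> H" "q \<in> H" "D (y p) (y q) = gen_bracket pos os' y p q"
  shows "D (y q) (y p) = gen_bracket pos os' y q p"
  using S_unique[OF S_D[of "y p" "y q", unfolded assms(3)] S_gen_bracket[OF order_sign_os' pos assms(1,2)]]
  by simp

lemma D_other: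
  assumes d: "d \<in> H" "d \<noteq> b" "d \<noteq> star b" "d' \<in> H" "d' \<noteq> b" "d' \<noteq> star b"
  shows "D (y d) (y d') = gen_bracket pos os' y d d'"
proof -
  \<comment> \<open>The signs that change compare \<open>b\<close> with \<open>c\<close>, and
    \<open>b\<close> is none of the half-edges of \<open>d\<close> and \<open>d'\<close>.\<close>
  have sd: "star d \<noteq> b" "star d' \<noteq> b" using d by (metis star_star)+
  show ?thesis using d sd by (simp add: D_gen y_def bracket_formula_def os')
qed

theorem gens_ok_swap: "gens_ok pos os' y"
  unfolding gens_ok_def
proof (intro ballI)
  fix p q assume pq: "p \<in> H" "q \<in> H"
  consider "p = b" | "p = star b" | "p \<noteq> b" "p \<noteq> star b" by blast
  then show "D (y p) (y q) = gen_bracket pos os' y p q"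
    by cases (metis pq b star_H D_b_b D_bs_bs D_b_bs D_b_other D_bs_other D_other D_swap_args)+
qed

end

section \<open>Reversal of an arrow\<close>

locale flip_move = quiver_family J L R D S H star tl e x z
  for J :: "'r::ring_1 set" and L R :: "'r \<Rightarrow> 't::ring_1" and D S
    and H :: "'d set" and star tl and e :: "'v \<Rightarrow> 'r" and x z +
  fixes pos pos' :: "'d \<Rightarrow> bool" and os :: "'v \<Rightarrow> 'd \<Rightarrow> 'd \<Rightarrow> int" and b :: 'd and s :: 'v
  assumes ok: "gens_ok pos os x" and os: "order_sign os" and pos: "orient pos"
    and b: "b \<in> H" and tl_b: "tl b = s" and pos_b: "pos b"
    and pos': "pos' d = (if d = b then False else if d = star b then True else pos d)"
begin

abbreviation "f \<equiv> mfac pos b"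
abbreviation "w \<equiv> mfac_inv pos b"

text \<open>Modulo \<open>J\<close>, the new loop element at \<open>b\<close> is
  \<open>e s - (f - e s) * w\<close>, which equals \<open>w\<close>. Thus the loop element is
  inverted while the exponent of \<open>b\<close> changes sign as well.\<close>

definition y :: "'d \<Rightarrow> 'r" where
  "y d = (if d = star b then - (x (star b) * w) else x d)"

sublocale fw: local_unit J L R D S "e s" f w
  using local_unit_mfac[OF b] tl_b by simp

lemma orient_pos': "orient pos'"
  unfolding orient_def
proof
  fix d
  have "star d = b \<longleftrightarrow> d = star b" "star d = star b \<longleftrightarrow> d = b" by (metis star_star)+
  then show "pos' (star d) = (\<not> pos' d)"
    using pos by (auto simp: pos' orient_def)
qed

lemma D_gen: "p \<in> H \<Longrightarrow> q \<in> H \<Longrightarrow> D (x p) (x q) = gen_bracket pos os x p q"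
  using ok by (simp add: gens_ok_def)

lemma D_bs_other:
  assumes d: "d \<in> H" "d \<noteq> b" "d \<noteq> star b"
  shows "D (y (star b)) (y d) = gen_bracket pos' os y (star b) d"
proof -
  have sd: "star d \<noteq> b" "star d \<noteq> star b" using d by (metis star_star)+
  have y: "y (star b) = - (x (star b) * w)" "y d = x d" using d by (simp_all add: y_def)
  have absorb: "of_int (os s b d) * (u * (v * (R (e s) * R (x d)))) = of_int (os s b d) * (u * (v * R (x d)))"
    "of_int (os s b (star d)) * (L (x d) * (L (e s) * u)) = of_int (os s b (star d)) * (L (x d) * u)" for u v
    using order_sign_tl[OF os, of s b d] order_sign_tl[OF os, of s b "star d"] R_arrow[OF d(1)] L_arrow[OF d(1)]
    by (cases "os s b d = 0"; cases "os s b (star d) = 0"; force)+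
  have "D (y (star b)) (y d) = - (gen_bracket pos os x (star b) d * L w + R (x (star b)) * D w (x d))"
    using b d unfolding y D_mult_left D_uminus by (simp add: D_gen)
  then show ?thesis
    unfolding fw.D_inverse_left D_mfac[OF ok os pos b d(1)]
    using d(2-) sd L_arrow[OF b] R_arrow[OF b] L_arrow[OF star_H[OF b]] R_arrow[OF star_H[OF b]] absorb
    by (auto simp add: bracket_formula_def y tl_b L_mult R_mult tensor_nf fw.L_unit fw.R_unit add_ac)
qed

definition m :: int where "m = os s b (star b)"

lemma loop_cases: "tl (star b) = s \<or> m = 0"
  using order_sign_tl[OF os, of s b "star b"] by (auto simp: m_def)

lemma os_loop: "os s b (star b) = m" "os (tl (star b)) (star b) b = - m"
  using order_sign_skew[OF os, of "star b" b] by (simp_all add: m_def tl_b)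

lemma D_f_b: "D f (x b) = - (L (e s) * (R f * R (x b))) - L f * R (x b)
    - of_int m * (L (x b) * R f) + of_int m * (L (x b) * (L f * R (e s)))"
  unfolding D_mfac[OF ok os pos b b] by (simp add: m_def tl_b order_sign_self[OF os])

lemma D_f_bs: "D f (x (star b)) = of_int m * (L (e s) * (R f * R (x (star b))))
    - of_int m * (L f * R (x (star b)))
    + L (x (star b)) * R f + L (x (star b)) * (L f * R (e s))"
  unfolding D_mfac[OF ok os pos b star_H[OF b]] by (simp add: m_def tl_b order_sign_self[OF os])

lemma D_b_f: "D (x b) f = - (- (L f * (L (x b) * R (e s))) - L (x b) * R f
    - of_int m * (L f * R (x b)) + of_int m * (L (e s) * (R (x b) * R f)))"
proof -
  have "S (D f (x b)) (- (L f * (L (x b) * R (e s))) - L (x b) * R f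
    - of_int m * (L f * R (x b)) + of_int m * (L (e s) * (R (x b) * R f)))"
    unfolding D_f_b by (intro S_add S_diff S_uminus S_of_int S_tens S_tens3)
  from S_unique[OF S_D this] show ?thesis by (metis minus_minus)
qed

lemma D_bs_f: "D (x (star b)) f = - (of_int m * (L f * (L (x (star b)) * R (e s)))
    - of_int m * (L (x (star b)) * R f)
    + L f * R (x (star b)) + L (e s) * (R (x (star b)) * R f))"
proof -
  have "S (D f (x (star b))) (of_int m * (L f * (L (x (star b)) * R (e s)))
    - of_int m * (L (x (star b)) * R f)
    + L f * R (x (star b)) + L (e s) * (R (x (star b)) * R f))"
    unfolding D_f_bs by (intro S_add S_diff S_uminus S_of_int S_tens S_tens3)
  from S_unique[OF S_D this] show ?thesis by (metis minus_minus)
qed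

lemma D_f_f: "D f f = L f * (L f * R (e s)) - L (e s) * (R f * R f)"
  using D_mfac_self[OF ok os pos b] tl_b by simp

lemmas arr = L_arrow[OF b, unfolded tl_b] R_arrow[OF b, unfolded tl_b]
  L_arrow[OF star_H[OF b], simplified, unfolded tl_b] R_arrow[OF star_H[OF b], simplified, unfolded tl_b]

text \<open>Writes the loop at \<open>b\<close> through \<open>f\<close>; in the mixed bracket it
  then meets \<open>w\<close>, and the rules for a unit and its inverse apply.\<close>

lemma xx: "L (x b) * L (x (star b)) = L f - L (e s)" "R (x b) * R (x (star b)) = R f - R (e s)"
  "L (x b) * (L (x (star b)) * u) = (L f - L (e s)) * u" "R (x b) * (R (x (star b)) * u) = (R f - R (e s)) * u"
  using pos_b by (simp_all add: mfac_def tl_b L_add R_add L_mult R_mult algebra_simps)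

lemma y_b: "y b = x b" "y (star b) = - (x (star b) * w)"
  by (simp_all add: y_def)

lemmas expand = D_mult_left D_mult_right fw.D_inverse_left fw.D_inverse_right D_f_f D_f_b D_b_f D_f_bs D_bs_f
  D_gen b bracket_formula_def y_b tl_b os_loop order_sign_self[OF os] L_mult R_mult tensor_nf
  fw.L_unit fw.R_unit pos' pos_b

lemma D_bs_bs: "D (y (star b)) (y (star b)) = gen_bracket pos' os y (star b) (star b)"
  using loop_cases
proof
  assume t: "tl (star b) = s"
  show ?thesis using arr[unfolded t] by (simp add: expand t os_loop[unfolded t])
next
  assume m: "m = 0"
  show ?thesis using arr by (simp add: expand m)
qed

lemma D_b_bs: "D (y b) (y (star b)) = gen_bracket pos' os y b (star b)"
  using loop_cases
proof
  assume t: "tl (star b) = s"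
  show ?thesis using arr[unfolded t] by (simp add: expand t os_loop[unfolded t] xx)
next
  assume m: "m = 0"
  show ?thesis using arr by (simp add: expand m xx)
qed

lemma D_swap_args:
  assumes "p \<in> H" "q \<in> H" "D (y p) (y q) = gen_bracket pos' os y p q"
  shows "D (y q) (y p) = gen_bracket pos' os y q p"
  using S_unique[OF S_D[of "y p" "y q", unfolded assms(3)] S_gen_bracket[OF os orient_pos' assms(1,2)]]
  by simp

lemma D_other:
  assumes d: "d \<in> H" "d \<noteq> star b" "d' \<in> H" "d' \<noteq> star b"
  shows "D (y d) (y d') = gen_bracket pos' os y d d'"
proof -
  \<comment> \<open>Among these pairs a pairing term occurs only for arrows whose orientation is
    unchanged.\<close>
  have "d' = star d \<Longrightarrow> d \<noteq> b" using d by auto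
  then show ?thesis using d by (simp add: D_gen y_def bracket_formula_def pos')
qed

theorem gens_ok_flip: "gens_ok pos' os y"
  unfolding gens_ok_def
proof (intro ballI)
  fix p q assume pq: "p \<in> H" "q \<in> H"
  consider "p = star b" | "q = star b" "p \<noteq> star b" | "p \<noteq> star b" "q \<noteq> star b" by blast
  then show "D (y p) (y q) = gen_bracket pos' os y p q"
    by cases (metis pq b star_H D_bs_bs D_b_bs D_bs_other D_other D_swap_args)+
qed

end

section \<open>Automorphisms of the localised path algebra\<close>

lemma dstar_simps [simp]: "dstar (dstar b) = b" "dstar b \<noteq> b" "b \<noteq> dstar b"
    "dstar b \<in> darrows Ar \<longleftrightarrow> b \<in> darrows Ar"
  by (cases b; auto simp: dstar_def darrows_def)+

lemma dhd_eq: "dhd t h b = dtl t h (dstar b)"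
  by (auto simp: dhd_def dtl_def dstar_def)

lemma dtl_in: "quiver I Ar t h \<Longrightarrow> b \<in> darrows Ar \<Longrightarrow> dtl t h b \<in> I"
  by (auto simp: quiver_def darrows_def dtl_def)

abbreviation vtx :: "'v \<Rightarrow> ('k::field, ('v, 'a) gen) falg" where "vtx s \<equiv> ltr (V s)"
abbreviation arr :: "'a \<times> bool \<Rightarrow> ('k::field, ('v, 'a) gen) falg" where "arr b \<equiv> ltr (E b)"
abbreviation zinv :: "'a \<times> bool \<Rightarrow> ('k::field, ('v, 'a) gen) falg" where "zinv b \<equiv> ltr (Z b)"

section \<open>Moment maps and relations of the localised path algebra\<close>

definition fac :: "('a \<times> bool \<Rightarrow> bool) \<Rightarrow> 'v \<Rightarrow> 'a \<times> bool \<Rightarrow> ('k::field, ('v, 'a) gen) falg" where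
  "fac pos s b = (if pos b then vtx s + arr b * arr (dstar b) else zinv b)"

text \<open>Other orientations than \<open>snd\<close> describe a partly reversed quiver written in
  the same generators.\<close>

definition moment :: "'v set \<Rightarrow> ('a \<times> bool \<Rightarrow> bool) \<Rightarrow> ('v \<Rightarrow> ('a \<times> bool) list) \<Rightarrow> ('k::field, ('v, 'a) gen) falg" where
  "moment I pos ol = (\<Sum>s\<in>I. vtx s * prod_list (map (fac pos s) (ol s)))"

lemma Phi_eq_moment: "Phi I t h ol = moment I snd ol"
  by (simp add: Phi_def moment_def fac_def[abs_def])

text \<open>\<open>lam\<close> is a faithful representation of the localised path algebra, so
  congruences modulo \<open>J\<close> become equations usable as rewrite rules. The codomain is only
  a \<open>ring\<close>: the image of 1 is the sum of the vertex idempotents and need not be neutral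
  there.\<close>

locale quiver_rep =
  fixes I :: "'v set" and Ar :: "'a set" and t h :: "'a \<Rightarrow> 'v"
    and lam :: "('k::field, ('v, 'a) gen) falg \<Rightarrow> 'r::ring"
  assumes quiver: "quiver I Ar t h"
    and lam_add: "lam (p + q) = lam p + lam q" and lam_mult: "lam (p * q) = lam p * lam q"
    and lam_ker: "lam p = 0 \<longleftrightarrow> p \<in> JQ I Ar t h"
begin

abbreviation "J \<equiv> JQ I Ar t h :: ('k, ('v, 'a) gen) falg set"
abbreviation "H \<equiv> darrows Ar"
abbreviation "tail \<equiv> dtl t h"

lemma lam_zero [simp]: "lam 0 = 0" using lam_add[of 0 0] by simp

lemma lam_uminus: "lam (- p) = - lam p"
  using lam_add[of "- p" p] by (simp add: eq_neg_iff_add_eq_0)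

lemma lam_diff: "lam (p - q) = lam p - lam q"
  using lam_add[of p "- q"] by (simp add: lam_uminus)

lemma lam_eq_iff: "lam p = lam q \<longleftrightarrow> p - q \<in> J"
  using lam_ker[of "p - q"] by (simp add: lam_diff)

lemma lam_sum: "lam (sum f A) = (\<Sum>x\<in>A. lam (f x))"
  by (induction A rule: infinite_finite_induct) (auto simp: lam_add)

lemma lam_sm_cong: "lam p = lam q \<Longrightarrow> lam (sm c p) = lam (sm c q)"
  by (simp add: sm_eq_mult lam_mult)

lemma lam_rel: "p - q \<in> rels I Ar t h \<Longrightarrow> lam p = lam q"
  unfolding lam_eq_iff JQ_def by (rule tideal.gen)

lemma lam_rel0: "p \<in> rels I Ar t h \<Longrightarrow> lam p = 0"
  using lam_rel[of p 0] by simp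

lemma lam_one: "lam 1 = (\<Sum>s\<in>I. lam (vtx s))"
  using lam_rel[of 1 "\<Sum>s\<in>I. vtx s"] by (simp add: rels_def lam_sum)

lemma lam_vtx_vtx:
  assumes "s \<in> I" "s' \<in> I"
  shows "lam (vtx s) * lam (vtx s') = (if s = s' then lam (vtx s) else 0)"
proof -
  have "vtx s * vtx s' - (if s = s' then vtx s else 0) \<in> rels I Ar t h"
    unfolding rels_def using assms by blast
  from lam_rel[OF this] show ?thesis by (simp add: lam_mult split: if_splits)
qed

lemma lam_outside:
  "s \<notin> I \<Longrightarrow> lam (vtx s) = 0" "b \<notin> H \<Longrightarrow> lam (arr b) = 0" "b \<notin> H \<Longrightarrow> lam (zinv b) = 0"
  by (rule lam_rel0, unfold rels_def, blast)+

lemma tail_in_I: "b \<in> H \<Longrightarrow> tail b \<in> I"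
  using dtl_in[OF quiver] .

lemma lam_gens:
  assumes b: "b \<in> H"
  shows "lam (vtx (tail b)) * lam (vtx (tail b)) = lam (vtx (tail b))"
    "lam (vtx (tail b)) * lam (arr b) = lam (arr b)" "lam (arr b) * lam (vtx (tail (dstar b))) = lam (arr b)"
    "lam (vtx (tail b)) * lam (zinv b) = lam (zinv b)" "lam (zinv b) * lam (vtx (tail b)) = lam (zinv b)"
    "lam (zinv b) * (lam (arr b) * lam (arr (dstar b))) = lam (vtx (tail b)) - lam (zinv b)"
    "lam (arr b) * (lam (arr (dstar b)) * lam (zinv b)) = lam (vtx (tail b)) - lam (zinv b)"
proof -
  have "arr b - vtx (tail b) * arr b * vtx (dhd t h b) \<in> rels I Ar t h"
    "zinv b - vtx (tail b) * zinv b * vtx (tail b) \<in> rels I Ar t h"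
    "zinv b * (vtx (tail b) + arr b * arr (dstar b)) - vtx (tail b) \<in> rels I Ar t h"
    "(vtx (tail b) + arr b * arr (dstar b)) * zinv b - vtx (tail b) \<in> rels I Ar t h"
    unfolding rels_def using b by blast+
  note r = this[THEN lam_rel, unfolded lam_mult lam_add dhd_eq]
  have e: "lam (vtx s) * lam (vtx s) = lam (vtx s)" "lam (vtx s) * (lam (vtx s) * u) = lam (vtx s) * u" if "s \<in> I" for s u
    using lam_vtx_vtx[OF that that] by (simp_all flip: mult.assoc)
  note i = tail_in_I[OF b] tail_in_I[of "dstar b", simplified, OF b]
  show "lam (vtx (tail b)) * lam (vtx (tail b)) = lam (vtx (tail b))" by (rule e[OF i(1)])
  show "lam (vtx (tail b)) * lam (arr b) = lam (arr b)"
    by (subst (1 2) r(1)) (simp add: mult.assoc e i)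
  show "lam (arr b) * lam (vtx (tail (dstar b))) = lam (arr b)"
    by (subst (1 2) r(1)) (simp add: mult.assoc e i)
  show 1: "lam (vtx (tail b)) * lam (zinv b) = lam (zinv b)"
    by (subst (1 2) r(2)) (simp add: mult.assoc e i)
  show 2: "lam (zinv b) * lam (vtx (tail b)) = lam (zinv b)"
    by (subst (1 2) r(2)) (simp add: mult.assoc e i)
  show "lam (zinv b) * (lam (arr b) * lam (arr (dstar b))) = lam (vtx (tail b)) - lam (zinv b)"
    using r(3) 2 by (simp add: algebra_simps)
  show "lam (arr b) * (lam (arr (dstar b)) * lam (zinv b)) = lam (vtx (tail b)) - lam (zinv b)"
    using r(4) 1 by (simp add: algebra_simps)
qed

lemmas lam_gens_left = lam_gens[THEN arg_cong[where f = "\<lambda>v. v * u"], unfolded mult.assoc left_diff_distrib] for u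

lemmas ring_nf = mult.assoc distrib_left distrib_right left_diff_distrib right_diff_distrib

lemma lam_fhom_cong:
  assumes "\<And>x. lam (\<gamma> x) = lam (\<delta> x)"
  shows "lam (fhom \<gamma> p) = lam (fhom \<delta> p)"
proof (induction p rule: falg_induct)
  case (scale c p)
  from lam_sm_cong[OF this] show ?case by (simp add: fhom_simps)
qed (simp_all add: fhom_simps lam_mult lam_add assms)

lemma lam_fhom_id:
  assumes "\<And>x. lam (\<gamma> x) = lam (ltr x)"
  shows "lam (fhom \<gamma> p) = lam p"
  using lam_fhom_cong[of \<gamma> ltr p, OF assms] by (simp add: fhom_id)

lemma is_ideal_J: "is_ideal J"
  unfolding JQ_def by (rule is_ideal_tideal)

text \<open>Universal property of the localised path algebra: the assumptions are its relations for
  the images of the generators, nested to the right to fit the rewrite rules. The source has its own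
  arrows \<open>Ar0\<close>, so relabellings are covered as well as automorphisms.\<close>

lemma fhom_JQ:
  fixes \<alpha> :: "('v, 'c) gen \<Rightarrow> ('k, ('v, 'a) gen) falg"
  assumes V: "\<And>s. \<alpha> (V s) = vtx s"
    and out: "\<And>b. b \<notin> darrows Ar0 \<Longrightarrow> lam (\<alpha> (E b)) = 0" "\<And>b. b \<notin> darrows Ar0 \<Longrightarrow> lam (\<alpha> (Z b)) = 0"
    and eE: "\<And>b. b \<in> darrows Ar0 \<Longrightarrow> lam (vtx (dtl t0 h0 b)) * lam (\<alpha> (E b)) = lam (\<alpha> (E b))"
    and Ee: "\<And>b. b \<in> darrows Ar0 \<Longrightarrow> lam (\<alpha> (E b)) * lam (vtx (dtl t0 h0 (dstar b))) = lam (\<alpha> (E b))"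
    and eZ: "\<And>b. b \<in> darrows Ar0 \<Longrightarrow> lam (vtx (dtl t0 h0 b)) * lam (\<alpha> (Z b)) = lam (\<alpha> (Z b))"
    and Ze: "\<And>b. b \<in> darrows Ar0 \<Longrightarrow> lam (\<alpha> (Z b)) * lam (vtx (dtl t0 h0 b)) = lam (\<alpha> (Z b))"
    and Zg: "\<And>b. b \<in> darrows Ar0 \<Longrightarrow> lam (\<alpha> (Z b)) * (lam (\<alpha> (E b)) * lam (\<alpha> (E (dstar b))))
        = lam (vtx (dtl t0 h0 b)) - lam (\<alpha> (Z b))"
    and gZ: "\<And>b. b \<in> darrows Ar0 \<Longrightarrow> lam (\<alpha> (E b)) * (lam (\<alpha> (E (dstar b))) * lam (\<alpha> (Z b)))
        = lam (vtx (dtl t0 h0 b)) - lam (\<alpha> (Z b))"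
    and p: "p \<in> JQ I Ar0 t0 h0"
  shows "fhom \<alpha> p \<in> J"
proof (rule fhom_tideal_subset[OF is_ideal_J _ p[unfolded JQ_def]])
  fix r :: "('k, ('v, 'c) gen) falg"
  assume r: "r \<in> rels I Ar0 t0 h0"
  note hom = fhom_simps fhom_ltr fhom_one lam_diff lam_mult lam_add V dhd_eq mult.assoc
  have "lam (fhom \<alpha> r) = 0"
    using r[unfolded rels_def]
  proof (elim UnE)
    assume "r \<in> {1 - (\<Sum>s\<in>I. ltr (V s))}"
    then show ?thesis by (simp add: hom lam_one lam_sum)
  next
    assume "r \<in> {ltr (V s) * ltr (V s') - (if s = s' then ltr (V s) else 0) | s s'. s \<in> I \<and> s' \<in> I}"
    then obtain s s' where "s \<in> I" "s' \<in> I" "r = ltr (V s) * ltr (V s') - (if s = s' then ltr (V s) else 0)"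
      by blast
    then show ?thesis by (cases "s = s'") (simp_all add: hom lam_vtx_vtx)
  next
    assume "r \<in> {ltr (V s) | s. s \<notin> I}"
    then show ?thesis using lam_outside(1) by (auto simp: hom)
  next
    assume "r \<in> {ltr (E b) | b. b \<notin> darrows Ar0}"
    then show ?thesis using out by auto
  next
    assume "r \<in> {ltr (Z b) | b. b \<notin> darrows Ar0}"
    then show ?thesis using out by auto
  next
    assume "r \<in> {ltr (E b) - ltr (V (dtl t0 h0 b)) * ltr (E b) * ltr (V (dhd t0 h0 b)) | b. b \<in> darrows Ar0}"
    then obtain b where "b \<in> darrows Ar0" "r = ltr (E b) - ltr (V (dtl t0 h0 b)) * ltr (E b) * ltr (V (dhd t0 h0 b))"
      by blast
    then show ?thesis using eE[of b] Ee[of b] by (simp add: hom)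
  next
    assume "r \<in> {ltr (Z b) - ltr (V (dtl t0 h0 b)) * ltr (Z b) * ltr (V (dtl t0 h0 b)) | b. b \<in> darrows Ar0}"
    then obtain b where "b \<in> darrows Ar0" "r = ltr (Z b) - ltr (V (dtl t0 h0 b)) * ltr (Z b) * ltr (V (dtl t0 h0 b))"
      by blast
    then show ?thesis using eZ[of b] Ze[of b] by (simp add: hom)
  next
    assume "r \<in> {ltr (Z b) * (ltr (V (dtl t0 h0 b)) + ltr (E b) * ltr (E (dstar b))) - ltr (V (dtl t0 h0 b))
       | b. b \<in> darrows Ar0}"
    then obtain b where "b \<in> darrows Ar0"
      "r = ltr (Z b) * (ltr (V (dtl t0 h0 b)) + ltr (E b) * ltr (E (dstar b))) - ltr (V (dtl t0 h0 b))"
      by blast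
    then show ?thesis using Ze[of b] Zg[of b] by (simp add: hom distrib_left)
  next
    assume "r \<in> {(ltr (V (dtl t0 h0 b)) + ltr (E b) * ltr (E (dstar b))) * ltr (Z b) - ltr (V (dtl t0 h0 b))
       | b. b \<in> darrows Ar0}"
    then obtain b where "b \<in> darrows Ar0"
      "r = (ltr (V (dtl t0 h0 b)) + ltr (E b) * ltr (E (dstar b))) * ltr (Z b) - ltr (V (dtl t0 h0 b))"
      by blast
    then show ?thesis using eZ[of b] gZ[of b] by (simp add: hom distrib_right)
  qed
  then show "fhom \<alpha> r \<in> J" by (simp add: lam_ker)
qed

text \<open>The leading factors are general because the induction moves each processed letter into
  them; this also allows an inner block of a list to be treated as part of the front.\<close>

lemma lam_prod_list_cong:
  assumes "\<And>b. b \<in> set bs \<Longrightarrow> lam (f b) = lam (g b)" "lam u = lam v"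
  shows "lam (u * prod_list (map f bs)) = lam (v * prod_list (map g bs))"
  using assms
proof (induction bs arbitrary: u v)
  case (Cons b bs)
  from Cons.IH[of "u * f b" "v * g b"] Cons.prems show ?case by (simp add: lam_mult mult.assoc)
qed simp

definition unit_at :: "'v \<Rightarrow> ('k, ('v, 'a) gen) falg \<Rightarrow> ('k, ('v, 'a) gen) falg \<Rightarrow> bool" where
  "unit_at s g g' \<longleftrightarrow> lam (vtx s) * lam g = lam g \<and> lam g * lam (vtx s) = lam g
     \<and> lam (vtx s) * lam g' = lam g' \<and> lam g' * lam (vtx s) = lam g'
     \<and> lam g * lam g' = lam (vtx s) \<and> lam g' * lam g = lam (vtx s)"

lemma unit_at_sym: "unit_at s g g' \<Longrightarrow> unit_at s g' g"
  by (simp add: unit_at_def)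

lemma unit_atD:
  assumes "unit_at s g g'"
  shows "lam (vtx s) * lam g = lam g" "lam g * lam (vtx s) = lam g"
    "lam (vtx s) * lam g' = lam g'" "lam g' * lam (vtx s) = lam g'"
    "lam g * lam g' = lam (vtx s)" "lam g' * lam g = lam (vtx s)"
    "lam (vtx s) * (lam g * u) = lam g * u" "lam g * (lam (vtx s) * u) = lam g * u"
    "lam (vtx s) * (lam g' * u) = lam g' * u" "lam g' * (lam (vtx s) * u) = lam g' * u"
    "lam g * (lam g' * u) = lam (vtx s) * u" "lam g' * (lam g * u) = lam (vtx s) * u"
  using assms by (simp_all add: unit_at_def flip: mult.assoc)

text \<open>Negating the orientation of \<open>c\<close> inverts its factor, so inverses of factors
  are again values of \<open>fac\<close>.\<close>

lemma unit_at_fac: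
  assumes "c \<in> H" "pos' c = (\<not> pos c)"
  shows "unit_at (tail c) (fac pos (tail c) c) (fac pos' (tail c) c)"
  using lam_gens[OF assms(1)] lam_gens[of "dstar c", simplified, OF assms(1)]
    lam_gens_left[OF assms(1)] lam_gens_left[of "dstar c", simplified, OF assms(1)] assms(2)
  by (auto simp: unit_at_def fac_def lam_mult lam_add algebra_simps)

text \<open>The loop at the tail of \<open>b\<close> gets conjugated, whereas
  \<open>arr (dstar b) * arr b\<close> is unchanged since \<open>g' * g\<close> is absorbed. This
  dictates the images of the two inverses: only \<open>zinv b\<close> is conjugated.\<close>

definition conj_map :: "'a \<times> bool \<Rightarrow> ('k, ('v, 'a) gen) falg \<Rightarrow> ('k, ('v, 'a) gen) falg \<Rightarrow> ('v, 'a) gen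
    \<Rightarrow> ('k, ('v, 'a) gen) falg" where
  "conj_map b g g' x = (case x of V s \<Rightarrow> vtx s
     | E d \<Rightarrow> if d = b then g * arr b else if d = dstar b then arr d * g' else arr d
     | Z d \<Rightarrow> if d = b then g * zinv b * g' else zinv d)"

lemma conj_map_simps [simp]:
  "conj_map b g g' (V s) = vtx s" "conj_map b g g' (E b) = g * arr b"
  "conj_map b g g' (E (dstar b)) = arr (dstar b) * g'"
  "d \<noteq> b \<Longrightarrow> d \<noteq> dstar b \<Longrightarrow> conj_map b g g' (E d) = arr d"
  "conj_map b g g' (Z b) = g * zinv b * g'" "d \<noteq> b \<Longrightarrow> conj_map b g g' (Z d) = zinv d"
  by (simp_all add: conj_map_def)

lemma conj_map_J:
  assumes b: "b \<in> H" and u: "unit_at (tail b) g g'" and p: "p \<in> J"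
  shows "fhom (conj_map b g g') p \<in> J"
proof (rule fhom_JQ[OF _ _ _ _ _ _ _ _ _ p])
  note rules = lam_mult mult.assoc unit_atD[OF u] lam_gens lam_gens_left left_diff_distrib right_diff_distrib b
  fix d
  show "d \<notin> H \<Longrightarrow> lam (conj_map b g g' (E d)) = 0" "d \<notin> H \<Longrightarrow> lam (conj_map b g g' (Z d)) = 0"
    using b by (auto simp: conj_map_def lam_outside)
  assume d: "d \<in> H"
  have cases: "d = b \<or> d = dstar b \<or> d \<noteq> b \<and> d \<noteq> dstar b \<and> dstar d \<noteq> b \<and> dstar d \<noteq> dstar b"
    by (metis dstar_simps(1))
  from cases lam_gens[of b] lam_gens[of "dstar b"] show "lam (vtx (tail d)) * lam (conj_map b g g' (E d)) = lam (conj_map b g g' (E d))"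
    using d by (elim disjE) (simp_all add: rules)
  from cases lam_gens[of b] lam_gens[of "dstar b"] show "lam (conj_map b g g' (E d)) * lam (vtx (tail (dstar d))) = lam (conj_map b g g' (E d))"
    using d by (elim disjE) (simp_all add: rules)
  from cases show "lam (vtx (tail d)) * lam (conj_map b g g' (Z d)) = lam (conj_map b g g' (Z d))"
    using d by (elim disjE) (simp_all add: rules)
  from cases show "lam (conj_map b g g' (Z d)) * lam (vtx (tail d)) = lam (conj_map b g g' (Z d))"
    using d by (elim disjE) (simp_all add: rules)
  from cases show "lam (conj_map b g g' (Z d)) * (lam (conj_map b g g' (E d)) * lam (conj_map b g g' (E (dstar d))))
      = lam (vtx (tail d)) - lam (conj_map b g g' (Z d))"
    using d lam_gens(6)[of "dstar b"] by (elim disjE) (simp_all add: rules)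
  from cases show "lam (conj_map b g g' (E d)) * (lam (conj_map b g g' (E (dstar d))) * lam (conj_map b g g' (Z d)))
      = lam (vtx (tail d)) - lam (conj_map b g g' (Z d))"
    using d lam_gens(7)[of "dstar b"] by (elim disjE) (simp_all add: rules)
qed simp

lemma lam_conj_fac:
  assumes b: "b \<in> H" and u: "unit_at (tail b) g g'" and d: "d \<in> H" "d \<noteq> b"
  shows "lam (fhom (conj_map b g g') (fac pos (tail d) d)) = lam (fac pos (tail d) d)"
proof -
  have cases: "d = dstar b \<or> d \<noteq> b \<and> d \<noteq> dstar b \<and> dstar d \<noteq> b \<and> dstar d \<noteq> dstar b"
    using d by (metis dstar_simps(1))
  then show ?thesis
    using d b by (elim disjE)
      (simp_all add: fac_def fhom_simps lam_add lam_mult mult.assoc unit_atD[OF u] lam_gens lam_gens_left)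
qed

lemma lam_conj_fac_self:
  assumes b: "b \<in> H" and u: "unit_at (tail b) g g'"
  shows "lam (fhom (conj_map b g g') (fac pos (tail b) b)) = lam g * lam (fac pos (tail b) b) * lam g'"
  using b by (simp add: fac_def fhom_simps lam_add lam_mult mult.assoc unit_atD[OF u] distrib_left distrib_right)

text \<open>The inverse is the same substitution with \<open>g\<close> and \<open>g'\<close>
  exchanged, because the substitution fixes both; this holds for the factor of a half-edge different
  from \<open>b\<close>.\<close>

lemma conj_map_inverse:
  assumes b: "b \<in> H" and u: "unit_at (tail b) g g'"
    and g: "lam (fhom (conj_map b g g') g) = lam g" "lam (fhom (conj_map b g g') g') = lam g'"
  shows "fhom (conj_map b g g') (fhom (conj_map b g' g) p) - p \<in> J"
proof -
  have "lam (fhom (conj_map b g g') (conj_map b g' g x)) = lam (ltr x)" for x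
  proof (cases x)
    case (E d)
    consider "d = b" | "d = dstar b" | "d \<noteq> b" "d \<noteq> dstar b" by blast
    then show ?thesis
      using b lam_gens[of b] lam_gens[of "dstar b"]
      by cases (simp_all add: E fhom_simps lam_mult g mult.assoc unit_atD[OF u]
        lam_gens_left unit_atD[OF u, unfolded mult.assoc[symmetric]])
  next
    case (Z d)
    then show ?thesis
      using b by (cases "d = b") (simp_all add: fhom_simps lam_mult g mult.assoc unit_atD[OF u] lam_gens)
  qed simp
  from lam_fhom_id[OF this, of p] show ?thesis by (simp add: fhom_comp lam_eq_iff)
qed

section \<open>The automorphism that reverses an arrow\<close>

definition flip_map :: "'a \<times> bool \<Rightarrow> ('v, 'a) gen \<Rightarrow> ('k, ('v, 'a) gen) falg" where
  "flip_map b x = (case x of V s \<Rightarrow> vtx s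
     | E d \<Rightarrow> if d = dstar b then - (arr d * zinv b) else arr d
     | Z d \<Rightarrow> if d = b \<or> d = dstar b then vtx (tail d) + arr d * arr (dstar d) else zinv d)"

lemma flip_map_simps [simp]:
  "flip_map b (V s) = vtx s" "flip_map b (E b) = arr b"
  "flip_map b (E (dstar b)) = - (arr (dstar b) * zinv b)"
  "d \<noteq> dstar b \<Longrightarrow> flip_map b (E d) = arr d"
  "flip_map b (Z b) = vtx (tail b) + arr b * arr (dstar b)"
  "flip_map b (Z (dstar b)) = vtx (tail (dstar b)) + arr (dstar b) * arr b"
  "d \<noteq> b \<Longrightarrow> d \<noteq> dstar b \<Longrightarrow> flip_map b (Z d) = zinv d"
  by (simp_all add: flip_map_def)

text \<open>\<open>q\<close> is a right inverse of the loop element at \<open>dstar b\<close>,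
  because \<open>dstar b\<close> can be moved across the inverse of the loop element at
  \<open>b\<close>; hence it equals \<open>zinv (dstar b)\<close>. So reversing \<open>b\<close>
  inverts the loop element at the other end too.\<close>

lemma lam_slide:
  assumes b: "b \<in> H"
  shows "lam (arr (dstar b)) * (lam (zinv b) * lam (arr b)) = lam (vtx (tail (dstar b))) - lam (zinv (dstar b))"
proof -
  define q where "q = lam (vtx (tail (dstar b))) - lam (arr (dstar b)) * (lam (zinv b) * lam (arr b))"
  note g = lam_gens[OF b] lam_gens[of "dstar b", simplified, OF b] lam_gens_left[OF b] lam_gens_left[of "dstar b", simplified, OF b]
  have "(lam (vtx (tail (dstar b))) + lam (arr (dstar b)) * lam (arr b)) * q = lam (vtx (tail (dstar b)))"
    by (simp add: q_def g ring_nf)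
  then have "lam (zinv (dstar b)) * ((lam (vtx (tail (dstar b))) + lam (arr (dstar b)) * lam (arr b)) * q) = lam (zinv (dstar b))"
    using g by simp
  moreover have "lam (zinv (dstar b)) * (lam (vtx (tail (dstar b))) + lam (arr (dstar b)) * lam (arr b)) * q = q"
  proof -
    have "lam (zinv (dstar b)) * (lam (vtx (tail (dstar b))) + lam (arr (dstar b)) * lam (arr b)) = lam (vtx (tail (dstar b)))"
      by (simp add: g ring_nf)
    then show ?thesis by (simp add: q_def g ring_nf)
  qed
  ultimately show ?thesis by (simp add: mult.assoc) (simp add: q_def algebra_simps)
qed

lemma flip_map_J:
  assumes b: "b \<in> H" and p: "p \<in> J"
  shows "fhom (flip_map b) p \<in> J"
proof (rule fhom_JQ[OF _ _ _ _ _ _ _ _ _ p])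
  note g = lam_gens[OF b] lam_gens[of "dstar b", simplified, OF b] lam_gens_left[OF b] lam_gens_left[of "dstar b", simplified, OF b]
    lam_slide[OF b]
  note rules = lam_mult lam_add lam_uminus ring_nf g
  fix d
  show "d \<notin> H \<Longrightarrow> lam (flip_map b (E d)) = 0" "d \<notin> H \<Longrightarrow> lam (flip_map b (Z d)) = 0"
    using b by (auto simp: flip_map_def lam_outside)
  assume d: "d \<in> H"
  have cases: "d = b \<or> d = dstar b \<or> d \<noteq> b \<and> d \<noteq> dstar b \<and> dstar d \<noteq> b \<and> dstar d \<noteq> dstar b"
    by (metis dstar_simps(1))
  from cases lam_gens[OF d] show "lam (vtx (tail d)) * lam (flip_map b (E d)) = lam (flip_map b (E d))"
    by (elim disjE) (simp_all add: rules)
  from cases lam_gens[OF d] show "lam (flip_map b (E d)) * lam (vtx (tail (dstar d))) = lam (flip_map b (E d))"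
    by (elim disjE) (simp_all add: rules)
  from cases lam_gens[OF d] show "lam (vtx (tail d)) * lam (flip_map b (Z d)) = lam (flip_map b (Z d))"
    by (elim disjE) (simp_all add: rules)
  from cases lam_gens[OF d] show "lam (flip_map b (Z d)) * lam (vtx (tail d)) = lam (flip_map b (Z d))"
    by (elim disjE) (simp_all add: rules)
  from cases lam_gens[OF d] show "lam (flip_map b (Z d)) * (lam (flip_map b (E d)) * lam (flip_map b (E (dstar d))))
      = lam (vtx (tail d)) - lam (flip_map b (Z d))"
    by (elim disjE) (simp_all add: rules)
  from cases lam_gens[OF d] show "lam (flip_map b (E d)) * (lam (flip_map b (E (dstar d))) * lam (flip_map b (Z d)))
      = lam (vtx (tail d)) - lam (flip_map b (Z d))"
    by (elim disjE) (simp_all add: rules)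
qed simp

text \<open>\<open>zinv b\<close> is sent to the loop element itself, which in the second
  application cancels the factor \<open>zinv b\<close> acquired in the first; the two signs cancel
  as well.\<close>

lemma flip_map_involution:
  assumes b: "b \<in> H"
  shows "fhom (flip_map b) (fhom (flip_map b) p) - p \<in> J"
proof -
  note g = lam_gens[OF b] lam_gens[of "dstar b", simplified, OF b] lam_gens_left[OF b] lam_gens_left[of "dstar b", simplified, OF b]
    lam_slide[OF b]
  have "lam (fhom (flip_map b) (flip_map b x)) = lam (ltr x)" for x
  proof (cases x)
    case (E d)
    then show ?thesis
      by (cases "d = dstar b") (simp_all add: fhom_simps lam_mult lam_add lam_uminus ring_nf g)
  next
    case (Z d)
    consider "d = b" | "d = dstar b" | "d \<noteq> b" "d \<noteq> dstar b" by blast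
    then show ?thesis
      by cases (simp_all add: Z fhom_simps lam_mult lam_add lam_diff lam_uminus ring_nf g)
  qed simp
  from lam_fhom_id[OF this, of p] show ?thesis by (simp add: fhom_comp lam_eq_iff)
qed

lemma lam_flip_fac:
  assumes b: "b \<in> H" "pos b" "\<not> pos (dstar b)" and d: "d \<in> H"
    and pos': "\<And>d. pos' d = (if d = b then False else if d = dstar b then True else pos d)"
  shows "lam (fhom (flip_map b) (fac pos' (tail d) d)) = lam (fac pos (tail d) d)"
proof -
  have cases: "d = b \<or> d = dstar b \<or> d \<noteq> b \<and> d \<noteq> dstar b \<and> dstar d \<noteq> b \<and> dstar d \<noteq> dstar b"
    by (metis dstar_simps(1))
  then show ?thesis
    using b by (elim disjE)
      (simp_all add: fac_def pos' fhom_simps lam_add lam_mult lam_uminus lam_diff mult.assoc lam_slide)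
qed

lemma lam_moment_flip:
  assumes b: "b \<in> H" "pos b" "\<not> pos (dstar b)"
    and pos': "\<And>d. pos' d = (if d = b then False else if d = dstar b then True else pos d)"
    and ol: "orderings I Ar t h ol"
  shows "lam (fhom (flip_map b) (moment I pos' ol)) = lam (moment I pos ol)"
proof -
  have "lam (vtx s * prod_list (map (fhom (flip_map b) \<circ> fac pos' s) (ol s)))
      = lam (vtx s * prod_list (map (fac pos s) (ol s)))" if s: "s \<in> I" for s
  proof (rule lam_prod_list_cong)
    fix d assume "d \<in> set (ol s)"
    with ol s have "d \<in> H" "tail d = s" by (auto simp: orderings_def Tset_def)
    with lam_flip_fac[OF b _ pos', of d]
    show "lam ((fhom (flip_map b) \<circ> fac pos' s) d) = lam (fac pos s d)" by simp
  qed simp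
  then show ?thesis by (simp add: moment_def fhom_simps lam_sum)
qed

lemma lam_moment_swap:
  assumes b: "b \<in> H" and c: "c \<in> H" and bc: "b \<noteq> c" and s: "tail b = s" "tail c = s"
    and ol: "orderings I Ar t h ol" and ol_s: "ol s = us @ [c, b] @ vs"
    and pos: "pos' c = (\<not> pos c)"
  shows "lam (fhom (conj_map b (fac pos s c) (fac pos' s c)) (moment I pos (ol(s := us @ [b, c] @ vs))))
    = lam (moment I pos ol)"
proof -
  define \<alpha> where "\<alpha> = conj_map b (fac pos s c) (fac pos' s c)"
  have sI: "s \<in> I" using tail_in_I[OF b] s by simp
  have u: "unit_at (tail b) (fac pos s c) (fac pos' s c)"
    using unit_at_fac[of c pos' pos, OF c pos] s by simp
  have fixed: "lam ((fhom \<alpha> \<circ> fac pos s') d) = lam (fac pos s' d)" if "d \<in> H" "d \<noteq> b" "tail d = s'" for d s'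
    using lam_conj_fac[OF b u that(1,2)] that(3) by (simp add: \<alpha>_def)
  have "lam (vtx s' * prod_list (map (fhom \<alpha> \<circ> fac pos s') ((ol(s := us @ [b, c] @ vs)) s')))
      = lam (vtx s' * prod_list (map (fac pos s') (ol s')))" if s': "s' \<in> I" for s'
  proof (cases "s' = s")
    case False
    have "lam (vtx s' * prod_list (map (fhom \<alpha> \<circ> fac pos s') (ol s')))
      = lam (vtx s' * prod_list (map (fac pos s') (ol s')))"
    proof (rule lam_prod_list_cong)
      fix d assume "d \<in> set (ol s')"
      with ol s' have "d \<in> H" "tail d = s'" by (auto simp: orderings_def Tset_def)
      with False s show "lam ((fhom \<alpha> \<circ> fac pos s') d) = lam (fac pos s' d)"
        by (intro fixed) auto
    qed simp
    with False show ?thesis by simp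
  next
    case True
    have dist: "distinct (ol s)" and set: "set (ol s) = Tset Ar t h s"
      using ol sI by (auto simp: orderings_def)
    have in_H: "d \<in> H" "tail d = s" if "d \<in> set us \<union> set vs" for d
      using that set ol_s by (auto simp: Tset_def)
    have "b \<notin> set us \<union> set vs" using dist ol_s by auto
    then have fixed': "lam ((fhom \<alpha> \<circ> fac pos s) d) = lam (fac pos s d)" if "d \<in> set us \<union> set vs" for d
      using that in_H[OF that] by (intro fixed) metis+
    have 1: "lam (vtx s * prod_list (map (fhom \<alpha> \<circ> fac pos s) us)) = lam (vtx s * prod_list (map (fac pos s) us))"
      by (intro lam_prod_list_cong fixed') simp_all
    have fb: "lam (fhom \<alpha> (fac pos s b)) = lam (fac pos s c) * lam (fac pos s b) * lam (fac pos' s c)"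
      using lam_conj_fac_self[OF b u, of pos] s by (simp add: \<alpha>_def)
    have "lam (fac pos s b) * lam (vtx s) = lam (fac pos s b)"
      using unit_at_fac[of b "\<lambda>d. \<not> pos d" pos, OF b] s by (simp add: unit_at_def)
    \<comment> \<open>In the new order the factor of \<open>b\<close> comes first; its conjugate
      times the factor of \<open>c\<close> collapses to the product in the old order.\<close>
    then have "lam (fhom \<alpha> (fac pos s b) * fhom \<alpha> (fac pos s c)) = lam (fac pos s c * fac pos s b)"
      using fixed[OF c _ s(2)] bc unit_atD[OF u] s by (simp add: lam_mult fb mult.assoc)
    with 1 have "lam (vtx s * prod_list (map (fhom \<alpha> \<circ> fac pos s) us) * (fhom \<alpha> (fac pos s b) * fhom \<alpha> (fac pos s c)))
       = lam (vtx s * prod_list (map (fac pos s) us) * (fac pos s c * fac pos s b))"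
      by (simp only: lam_mult)
    then have "lam (vtx s * prod_list (map (fhom \<alpha> \<circ> fac pos s) us) * (fhom \<alpha> (fac pos s b) * fhom \<alpha> (fac pos s c))
         * prod_list (map (fhom \<alpha> \<circ> fac pos s) vs))
       = lam (vtx s * prod_list (map (fac pos s) us) * (fac pos s c * fac pos s b) * prod_list (map (fac pos s) vs))"
      by (intro lam_prod_list_cong fixed') simp_all
    then show ?thesis using True by (simp add: ol_s mult.assoc)
  qed
  then show ?thesis by (simp add: moment_def fhom_simps lam_sum \<alpha>_def)
qed

end

text \<open>An explicit lift of the inverse composes more easily than injectivity and surjectivity.
  Both lifts fix the vertices literally, not merely modulo the ideal, so formulas with idempotents
  are transported by rewriting.\<close>

definition alg_iso :: "('k::field, ('v, 'a) gen) falg set \<Rightarrow> ('k, ('v, 'b) gen) falg set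
    \<Rightarrow> (('v, 'a) gen \<Rightarrow> ('k, ('v, 'b) gen) falg) \<Rightarrow> bool" where
  "alg_iso J J' X \<longleftrightarrow> (\<forall>s. X (V s) = vtx s) \<and> (\<forall>p\<in>J. fhom X p \<in> J') \<and>
     (\<exists>Y. (\<forall>s. Y (V s) = vtx s) \<and> (\<forall>q\<in>J'. fhom Y q \<in> J) \<and> (\<forall>p. fhom Y (fhom X p) - p \<in> J) \<and> (\<forall>q. fhom X (fhom Y q) - q \<in> J'))"

lemma alg_iso_comp:
  assumes X: "alg_iso J J' X" and \<alpha>: "alg_iso J0 J \<alpha>" and J: "is_ideal J0" "is_ideal J'"
  shows "alg_iso J0 J' (\<lambda>x. fhom X (\<alpha> x))"
proof -
  from X obtain Y where Y: "\<forall>s. Y (V s) = vtx s" "\<forall>q\<in>J'. fhom Y q \<in> J"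
      "\<forall>p. fhom Y (fhom X p) - p \<in> J" "\<forall>q. fhom X (fhom Y q) - q \<in> J'"
    unfolding alg_iso_def by blast
  from \<alpha> obtain \<beta> where \<beta>: "\<forall>s. \<beta> (V s) = vtx s" "\<forall>q\<in>J. fhom \<beta> q \<in> J0"
      "\<forall>p. fhom \<beta> (fhom \<alpha> p) - p \<in> J0" "\<forall>q. fhom \<alpha> (fhom \<beta> q) - q \<in> J"
    unfolding alg_iso_def by blast
  have X': "\<forall>s. X (V s) = vtx s" "\<forall>p\<in>J. fhom X p \<in> J'" using X unfolding alg_iso_def by blast+
  have \<alpha>': "\<forall>s. \<alpha> (V s) = vtx s" "\<forall>p\<in>J0. fhom \<alpha> p \<in> J" using \<alpha> unfolding alg_iso_def by blast+
  have comp: "fhom (\<lambda>x. fhom X (\<alpha> x)) p = fhom X (fhom \<alpha> p)" "fhom (\<lambda>x. fhom \<beta> (Y x)) q = fhom \<beta> (fhom Y q)" for p q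
    by (simp_all add: fhom_comp)
  have "fhom \<beta> (fhom Y (fhom X (fhom \<alpha> p))) - p \<in> J0" for p
  proof -
    have "fhom \<beta> (fhom Y (fhom X (fhom \<alpha> p)) - fhom \<alpha> p) + (fhom \<beta> (fhom \<alpha> p) - p) \<in> J0"
      using is_idealD(2)[OF J(1)] Y(3) \<beta>(2,3) by blast
    then show ?thesis by (simp add: fhom_diff)
  qed
  moreover have "fhom X (fhom \<alpha> (fhom \<beta> (fhom Y q))) - q \<in> J'" for q
  proof -
    have "fhom X (fhom \<alpha> (fhom \<beta> (fhom Y q)) - fhom Y q) + (fhom X (fhom Y q) - q) \<in> J'"
      using is_idealD(2)[OF J(2)] Y(4) X'(2) \<beta>(4) by blast
    then show ?thesis by (simp add: fhom_diff)
  qed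
  ultimately show ?thesis
    unfolding alg_iso_def comp
    by (intro conjI exI[of _ "\<lambda>x. fhom \<beta> (Y x)"]) (simp_all add: comp X' \<alpha>' Y \<beta>)
qed

context quiver_rep
begin

lemma alg_iso_flip: "b \<in> H \<Longrightarrow> alg_iso J J (flip_map b)"
  unfolding alg_iso_def using flip_map_J flip_map_involution by (intro conjI exI[of _ "flip_map b"]) auto

lemma alg_iso_conj:
  assumes b: "b \<in> H" and c: "c \<in> H" and bc: "b \<noteq> c" and s: "tail b = s" "tail c = s"
    and pos: "pos' c = (\<not> pos c)"
  shows "alg_iso J J (conj_map b (fac pos s c) (fac pos' s c))"
proof -
  have u: "unit_at (tail b) (fac pos s c) (fac pos' s c)"
    using unit_at_fac[of c pos' pos, OF c pos] s by simp
  note u' = unit_at_sym[OF u]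
  have fixed: "lam (fhom (conj_map b g g') (fac p s c)) = lam (fac p s c)" if "unit_at (tail b) g g'" for p g g'
    using lam_conj_fac[OF b that c] bc s by auto
  show ?thesis
    unfolding alg_iso_def using conj_map_J[OF b u] conj_map_J[OF b u']
      conj_map_inverse[OF b u fixed[OF u] fixed[OF u]] conj_map_inverse[OF b u' fixed[OF u'] fixed[OF u']]
    by (intro conjI exI[of _ "conj_map b (fac pos' s c) (fac pos s c)"]) auto
qed

end

section \<open>Double brackets on the localised path algebra\<close>

lemma is_dbracketD:
  assumes "is_dbracket I J vx br"
  shows "p - p' \<in> J \<Longrightarrow> q - q' \<in> J \<Longrightarrow> br p q - br p' q' \<in> tens_ker J"
    "br (p + p') q - (br p q + br p' q) \<in> tens_ker J"
    "br p (q + q') - (br p q + br p q') \<in> tens_ker J"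
    "br (sm c p) q - sm c (br p q) \<in> tens_ker J"
    "br p (sm c q) - sm c (br p q) \<in> tens_ker J"
    "br p q + tswap (br q p) \<in> tens_ker J"
    "br p (q * r) - (br p q * tens 1 r + tens q 1 * br p r) \<in> tens_ker J"
    "br (\<Sum>s\<in>I. sm (d s) (ltr (vx s))) q \<in> tens_ker J"
    "br q (\<Sum>s\<in>I. sm (d s) (ltr (vx s))) \<in> tens_ker J"
  using assms[unfolded is_dbracket_def] by simp_all

text \<open>The exchange of tensor factors makes sense on the image of \<open>Lam\<close> only,
  hence the use of its graph; the assumption \<open>swap\<close> says that it is well defined
  there.\<close>

lemma double_bracket_rep_of_dbracket:
  fixes br :: "('k::field_char_0, 'x) falg \<Rightarrow> ('k, 'x) falg \<Rightarrow> ('k, 'x) ftens"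
    and Lam :: "('k, 'x) ftens \<Rightarrow> 't::ring_1"
  assumes J: "is_ideal J" and br: "is_dbracket I J vx br"
    and add: "\<And>U W. Lam (U + W) = Lam U + Lam W" and mult: "\<And>U W. Lam (U * W) = Lam U * Lam W"
    and ker: "\<And>U. U \<in> tens_ker J \<Longrightarrow> Lam U = 0" and swap: "\<And>U. Lam U = 0 \<Longrightarrow> Lam (tswap U) = 0"
  shows "double_bracket_rep J (\<lambda>p. Lam (tens p 1)) (\<lambda>p. Lam (tens 1 p))
     (\<lambda>p q. Lam (br p q) + Lam (br p q)) (\<lambda>u v. \<exists>U. u = Lam U \<and> v = Lam (tswap U))"
proof -
  have zero: "Lam 0 = 0" using add[of 0 0] by simp
  have uminus: "Lam (- U) = - Lam U" for U
    using add[of "- U" U] by (simp add: zero eq_neg_iff_add_eq_0)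
  have diff: "Lam (U - W) = Lam U - Lam W" for U W
    using add[of U "- W"] by (simp add: uminus)
  have eq: "Lam U = Lam W" if "U - W \<in> tens_ker J" for U W
    using ker[OF that] by (simp add: diff)
  have cong: "Lam (br p q) = Lam (br p' q')" if "p - p' \<in> J" "q - q' \<in> J" for p p' q q'
    using that by (intro eq is_dbracketD[OF br])
  have addl: "Lam (br (p + p') q) = Lam (br p q) + Lam (br p' q)" for p p' q
    unfolding add[symmetric] by (intro eq is_dbracketD[OF br])
  have addr: "Lam (br q (p + p')) = Lam (br q p) + Lam (br q p')" for p p' q
    unfolding add[symmetric] by (intro eq is_dbracketD[OF br])
  have skew: "Lam (tswap (br p q)) = - Lam (br q p)" for p q
  proof -
    have "br q p + tswap (br p q) \<in> tens_ker J"
      by (rule is_dbracketD[OF br])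
    from ker[OF this] show ?thesis by (simp add: add eq_neg_iff_add_eq_0 add.commute)
  qed
  have leib: "Lam (br p (q * r)) = Lam (br p q) * Lam (tens 1 r) + Lam (tens q 1) * Lam (br p r)" for p q r
    unfolding mult[symmetric] add[symmetric] by (intro eq is_dbracketD[OF br])
  have swap_eq: "Lam (tswap U) = Lam (tswap W)" if "Lam U = Lam W" for U W
    using swap[of "U - W"] that by (simp add: diff tswap_diff)
  \<comment> \<open>The product rule for the first argument follows from the one for the second by
    exchanging factors on both sides; the outer bimodule structure thereby becomes the inner
    one.\<close>
  have leib': "Lam (br (p * q) r) = Lam (br p r) * Lam (tens q 1) + Lam (tens 1 p) * Lam (br q r)" for p q r
  proof -
    have "Lam (br r (p * q)) = Lam (br r p * tens 1 q + tens p 1 * br r q)"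
      by (simp add: leib mult add)
    from swap_eq[OF this]
    have "- Lam (br (p * q) r) = - (Lam (br p r) * Lam (tens q 1)) - Lam (tens 1 p) * Lam (br q r)"
      by (simp add: skew tswap_add tswap_mult add mult)
    then show ?thesis by (simp add: neg_eq_iff_add_eq_0 algebra_simps)
  qed
  have zl: "Lam (br 0 q) = 0" "Lam (br q 0) = 0" for q
    using addl[of 0 0 q] addr[of q 0 0] by simp_all
  show ?thesis
  proof
    show "Lam (tens (p + q) 1) = Lam (tens p 1) + Lam (tens q 1)"
      "Lam (tens 1 (p + q)) = Lam (tens 1 p) + Lam (tens 1 q)" for p q
      by (simp_all add: tens_add_left tens_add_right add)
    show "Lam (tens (p * q) 1) = Lam (tens p 1) * Lam (tens q 1)"
      "Lam (tens 1 (p * q)) = Lam (tens 1 p) * Lam (tens 1 q)" for p q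
      by (simp_all add: tens_mult flip: mult)
    show "Lam (tens p 1) = 0" "Lam (tens 1 p) = 0" if "p \<in> J" for p
      using ker[OF tens_ker.left[OF that]] ker[OF tens_ker.right[OF that]] by simp_all
    show "Lam (tens 1 q) * Lam (tens p 1) = Lam (tens p 1) * Lam (tens 1 q)" for p q
      by (simp add: tens_mult flip: mult)
    show "Lam (br p q) + Lam (br p q) = 0" if "p \<in> J" for p q
      using cong[of p 0 q q] that is_idealD(1)[OF J] by (simp add: zl)
    show "Lam (br p q) + Lam (br p q) = 0" if "q \<in> J" for p q
      using cong[of p p q 0] that is_idealD(1)[OF J] by (simp add: zl)
    show "\<exists>U. Lam (tens p 1) * Lam (tens 1 q) = Lam U \<and> Lam (tens q 1) * Lam (tens 1 p) = Lam (tswap U)" for p q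
      by (rule exI[of _ "tens p q"]) (simp add: tens_mult flip: mult)
    show "\<exists>U. u + v = Lam U \<and> u' + v' = Lam (tswap U)"
      if "\<exists>U. u = Lam U \<and> u' = Lam (tswap U)" "\<exists>U. v = Lam U \<and> v' = Lam (tswap U)" for u u' v v'
      using that by (metis add tswap_add)
    show "\<exists>U. - u = Lam U \<and> - u' = Lam (tswap U)" if "\<exists>U. u = Lam U \<and> u' = Lam (tswap U)" for u u'
      using that by (metis uminus tswap_uminus)
    show "v = v'" if "\<exists>U. u = Lam U \<and> v = Lam (tswap U)" "\<exists>U. u = Lam U \<and> v' = Lam (tswap U)" for u v v'
      using that swap_eq by metis
    show "\<exists>U. Lam (br p q) + Lam (br p q) = Lam U \<and> - (Lam (br q p) + Lam (br q p)) = Lam (tswap U)" for p q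
      by (rule exI[of _ "br p q + br p q"]) (simp add: add tswap_add skew)
  qed (simp_all add: addl addr leib leib' algebra_simps)
qed

text \<open>Makes the identities proved for a \<open>quiver_family\<close> applicable to the images
  under \<open>X\<close> of the source generators. The relation \<open>S\<close> concerns values
  only and is kept.\<close>

lemma double_bracket_rep_pullback:
  fixes X :: "'x \<Rightarrow> ('k::field, 'y) falg"
  assumes "double_bracket_rep J' L R D S" and "\<And>p. p \<in> J \<Longrightarrow> fhom X p \<in> J'"
  shows "double_bracket_rep J (\<lambda>p. L (fhom X p)) (\<lambda>p. R (fhom X p)) (\<lambda>p q. D (fhom X p) (fhom X q)) S"
proof -
  interpret double_bracket_rep J' L R D S by fact
  show ?thesis
    by unfold_locales
       (simp_all add: fhom_simps L_add R_add L_mult R_mult R_L D_add_left D_add_right D_mult_left D_mult_right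
         S_tens S_add S_uminus S_D assms(2) L_J R_J D_J_left D_J_right S_unique)
qed

text \<open>Outside \<open>I\<close> the lists in \<open>ol\<close> are arbitrary, while the
  abstract conditions on signs range over all vertices; hence the default 0.\<close>

definition order_int :: "'v set \<Rightarrow> ('v \<Rightarrow> ('a \<times> bool) list) \<Rightarrow> 'v \<Rightarrow> 'a \<times> bool \<Rightarrow> 'a \<times> bool \<Rightarrow> int" where
  "order_int I ol s b c = (if s \<in> I then oo ol s b c else 0)"

lemma precedes_Nil [simp]: "\<not> precedes [] b c"
  by (simp add: precedes_def)

lemma precedes_Cons: "precedes (x # xs) b c \<longleftrightarrow> x = b \<and> c \<in> set xs \<or> precedes xs b c"
proof
  assume "precedes (x # xs) b c"
  then obtain i j where ij: "i < j" "j < length (x # xs)" "(x # xs) ! i = b" "(x # xs) ! j = c"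
    unfolding precedes_def by blast
  then obtain j' where j': "j = Suc j'" by (cases j) auto
  show "x = b \<and> c \<in> set xs \<or> precedes xs b c"
  proof (cases i)
    case 0
    with ij j' show ?thesis by auto
  next
    case (Suc i')
    with ij j' show ?thesis unfolding precedes_def by auto
  qed
next
  assume "x = b \<and> c \<in> set xs \<or> precedes xs b c"
  then show "precedes (x # xs) b c"
  proof
    assume "x = b \<and> c \<in> set xs"
    then obtain j where "j < length xs" "xs ! j = c" "x = b" by (auto simp: in_set_conv_nth)
    then show ?thesis unfolding precedes_def by (intro exI[of _ 0] exI[of _ "Suc j"]) auto
  next
    assume "precedes xs b c"
    then obtain i j where "i < j" "j < length xs" "xs ! i = b" "xs ! j = c"
      unfolding precedes_def by blast
    then show ?thesis unfolding precedes_def by (intro exI[of _ "Suc i"] exI[of _ "Suc j"]) auto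
  qed
qed

lemma precedes_in_set: "precedes xs b c \<Longrightarrow> b \<in> set xs \<and> c \<in> set xs"
  by (induction xs) (auto simp: precedes_Cons)

lemma precedes_append:
  "precedes (xs @ ys) b c \<longleftrightarrow> precedes xs b c \<or> precedes ys b c \<or> b \<in> set xs \<and> c \<in> set ys"
  by (induction xs) (auto simp: precedes_Cons)

lemma precedes_asym: "distinct xs \<Longrightarrow> precedes xs b c \<Longrightarrow> \<not> precedes xs c b"
  by (induction xs) (auto simp: precedes_Cons dest: precedes_in_set)

lemma precedes_map_inj:
  assumes "inj_on f (set xs \<union> {b, c})"
  shows "precedes (map f xs) (f b) (f c) \<longleftrightarrow> precedes xs b c"
proof -
  have "\<forall>x\<in>set xs. (f x = f b \<longleftrightarrow> x = b) \<and> (f x = f c \<longleftrightarrow> x = c)"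
    using assms by (auto simp: inj_on_def)
  then show ?thesis
  proof (induction xs)
    case (Cons a xs)
    have "f c \<in> f ` set xs \<longleftrightarrow> c \<in> set xs" using Cons.prems by (auto simp: image_iff)
    with Cons show ?case by (simp add: precedes_Cons)
  qed simp
qed

lemma order_int_skew:
  assumes "orderings I Ar t h ol"
  shows "order_int I ol s c b = - order_int I ol s b c"
  using assms precedes_asym[of "ol s" b c] precedes_asym[of "ol s" c b]
  by (auto simp: order_int_def oo_def orderings_def)

lemma order_int_tail:
  assumes "orderings I Ar t h ol" "order_int I ol s b c \<noteq> 0"
  shows "dtl t h b = s \<and> dtl t h c = s"
  using assms by (auto simp: order_int_def oo_def orderings_def Tset_def dest!: precedes_in_set split: if_splits)

context quiver_rep
begin

lemma quiver_family_gens: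
  assumes "double_bracket_rep J L R D S"
    and "\<And>s q. s \<in> I \<Longrightarrow> D (vtx s) q = 0" "\<And>s q. s \<in> I \<Longrightarrow> D q (vtx s) = 0"
  shows "quiver_family J L R D S H dstar tail vtx arr zinv"
proof -
  interpret double_bracket_rep J L R D S by fact
  note g = lam_gens lam_gens_left
  show ?thesis
    by unfold_locales
      (simp_all add: assms tail_in_I lam_mult lam_add ring_nf g lam_gens(3)[of "dstar _", simplified] flip: lam_eq_iff)
qed

lemma order_sign_order_int:
  assumes "quiver_family J L R D S H dstar tail vtx arr zinv" "orderings I Ar t h ol"
  shows "quiver_family.order_sign tail (order_int I ol)"
  unfolding quiver_family.order_sign_def[OF assms(1)]
  using order_int_skew[OF assms(2)] order_int_tail[OF assms(2)] by blast

text \<open>The separate prescriptions for equal arrows, for an arrow with its star and for other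
  pairs are instances of one formula: the sign of a half-edge with itself vanishes, and
  skew-symmetry merges the remaining ones. The bracket with the star is prescribed for arrows of the
  quiver only; for their stars it is deduced by exchange.\<close>

lemma bracket_gens_formula:
  fixes Lam :: "('k, ('v, 'a) gen) ftens \<Rightarrow> 't::ring_1"
    and br :: "('k, ('v, 'a) gen) falg \<Rightarrow> ('k, ('v, 'a) gen) falg \<Rightarrow> ('k, ('v, 'a) gen) ftens"
  assumes char: "(2::'k) \<noteq> 0" and gens: "bracket_gens I Ar t h ol br" and ol: "orderings I Ar t h ol"
    and add: "\<And>U W. Lam (U + W) = Lam U + Lam W" and mult: "\<And>U W. Lam (U * W) = Lam U * Lam W"
    and ker: "\<And>U. U \<in> tens_ker J \<Longrightarrow> Lam U = 0"
    and fam: "quiver_family J (\<lambda>p. Lam (tens p 1)) (\<lambda>p. Lam (tens 1 p))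
     (\<lambda>p q. Lam (br p q) + Lam (br p q)) S H dstar tail vtx arr zinv"
    and b: "b \<in> H" and c: "c \<in> H"
  shows "Lam (br (arr b) (arr c)) + Lam (br (arr b) (arr c))
    = bracket_formula (\<lambda>p. Lam (tens p 1)) (\<lambda>p. Lam (tens 1 p)) dstar tail vtx snd (order_int I ol) arr b c"
proof -
  define D where "D p q = Lam (br p q) + Lam (br p q)" for p q
  define L R where "L p = Lam (tens p 1)" and "R p = Lam (tens 1 p)" for p
  interpret quiver_family J L R D S H dstar tail vtx arr zinv
    using fam unfolding D_def[abs_def] L_def[abs_def] R_def[abs_def] .
  have os: "order_sign (order_int I ol)"
    by (rule order_sign_order_int[OF _ ol]) unfold_locales
  have pos: "orient snd" by (simp add: orient_def dstar_def)
  have zero: "Lam 0 = 0" using add[of 0 0] by simp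
  have uminus: "Lam (- U) = - Lam U" for U
    using add[of "- U" U] by (simp add: zero eq_neg_iff_add_eq_0)
  have diff: "Lam (U - W) = Lam U - Lam W" for U W
    using add[of U "- W"] by (simp add: uminus)
  have eq: "Lam U = Lam W" if "U - W \<in> tens_ker J" for U W
    using ker[OF that] by (simp add: diff)
  have oi: "oo ol (tail d) = order_int I ol (tail d)" if "d \<in> H" for d
    using tail_in_I[OF that] by (simp add: order_int_def fun_eq_iff)
  have Lam_int: "Lam (of_int n * U) = of_int n * Lam U" for n U
  proof (induction n rule: int_induct[where k = 0])
    case base
    then show ?case by (simp add: zero)
  next
    case (step1 i)
    then show ?case by (simp add: distrib_right add)
  next
    case (step2 i)
    then show ?case by (simp add: left_diff_distrib diff)
  qed
  \<comment> \<open>Doubling cancels the denominator and leaves an integer, which an additive map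
    can carry outside.\<close>
  have half: "Lam (sm (of_int n / 2) U) + Lam (sm (of_int n / 2) U) = of_int n * Lam U" for n U
    using char by (simp add: Lam_int sm_of_int field_simps flip: add sm_add_left)
  have half1: "Lam (sm (1 / 2) U) + Lam (sm (1 / 2) U) = Lam U" for U
    using half[of 1 U] by simp
  have tens: "Lam (tens p q) = L p * R q" for p q
    by (simp add: L_def R_def tens_mult flip: mult)
  have self: "D (arr d) (arr d) = gen_bracket snd (order_int I ol) arr d d" if d: "d \<in> H" for d
  proof -
    have "Lam (br (arr d) (arr d)) = Lam (sm (of_int (order_int I ol (tail d) d (dstar d)) / 2)
        (tens (arr d * arr d) (vtx (tail d)) - tens (vtx (tail (dstar d))) (arr d * arr d)))"
      by (rule eq) (use gens d in \<open>auto simp: bracket_gens_def Let_def dhd_eq oi\<close>)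
    then have "D (arr d) (arr d) = of_int (order_int I ol (tail d) d (dstar d)) *
        (L (arr d * arr d) * R (vtx (tail d)) - L (vtx (tail (dstar d))) * R (arr d * arr d))"
      unfolding D_def by (simp add: half diff tens)
    then show ?thesis
      using order_sign_skew[OF os, of "dstar d" d]
      by (simp add: bracket_formula_def order_sign_self[OF os] L_mult R_mult mult.assoc right_diff_distrib)
  qed
  have star: "D (arr d) (arr (dstar d)) = gen_bracket snd (order_int I ol) arr d (dstar d)"
    if d: "d \<in> H" "snd d" for d
  proof -
    obtain a where a: "d = (a, True)" "a \<in> Ar" using d by (cases d) (auto simp: darrows_def)
    have "br (arr d) (arr (dstar d)) - (tens (vtx (tail (dstar d))) (vtx (tail d))
          + sm (1/2) (tens (arr (dstar d) * arr d) (vtx (tail d)))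
          + sm (1/2) (tens (vtx (tail (dstar d))) (arr d * arr (dstar d)))
          + sm (of_int (oo ol (tail d) d (dstar d)) / 2)
             (tens (arr (dstar d)) (arr d) - tens (arr d) (arr (dstar d)))) \<in> tens_ker J"
      using gens a(2) unfolding bracket_gens_def Let_def dhd_eq a(1) by blast
    from eq[OF this, unfolded oi[OF d(1)]]
    have Lb: "Lam (br (arr d) (arr (dstar d))) = Lam (tens (vtx (tail (dstar d))) (vtx (tail d)))
          + Lam (sm (1/2) (tens (arr (dstar d) * arr d) (vtx (tail d))))
          + Lam (sm (1/2) (tens (vtx (tail (dstar d))) (arr d * arr (dstar d))))
          + Lam (sm (of_int (order_int I ol (tail d) d (dstar d)) / 2)
             (tens (arr (dstar d)) (arr d) - tens (arr d) (arr (dstar d))))"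
      by (simp only: add)
    have reorder: "(u1 + u2 + u3 + u4) + (u1 + u2 + u3 + u4) = (u1 + u1) + (u2 + u2) + (u3 + u3) + (u4 + u4)"
      for u1 u2 u3 u4 :: 't by (simp add: add_ac)
    show ?thesis
      unfolding D_def Lb reorder half half1
      using order_sign_skew[OF os, of "dstar d" d] d
      by (simp add: bracket_formula_def order_sign_self[OF os] tens diff L_mult R_mult mult.assoc right_diff_distrib)
  qed
  have "D (arr b) (arr c) = gen_bracket snd (order_int I ol) arr b c"
  proof -
    consider "c = b" | "c = dstar b" "snd b" | "c = dstar b" "\<not> snd b" | "c \<noteq> b" "c \<noteq> dstar b" by blast
    then show ?thesis
    proof cases
      case 3
      then have "snd c" "b = dstar c" by (simp add: dstar_def, simp)
      with star[OF c] have "D (arr c) (arr b) = gen_bracket snd (order_int I ol) arr c b" by simp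
      from S_unique[OF S_D[of "arr c" "arr b", unfolded this] S_gen_bracket[OF os pos c b]]
      show ?thesis by simp
    next
      case 4
      have "br (arr b) (arr c) - (- sm (of_int (oo ol (tail b) b c) / 2) (tens (arr b) (arr c))
           - sm (of_int (oo ol (tail (dstar b)) (dstar b) (dstar c)) / 2) (tens (arr c) (arr b))
           + sm (of_int (oo ol (tail b) b (dstar c)) / 2) (tens (arr c * arr b) (vtx (tail b)))
           + sm (of_int (oo ol (tail (dstar b)) (dstar b) c) / 2) (tens (vtx (tail (dstar b))) (arr b * arr c))) \<in> tens_ker J"
        using gens b c 4 unfolding bracket_gens_def Let_def dhd_eq by blast
      from eq[OF this, unfolded oi[OF b] oi[OF star_H[OF b]]]
      have Lb: "Lam (br (arr b) (arr c)) = - Lam (sm (of_int (order_int I ol (tail b) b c) / 2) (tens (arr b) (arr c)))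
           - Lam (sm (of_int (order_int I ol (tail (dstar b)) (dstar b) (dstar c)) / 2) (tens (arr c) (arr b)))
           + Lam (sm (of_int (order_int I ol (tail b) b (dstar c)) / 2) (tens (arr c * arr b) (vtx (tail b))))
           + Lam (sm (of_int (order_int I ol (tail (dstar b)) (dstar b) c) / 2) (tens (vtx (tail (dstar b))) (arr b * arr c)))"
        by (simp only: add diff uminus)
      have reorder: "(- u1 - u2 + u3 + u4) + (- u1 - u2 + u3 + u4) = - (u1 + u1) - (u2 + u2) + (u3 + u3) + (u4 + u4)"
        for u1 u2 u3 u4 :: 't by (simp add: algebra_simps)
      show ?thesis
        unfolding D_def Lb reorder half using 4
        by (simp add: bracket_formula_def tens L_mult R_mult mult.assoc)
    qed (use self[OF b] star[OF b] in auto)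
  qed
  then show ?thesis unfolding D_def L_def[abs_def] R_def[abs_def] .
qed

text \<open>Both brackets are derivations in each argument and vanish on vertices, and the rule for
  inverses expresses values on \<open>zinv c\<close> by values on arrows. Agreement spreads from
  arrows to all second arguments, and after that to all first ones. Scalars enter as the
  implications \<open>sc\<close> since the values lie in a ring without scalars.\<close>

lemma bracket_unique:
  assumes f1: "quiver_family J L R D1 S1 H dstar tail vtx arr zinv"
    and f2: "quiver_family J L R D2 S2 H dstar tail vtx arr zinv"
    and v1: "\<And>s q. D1 (vtx s) q = 0" "\<And>s q. D1 q (vtx s) = 0"
    and v2: "\<And>s q. D2 (vtx s) q = 0" "\<And>s q. D2 q (vtx s) = 0"
    and sc: "\<And>c p q. D1 p q = D2 p q \<Longrightarrow> D1 (sm c p) q = D2 (sm c p) q"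
      "\<And>c p q. D1 p q = D2 p q \<Longrightarrow> D1 p (sm c q) = D2 p (sm c q)"
    and eq: "\<And>b c. b \<in> H \<Longrightarrow> c \<in> H \<Longrightarrow> D1 (arr b) (arr c) = D2 (arr b) (arr c)"
  shows "D1 p q = D2 p q"
proof -
  interpret q1: quiver_family J L R D1 S1 H dstar tail vtx arr zinv by fact
  interpret q2: quiver_family J L R D2 S2 H dstar tail vtx arr zinv by fact
  have out: "arr b \<in> J" "zinv b \<in> J" if "b \<notin> H" for b
    using lam_outside(2,3)[OF that] by (simp_all add: lam_ker)
  have one: "1 - (\<Sum>s\<in>I. vtx s) \<in> J"
    using lam_one by (simp add: lam_sum flip: lam_eq_iff)
  have sum: "D1 (\<Sum>s\<in>A. vtx s) q = 0" "D1 q (\<Sum>s\<in>A. vtx s) = 0"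
      "D2 (\<Sum>s\<in>A. vtx s) q = 0" "D2 q (\<Sum>s\<in>A. vtx s) = 0" for q A
    by (induction A rule: infinite_finite_induct)
       (auto simp: v1 v2 q1.D_add_left q1.D_add_right q2.D_add_left q2.D_add_right)
  have one0: "D1 1 q = 0" "D1 q 1 = 0" "D2 1 q = 0" "D2 q 1 = 0" for q
    using q1.D_cong_left[OF one] q1.D_cong_right[OF one] q2.D_cong_left[OF one] q2.D_cong_right[OF one]
    by (simp_all add: sum)
  have right: "D1 p q = D2 p q" if p: "\<And>x. D1 p (ltr x) = D2 p (ltr x)" for p q
  proof (induction q rule: falg_induct)
    case (scale c q)
    then show ?case by (rule sc)
  qed (simp_all add: one0 p q1.D_add_right q2.D_add_right q1.D_mult_right q2.D_mult_right)
  have unit: "local_unit J L R D1 S1 (vtx (tail b)) (vtx (tail b) + arr b * arr (dstar b)) (zinv b)"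
    "local_unit J L R D2 S2 (vtx (tail b)) (vtx (tail b) + arr b * arr (dstar b)) (zinv b)" if "b \<in> H" for b
    using q1.local_unit_mfac[OF that, of "\<lambda>_. True"] q2.local_unit_mfac[OF that, of "\<lambda>_. True"]
    by (simp_all add: q1.mfac_def q1.mfac_inv_def q2.mfac_def q2.mfac_inv_def)
  have arrow: "D1 (arr b) q = D2 (arr b) q" for b q
  proof (cases "b \<in> H")
    case False
    then show ?thesis using out by (simp add: q1.D_J_left q2.D_J_left)
  next
    case b: True
    show ?thesis
    proof (rule right)
      fix x
      have E: "D1 (arr b) (arr c) = D2 (arr b) (arr c)" for c
        using eq[OF b] out q1.D_J_right q2.D_J_right by (cases "c \<in> H") auto
      show "D1 (arr b) (ltr x) = D2 (arr b) (ltr x)"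
      proof (cases x)
        case (Z c)
        show ?thesis
        proof (cases "c \<in> H")
          case True
          show ?thesis
            unfolding Z local_unit.D_inverse_right[OF unit(1)[OF True]] local_unit.D_inverse_right[OF unit(2)[OF True]]
            by (simp add: q1.D_add_right q2.D_add_right q1.D_mult_right q2.D_mult_right v1 v2 E)
        qed (simp add: Z out q1.D_J_right q2.D_J_right)
      qed (simp_all add: E v1 v2)
    qed
  qed
  show ?thesis
  proof (induction p rule: falg_induct)
    case (ltr x)
    show ?case
    proof (cases x)
      case (Z c)
      show ?thesis
      proof (cases "c \<in> H")
        case True
        show ?thesis
          unfolding Z local_unit.D_inverse_left[OF unit(1)[OF True]] local_unit.D_inverse_left[OF unit(2)[OF True]]
          by (simp add: q1.D_add_left q2.D_add_left q1.D_mult_left q2.D_mult_left v1 v2 arrow)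
      qed (simp add: Z out q1.D_J_left q2.D_J_left)
    qed (simp_all add: arrow v1 v2)
  next
    case (scale c p)
    then show ?case by (rule sc)
  qed (simp_all add: one0 q1.D_add_left q2.D_add_left q1.D_mult_left q2.D_mult_left)
qed

end

section \<open>Changing orders and orientations\<close>

text \<open>The required head is moved to the front past its predecessors, one neighbour at a time;
  the part already arranged is kept in \<open>us\<close>.\<close>

lemma adjacent_swaps_induct:
  assumes step: "\<And>us c b vs. P (us @ [c, b] @ vs) \<Longrightarrow> P (us @ [b, c] @ vs)"
    and "mset xs = mset ys" "P (us @ xs)"
  shows "P (us @ ys)"
  using assms(2,3)
proof (induction ys arbitrary: us xs)
  case (Cons y ys)
  then have "y \<in> set xs" by (metis list.set_intros(1) set_mset_mset)
  then obtain as bs where xs: "xs = as @ y # bs" by (meson split_list)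
  have "P (us @ as @ y # bs) \<Longrightarrow> P (us @ y # as @ bs)" for bs
  proof (induction as arbitrary: bs rule: rev_induct)
    case (snoc a as)
    then show ?case using step[of "us @ as" a y bs] snoc.IH[of "a # bs"] by simp
  qed simp
  with Cons.prems(2) xs have "P ((us @ [y]) @ as @ bs)" by simp
  moreover have "mset (as @ bs) = mset ys" using Cons.prems(1) xs by simp
  ultimately show ?case using Cons.IH[of "as @ bs" "us @ [y]"] by simp
qed simp

lemma order_int_swap:
  assumes ol: "orderings I Ar t h ol" and s: "s \<in> I" and ol_s: "ol s = us @ [c, b] @ vs"
  shows "order_int I ol s c b = 1"
    "d \<noteq> b \<Longrightarrow> d \<noteq> c \<Longrightarrow> order_int I ol s b d = order_int I ol s c d"
    "order_int I (ol(s := us @ [b, c] @ vs)) u p q = (if u = s \<and> p = b \<and> q = c then 1 else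
       if u = s \<and> p = c \<and> q = b then -1 else order_int I ol u p q)"
proof -
  have "distinct (us @ [c, b] @ vs)" using ol s unfolding ol_s[symmetric] orderings_def by blast
  then have d: "b \<noteq> c" "b \<notin> set us" "c \<notin> set us" "b \<notin> set vs" "c \<notin> set vs" by auto
  have n: "\<not> precedes us b d" "\<not> precedes us d b" "\<not> precedes us c d" "\<not> precedes us d c"
    "\<not> precedes vs b d" "\<not> precedes vs d b" "\<not> precedes vs c d" "\<not> precedes vs d c" for d
    using d precedes_in_set by metis+
  show "order_int I ol s c b = 1"
    using s d by (simp add: order_int_def oo_def ol_s precedes_append precedes_Cons)
  show "d \<noteq> b \<Longrightarrow> d \<noteq> c \<Longrightarrow> order_int I ol s b d = order_int I ol s c d"
    using s d n by (simp add: order_int_def oo_def ol_s precedes_append precedes_Cons)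
  show "order_int I (ol(s := us @ [b, c] @ vs)) u p q = (if u = s \<and> p = b \<and> q = c then 1 else
       if u = s \<and> p = c \<and> q = b then -1 else order_int I ol u p q)"
  proof (cases "u = s")
    case True
    consider "p = b" "q = c" | "p = c" "q = b" | "\<not> (p = b \<and> q = c)" "\<not> (p = c \<and> q = b)" by blast
    then show ?thesis
    proof cases
      case 3
      then have "precedes ([b, c] @ vs) p q = precedes ([c, b] @ vs) p q"
        "precedes ([b, c] @ vs) q p = precedes ([c, b] @ vs) q p"
        unfolding append_Cons append_Nil precedes_Cons list.set insert_iff by metis+
      moreover have "set ([b, c] @ vs) = set ([c, b] @ vs)" by auto
      ultimately have "oo (ol(s := us @ [b, c] @ vs)) s p q = oo ol s p q"
        unfolding oo_def fun_upd_same ol_s precedes_append[of us] by (simp only:)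
      with 3 True show ?thesis unfolding order_int_def by (simp only: if_False simp_thms)
    qed (use True s d n in \<open>simp_all add: order_int_def oo_def ol_s precedes_append precedes_Cons\<close>)
  qed (simp add: order_int_def oo_def)
qed

lemma orderings_swap:
  assumes "orderings I Ar t h ol" "ol s = us @ [c, b] @ vs"
  shows "orderings I Ar t h (ol(s := us @ [b, c] @ vs))"
  unfolding orderings_def
proof
  fix s' assume s': "s' \<in> I"
  with assms(1) have o: "distinct (ol s')" "set (ol s') = Tset Ar t h s'" by (auto simp: orderings_def)
  show "distinct ((ol(s := us @ [b, c] @ vs)) s') \<and> set ((ol(s := us @ [b, c] @ vs)) s') = Tset Ar t h s'"
  proof (cases "s' = s")
    case True
    with o assms(2) have "distinct (us @ [c, b] @ vs)" "set (us @ [c, b] @ vs) = Tset Ar t h s" by simp_all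
    then show ?thesis using True by auto
  qed (simp add: o)
qed

lemma bracket_formula_pullback:
  assumes "\<And>s. X (V s) = vtx s"
  shows "bracket_formula (\<lambda>p. L (fhom X p)) (\<lambda>p. R (fhom X p)) star tail vtx pos os y b c
    = bracket_formula L R star tail vtx pos os (\<lambda>d. fhom X (y d)) b c"
  by (simp add: bracket_formula_def assms)

section \<open>Isomorphisms onto a fixed target\<close>

locale reduction = quiver_rep I Ar t h lam + target: double_bracket_rep J' L R D S
  for I :: "'v set" and Ar :: "'a set" and t h and lam :: "('k::field, ('v, 'a) gen) falg \<Rightarrow> 'r::ring"
    and J' :: "('k, ('v, 'b) gen) falg set" and L R :: "('k, ('v, 'b) gen) falg \<Rightarrow> 't::ring_1" and D S +
  fixes \<Phi>' :: "('k, ('v, 'b) gen) falg"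
  assumes J': "is_ideal J'"
    and D_vtx: "\<And>s q. s \<in> I \<Longrightarrow> D (vtx s) q = 0" "\<And>s q. s \<in> I \<Longrightarrow> D q (vtx s) = 0"
begin

text \<open>The bracket condition is tested on arrows and read off in the target, so it makes sense
  without any bracket on the source for \<open>pos\<close> and \<open>ol\<close>.\<close>

definition reaches :: "('a \<times> bool \<Rightarrow> bool) \<Rightarrow> ('v \<Rightarrow> ('a \<times> bool) list) \<Rightarrow> bool" where
  "reaches pos ol \<longleftrightarrow> (\<exists>X. alg_iso J J' X \<and>
     (\<forall>b\<in>H. \<forall>c\<in>H. D (X (E b)) (X (E c)) = bracket_formula L R dstar tail vtx pos (order_int I ol) (\<lambda>d. X (E d)) b c)
     \<and> fhom X (moment I pos ol) - \<Phi>' \<in> J')"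

text \<open>\<open>\<alpha>\<close> has to carry the new moment map to the old one, and not
  conversely, since \<open>X\<close> is known to send the old one to \<open>\<Phi>'\<close>.\<close>

lemma reaches_step:
  assumes X: "alg_iso J J' X" "fhom X (moment I pos ol) - \<Phi>' \<in> J'"
    and \<alpha>: "alg_iso J J \<alpha>" "lam (fhom \<alpha> (moment I pos' ol')) = lam (moment I pos ol)"
    and f: "\<And>b c. b \<in> H \<Longrightarrow> c \<in> H \<Longrightarrow> D (fhom X (\<alpha> (E b))) (fhom X (\<alpha> (E c)))
       = bracket_formula L R dstar tail vtx pos' (order_int I ol') (\<lambda>d. fhom X (\<alpha> (E d))) b c"
  shows "reaches pos' ol'"
proof -
  have "fhom X (fhom \<alpha> (moment I pos' ol') - moment I pos ol) + (fhom X (moment I pos ol) - \<Phi>') \<in> J'"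
    using X \<alpha>(2) is_idealD(2)[OF J'] unfolding lam_eq_iff alg_iso_def by blast
  then have "fhom (\<lambda>x. fhom X (\<alpha> x)) (moment I pos' ol') - \<Phi>' \<in> J'"
    by (simp add: fhom_diff fhom_comp)
  with f alg_iso_comp[OF X(1) \<alpha>(1) is_ideal_J J'] show ?thesis
    unfolding reaches_def by (intro exI[of _ "\<lambda>x. fhom X (\<alpha> x)"]) blast
qed

lemma family_pullback:
  assumes "alg_iso J J' X"
  shows "quiver_family J (\<lambda>p. L (fhom X p)) (\<lambda>p. R (fhom X p)) (\<lambda>p q. D (fhom X p) (fhom X q)) S
    H dstar tail vtx arr zinv"
proof (rule quiver_family_gens)
  show "double_bracket_rep J (\<lambda>p. L (fhom X p)) (\<lambda>p. R (fhom X p)) (\<lambda>p q. D (fhom X p) (fhom X q)) S"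
    using assms by (intro double_bracket_rep_pullback[OF target.double_bracket_rep_axioms]) (simp add: alg_iso_def)
qed (use assms D_vtx in \<open>simp_all add: alg_iso_def\<close>)

lemma reaches_swap:
  assumes r: "reaches pos ol" and ol: "orderings I Ar t h ol" and pos: "\<And>d. pos (dstar d) = (\<not> pos d)"
    and s: "s \<in> I" and ol_s: "ol s = us @ [c, b] @ vs"
  shows "reaches pos (ol(s := us @ [b, c] @ vs))"
proof -
  obtain X where X: "alg_iso J J' X" "fhom X (moment I pos ol) - \<Phi>' \<in> J'"
    and f: "\<And>b c. b \<in> H \<Longrightarrow> c \<in> H \<Longrightarrow> D (X (E b)) (X (E c))
       = bracket_formula L R dstar tail vtx pos (order_int I ol) (\<lambda>d. X (E d)) b c"
    using r unfolding reaches_def by blast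
  have V: "X (V s) = vtx s" for s using X by (simp add: alg_iso_def)
  have "distinct (us @ [c, b] @ vs)" "set (us @ [c, b] @ vs) = Tset Ar t h s"
    using ol s unfolding ol_s[symmetric] orderings_def by blast+
  then have bc: "b \<in> H" "c \<in> H" "b \<noteq> c" "tail b = s" "tail c = s" by (auto simp: Tset_def)
  define LX where "LX p = L (fhom X p)" for p
  define RX where "RX p = R (fhom X p)" for p
  define DX where "DX p q = D (fhom X p) (fhom X q)" for p q
  note defs = LX_def[abs_def] RX_def[abs_def] DX_def[abs_def]
  interpret quiver_family J LX RX DX S H dstar tail vtx arr zinv
    using family_pullback[OF X(1)] unfolding defs .
  have fam: "quiver_family J LX RX DX S H dstar tail vtx arr zinv" by unfold_locales
  interpret sw: swap_move J LX RX DX S H dstar tail vtx arr zinv pos "order_int I ol"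
    "order_int I (ol(s := us @ [b, c] @ vs))" b c s
  proof
    show "gens_ok pos (order_int I ol) arr"
      using f unfolding gens_ok_def unfolding defs by (simp add: bracket_formula_pullback V)
    show "order_sign (order_int I ol)" by (rule order_sign_order_int[OF fam ol])
    show "orient pos" using pos by (simp add: orient_def)
  qed (fact bc order_int_swap[OF ol s ol_s] | erule (1) order_int_swap[OF ol s ol_s])+
  define \<alpha> where "\<alpha> = conj_map b (fac pos s c) (fac (\<lambda>d. \<not> pos d) s c)"
  have y: "sw.y d = \<alpha> (E d)" for d
    by (simp add: sw.y_def \<alpha>_def conj_map_def mfac_def mfac_inv_def fac_def bc)
  show ?thesis
  proof (rule reaches_step[OF X])
    show "alg_iso J J \<alpha>" unfolding \<alpha>_def by (rule alg_iso_conj[OF bc]) simp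
    show "lam (fhom \<alpha> (moment I pos (ol(s := us @ [b, c] @ vs)))) = lam (moment I pos ol)"
      unfolding \<alpha>_def by (rule lam_moment_swap[OF bc ol ol_s]) simp
    show "D (fhom X (\<alpha> (E b'))) (fhom X (\<alpha> (E c'))) = bracket_formula L R dstar tail vtx pos
        (order_int I (ol(s := us @ [b, c] @ vs))) (\<lambda>d. fhom X (\<alpha> (E d))) b' c'" if "b' \<in> H" "c' \<in> H" for b' c'
      using sw.gens_ok_swap that unfolding gens_ok_def unfolding defs y by (simp add: bracket_formula_pullback V)
  qed
qed

lemma reaches_flip:
  assumes r: "reaches pos ol" and ol: "orderings I Ar t h ol" and pos: "\<And>d. pos (dstar d) = (\<not> pos d)"
    and b: "b \<in> H" "pos b" and pos': "\<And>d. pos' d = (if d = b then False else if d = dstar b then True else pos d)"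
  shows "reaches pos' ol"
proof -
  obtain X where X: "alg_iso J J' X" "fhom X (moment I pos ol) - \<Phi>' \<in> J'"
    and f: "\<And>b c. b \<in> H \<Longrightarrow> c \<in> H \<Longrightarrow> D (X (E b)) (X (E c))
       = bracket_formula L R dstar tail vtx pos (order_int I ol) (\<lambda>d. X (E d)) b c"
    using r unfolding reaches_def by blast
  have V: "X (V s) = vtx s" for s using X by (simp add: alg_iso_def)
  define LX where "LX p = L (fhom X p)" for p
  define RX where "RX p = R (fhom X p)" for p
  define DX where "DX p q = D (fhom X p) (fhom X q)" for p q
  note defs = LX_def[abs_def] RX_def[abs_def] DX_def[abs_def]
  interpret quiver_family J LX RX DX S H dstar tail vtx arr zinv
    using family_pullback[OF X(1)] unfolding defs .
  have fam: "quiver_family J LX RX DX S H dstar tail vtx arr zinv" by unfold_locales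
  interpret fl: flip_move J LX RX DX S H dstar tail vtx arr zinv pos pos' "order_int I ol" b "tail b"
  proof
    show "gens_ok pos (order_int I ol) arr"
      using f unfolding gens_ok_def unfolding defs by (simp add: bracket_formula_pullback V)
    show "order_sign (order_int I ol)" by (rule order_sign_order_int[OF fam ol])
    show "orient pos" using pos by (simp add: orient_def)
  qed (fact b pos' refl)+
  have y: "fl.y d = flip_map b (E d)" for d
    using b by (simp add: fl.y_def flip_map_def mfac_inv_def)
  show ?thesis
  proof (rule reaches_step[OF X])
    show "alg_iso J J (flip_map b)" by (rule alg_iso_flip[OF b(1)])
    show "lam (fhom (flip_map b) (moment I pos' ol)) = lam (moment I pos ol)"
      using pos b by (intro lam_moment_flip[OF _ _ _ pos' ol]) auto
    show "D (fhom X (flip_map b (E b'))) (fhom X (flip_map b (E c'))) = bracket_formula L R dstar tail vtx pos'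
        (order_int I ol) (\<lambda>d. fhom X (flip_map b (E d))) b' c'" if "b' \<in> H" "c' \<in> H" for b' c'
      using fl.gens_ok_flip that unfolding gens_ok_def unfolding defs y by (simp add: bracket_formula_pullback V)
  qed
qed

lemma reaches_vertex_order:
  assumes "reaches pos ol" "orderings I Ar t h ol" and pos: "\<And>d. pos (dstar d) = (\<not> pos d)"
    and s: "s \<in> I" and bs: "distinct bs" "set bs = Tset Ar t h s"
  shows "reaches pos (ol(s := bs)) \<and> orderings I Ar t h (ol(s := bs))"
proof -
  let ?P = "\<lambda>bs. reaches pos (ol(s := bs)) \<and> orderings I Ar t h (ol(s := bs))"
  have step: "?P (us @ [b, c] @ vs)" if "?P (us @ [c, b] @ vs)" for us c b vs
    using reaches_swap[of pos "ol(s := us @ [c, b] @ vs)" s us c b vs] orderings_swap[of I Ar t h "ol(s := us @ [c, b] @ vs)" s us c b vs]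
      that pos s by simp
  have "mset (ol s) = mset bs"
    using assms(2) s bs by (simp add: orderings_def set_eq_iff_mset_eq_distinct[symmetric])
  with adjacent_swaps_induct[of ?P "ol s" bs "[]", OF step] assms(1,2) show ?thesis by simp
qed

lemma reaches_order:
  assumes "reaches pos ol" "orderings I Ar t h ol" and pos: "\<And>d. pos (dstar d) = (\<not> pos d)"
    and ol': "orderings I Ar t h ol'"
  shows "reaches pos ol'"
proof -
  have "finite K \<Longrightarrow> K \<subseteq> I \<Longrightarrow> reaches pos (\<lambda>s. if s \<in> K then ol' s else ol s) \<and>
      orderings I Ar t h (\<lambda>s. if s \<in> K then ol' s else ol s)" for K
  proof (induction K rule: finite_induct)
    case empty
    then show ?case using assms by simp
  next
    case (insert s K)
    have "(\<lambda>s. if s \<in> K then ol' s else ol s)(s := ol' s) = (\<lambda>u. if u \<in> insert s K then ol' u else ol u)"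
      by auto
    with reaches_vertex_order[of pos "\<lambda>s. if s \<in> K then ol' s else ol s" s "ol' s", OF _ _ pos] insert ol'
    show ?case by (simp add: orderings_def)
  qed
  from this[of I] have "reaches pos (\<lambda>s. if s \<in> I then ol' s else ol s)"
    using quiver by (simp add: quiver_def)
  \<comment> \<open>Outside \<open>I\<close> the lists still come from \<open>ol\<close>, but signs
    and moment maps read them at vertices only.\<close>
  moreover have "order_int I (\<lambda>s. if s \<in> I then ol' s else ol s) = order_int I ol'"
    "moment I pos (\<lambda>s. if s \<in> I then ol' s else ol s) = (moment I pos ol' :: ('k, ('v, 'a) gen) falg)"
    by (auto simp: fun_eq_iff order_int_def oo_def moment_def)
  ultimately show ?thesis by (simp add: reaches_def)
qed

lemma reaches_orientation:
  assumes "finite F" "F \<subseteq> Ar" "orderings I Ar t h ol"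
    and "reaches (\<lambda>(a, v). if a \<in> F then \<not> v else v) ol"
  shows "reaches snd ol"
  using assms
proof (induction F rule: finite_induct)
  case empty
  then show ?case by (simp add: case_prod_unfold)
next
  case (insert a F)
  have "reaches (\<lambda>(a, v). if a \<in> F then \<not> v else v) ol"
    \<comment> \<open>Being reversed, \<open>a\<close> has \<open>(a, False)\<close> as its positive
      half-edge, and this is the one to flip.\<close>
    by (rule reaches_flip[OF insert.prems(3) insert.prems(2), of "(a, False)"])
       (use insert in \<open>auto simp: dstar_def darrows_def\<close>)
  with insert show ?case by simp
qed

end

text \<open>Half-edges outside \<open>H\<close> go to 0, in agreement with the relations, since
  \<open>r\<close> is arbitrary there. As \<open>r\<close> acts on half-edges rather than arrows, it
  may change orientations.\<close>

definition relabel :: "('a \<times> bool) set \<Rightarrow> ('a \<times> bool \<Rightarrow> 'b \<times> bool) \<Rightarrow> ('v, 'a) gen \<Rightarrow> ('k::field, ('v, 'b) gen) falg" where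
  "relabel H r x = (case x of V s \<Rightarrow> vtx s | E b \<Rightarrow> if b \<in> H then arr (r b) else 0
     | Z b \<Rightarrow> if b \<in> H then zinv (r b) else 0)"

lemma relabel_JQ:
  fixes lam :: "('k::field, ('v, 'b) gen) falg \<Rightarrow> 'r::ring" and p :: "('k, ('v, 'a) gen) falg"
  assumes "quiver_rep I Ar' t' h' lam"
    and r: "\<And>b. b \<in> darrows Ar \<Longrightarrow> r b \<in> darrows Ar' \<and> r (dstar b) = dstar (r b) \<and> dtl t' h' (r b) = dtl t h b"
    and p: "p \<in> JQ I Ar t h"
  shows "fhom (relabel (darrows Ar) r) p \<in> JQ I Ar' t' h'"
proof -
  interpret quiver_rep I Ar' t' h' lam by fact
  have "lam (vtx (dtl t h b)) * lam (arr (r b)) = lam (arr (r b))"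
    "lam (arr (r b)) * lam (vtx (dtl t h (dstar b))) = lam (arr (r b))"
    "lam (vtx (dtl t h b)) * lam (zinv (r b)) = lam (zinv (r b))"
    "lam (zinv (r b)) * lam (vtx (dtl t h b)) = lam (zinv (r b))"
    "lam (zinv (r b)) * (lam (arr (r b)) * lam (arr (r (dstar b)))) = lam (vtx (dtl t h b)) - lam (zinv (r b))"
    "lam (arr (r b)) * (lam (arr (r (dstar b))) * lam (zinv (r b))) = lam (vtx (dtl t h b)) - lam (zinv (r b))"
    if "b \<in> darrows Ar" for b
    using lam_gens[of "r b"] r[OF that] r[of "dstar b"] that by simp_all
  then show ?thesis
    by (intro fhom_JQ[OF _ _ _ _ _ _ _ _ _ p]) (simp_all add: relabel_def)
qed

lemma relabel_inverse:
  fixes lam :: "('k::field, ('v, 'a) gen) falg \<Rightarrow> 'r::ring" and p :: "('k, ('v, 'a) gen) falg"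
    and r :: "'a \<times> bool \<Rightarrow> 'b \<times> bool"
  assumes "quiver_rep I Ar t h lam"
    and "\<And>b. b \<in> darrows Ar \<Longrightarrow> r b \<in> darrows Ar' \<and> r' (r b) = b"
  shows "fhom (relabel (darrows Ar') r') (fhom (relabel (darrows Ar) r) p) - p \<in> JQ I Ar t h"
proof -
  interpret quiver_rep I Ar t h lam by fact
  have "lam (fhom (relabel (darrows Ar') r') (relabel (darrows Ar) r x)) = lam (ltr x)" for x
    using assms(2) lam_outside by (cases x) (auto simp: relabel_def)
  from lam_fhom_id[OF this, of p] show ?thesis by (simp add: fhom_comp lam_eq_iff)
qed

context reduction
begin

text \<open>Starting point of the reduction: the structure of the target, transported along a
  bijection of half-edges that preserves tails and stars. The resulting orientation
  \<open>snd (r b)\<close> differs from that of the source at the arrows that \<open>r\<close>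
  reverses.\<close>

lemma reaches_relabel:
  fixes lam' :: "('k, ('v, 'b) gen) falg \<Rightarrow> 's::ring"
  assumes q': "quiver_rep I Ar' t' h' lam'" and J'_eq: "J' = JQ I Ar' t' h'"
    and r: "bij_betw r H (darrows Ar')"
    and star: "\<And>b. b \<in> H \<Longrightarrow> r (dstar b) = dstar (r b)"
    and tl: "\<And>b. b \<in> H \<Longrightarrow> dtl t' h' (r b) = tail b"
    and ol': "orderings I Ar' t' h' ol'"
    and f: "\<And>b c. b \<in> darrows Ar' \<Longrightarrow> c \<in> darrows Ar' \<Longrightarrow> D (arr b) (arr c)
      = bracket_formula L R dstar (dtl t' h') vtx snd (order_int I ol') arr b c"
    and \<Phi>': "\<Phi>' = moment I snd ol'"
  defines "ol \<equiv> \<lambda>s. map (inv_into H r) (ol' s)"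
  shows "reaches (\<lambda>b. snd (r b)) ol \<and> orderings I Ar t h ol"
proof -
  define r' where "r' = inv_into H r"
  have rH: "r b \<in> darrows Ar'" "r' (r b) = b" if "b \<in> H" for b
    using r that by (auto simp: r'_def bij_betw_def)
  have r'H: "r' c \<in> H" "r (r' c) = c" if "c \<in> darrows Ar'" for c
    using r that by (auto simp: r'_def bij_betw_def inv_into_into f_inv_into_f)
  have inj: "r b = r c \<longleftrightarrow> b = c" if "b \<in> H" "c \<in> H" for b c
    using rH that by metis
  have star': "r' (dstar c) = dstar (r' c)" if "c \<in> darrows Ar'" for c
    using star[OF r'H(1)[OF that]] r'H[OF that] rH(2)[of "dstar (r' c)"] by simp
  have tl': "tail (r' c) = dtl t' h' c" if "c \<in> darrows Ar'" for c
    using tl[OF r'H(1)[OF that]] r'H[OF that] by simp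
  have set': "set (ol' s) = Tset Ar' t' h' s" "distinct (ol' s)" if "s \<in> I" for s
    using ol' that by (auto simp: orderings_def)
  have sub: "set (ol' s) \<subseteq> darrows Ar'" if "s \<in> I" for s
    using set'[OF that] by (auto simp: Tset_def)
  have ol_H: "set (ol s) \<subseteq> H" if "s \<in> I" for s
    using sub[OF that] r'H by (auto simp: ol_def r'_def[symmetric])
  have map_r: "map r (ol s) = ol' s" if "s \<in> I" for s
    using sub[OF that] r'H by (auto simp: ol_def r'_def[symmetric] intro!: map_idI)
  have ol: "orderings I Ar t h ol"
    unfolding orderings_def
  proof (intro ballI conjI)
    fix s assume s: "s \<in> I"
    show "distinct (ol s)" using map_r[OF s] set'(2)[OF s] distinct_map by metis
    show "set (ol s) = Tset Ar t h s"
    proof (intro equalityI subsetI)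
      fix b assume "b \<in> set (ol s)"
      then obtain c where "c \<in> set (ol' s)" "b = r' c" by (auto simp: ol_def r'_def)
      then show "b \<in> Tset Ar t h s" using set'[OF s] r'H tl' by (auto simp: Tset_def)
    next
      fix b assume "b \<in> Tset Ar t h s"
      then have "b \<in> H" "tail b = s" by (auto simp: Tset_def)
      then have "r b \<in> set (ol' s)" "b = r' (r b)" using set'[OF s] rH tl by (auto simp: Tset_def)
      then show "b \<in> set (ol s)" unfolding ol_def r'_def[symmetric] set_map by blast
    qed
  qed
  define X where "X = (relabel H r :: ('v, 'a) gen \<Rightarrow> ('k, ('v, 'b) gen) falg)"
  define Y where "Y = (relabel (darrows Ar') r' :: ('v, 'b) gen \<Rightarrow> ('k, ('v, 'a) gen) falg)"
  have q: "quiver_rep I Ar t h lam" by unfold_locales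
  have iso: "alg_iso J J' X"
    unfolding alg_iso_def J'_eq
  proof (intro conjI exI[of _ Y] ballI allI)
    show "fhom X p \<in> JQ I Ar' t' h'" if "p \<in> J" for p
      unfolding X_def using rH star tl by (intro relabel_JQ[OF q' _ that]) auto
    show "fhom Y p \<in> J" if "p \<in> JQ I Ar' t' h'" for p
      unfolding Y_def using r'H star' tl' by (intro relabel_JQ[OF q _ that]) auto
    show "fhom Y (fhom X p) - p \<in> J" for p
      unfolding X_def Y_def using rH by (intro relabel_inverse[OF q]) auto
    show "fhom X (fhom Y p) - p \<in> JQ I Ar' t' h'" for p
      unfolding X_def Y_def using r'H by (intro relabel_inverse[OF q']) auto
  qed (simp_all add: X_def Y_def relabel_def)
  have X_E: "X (E b) = arr (r b)" if "b \<in> H" for b using that by (simp add: X_def relabel_def)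
  have oi: "order_int I ol s b c = order_int I ol' s (r b) (r c)" if "b \<in> H" "c \<in> H" for s b c
  proof (cases "s \<in> I")
    case True
    have "inj_on r (set (ol s) \<union> {d, d'})" if "d \<in> H" "d' \<in> H" for d d'
      by (rule inj_on_subset[OF bij_betw_imp_inj_on[OF r]]) (use ol_H[OF True] that in simp)
    then show ?thesis
      using precedes_map_inj[of r "ol s" b c] precedes_map_inj[of r "ol s" c b] that
      by (simp add: order_int_def oo_def map_r[OF True])
  qed (simp add: order_int_def)
  have "D (X (E b)) (X (E c)) = bracket_formula L R dstar tail vtx (\<lambda>b. snd (r b)) (order_int I ol) (\<lambda>d. X (E d)) b c"
    if b: "b \<in> H" and c: "c \<in> H" for b c
  proof -
    have "r c = dstar (r b) \<longleftrightarrow> c = dstar b"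
      using inj[OF c, of "dstar b"] star[OF b] b by simp
    then show ?thesis
      using b c unfolding X_E[OF b] X_E[OF c] f[OF rH(1)[OF b] rH(1)[OF c]] bracket_formula_def
      by (simp add: X_E oi star tl flip: star)
  qed
  moreover have "fhom X (moment I (\<lambda>b. snd (r b)) ol) = \<Phi>'"
    unfolding \<Phi>' moment_def fhom_sum
  proof (rule sum.cong[OF refl])
    fix s assume s: "s \<in> I"
    have "fhom X (fac (\<lambda>b. snd (r b)) s b) = fac snd s (r b)" if "b \<in> H" for b
      using that star by (simp add: fac_def fhom_simps X_def relabel_def)
    then have "map (fhom X \<circ> fac (\<lambda>b. snd (r b)) s) (ol s) = map (fac snd s) (map r (ol s))"
      using ol_H[OF s] by auto
    then show "fhom X (vtx s * prod_list (map (fac (\<lambda>b. snd (r b)) s) (ol s))) = vtx s * prod_list (map (fac snd s) (ol' s))"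
      by (simp add: fhom_simps map_r[OF s] X_def relabel_def)
  qed
  ultimately show ?thesis
    unfolding reaches_def using iso ol is_idealD(1)[OF J'] by (auto intro!: exI[of _ X])
qed

end

section \<open>Isomorphism of the two quasi-Hamiltonian algebras\<close>

lemma is_dbracket_vtx:
  fixes br :: "('k::field, ('v, 'a) gen) falg \<Rightarrow> ('k, ('v, 'a) gen) falg \<Rightarrow> ('k, ('v, 'a) gen) ftens"
  assumes "is_dbracket I J V br" "finite I" "s \<in> I"
  shows "br (vtx s) q \<in> tens_ker J" "br q (vtx s) \<in> tens_ker J"
proof -
  have "(\<Sum>s'\<in>I. sm (if s' = s then 1 else 0) (vtx s')) = (vtx s :: ('k, ('v, 'a) gen) falg)"
    using assms(2,3) by (subst sum.remove[of _ s]) auto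
  then show "br (vtx s) q \<in> tens_ker J" "br q (vtx s) \<in> tens_ker J"
    using is_dbracketD(8,9)[OF assms(1), where q = q and d = "\<lambda>s'. if s' = s then 1 else 0"] by simp_all
qed

lemma alg_iso_imp:
  assumes "alg_iso J J' X" "is_ideal J"
  shows "fhom X p \<in> J' \<longleftrightarrow> p \<in> J" "\<exists>p. fhom X p - q \<in> J'"
proof -
  obtain Y where Y: "\<forall>q\<in>J'. fhom Y q \<in> J" "\<forall>p. fhom Y (fhom X p) - p \<in> J" "\<forall>q. fhom X (fhom Y q) - q \<in> J'"
    using assms(1) unfolding alg_iso_def by blast
  show "\<exists>p. fhom X p - q \<in> J'" using Y by blast
  have "p \<in> J" if "fhom X p \<in> J'"
  proof -
    have "fhom Y (fhom X p) - (fhom Y (fhom X p) - p) \<in> J"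
      by (rule is_ideal_diff[OF assms(2)]) (use Y that in blast)+
    then show ?thesis by simp
  qed
  then show "fhom X p \<in> J' \<longleftrightarrow> p \<in> J" using assms(1) by (auto simp: alg_iso_def)
qed

theorem mainTheorem2:
  fixes I :: "'v set"
    and Ar :: "'a set" and t h :: "'a \<Rightarrow> 'v" and ol :: "'v \<Rightarrow> ('a \<times> bool) list"
    and Ar' :: "'b set" and t' h' :: "'b \<Rightarrow> 'v" and ol' :: "'v \<Rightarrow> ('b \<times> bool) list"
    and br :: "('k::field_char_0, ('v, 'a) gen) falg \<Rightarrow> ('k, ('v, 'a) gen) falg \<Rightarrow> ('k, ('v, 'a) gen) ftens"
    and br' :: "('k, ('v, 'b) gen) falg \<Rightarrow> ('k, ('v, 'b) gen) falg \<Rightarrow> ('k, ('v, 'b) gen) ftens"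
  assumes "quiver I Ar t h" and "quiver I Ar' t' h'"
    and "\<exists>\<sigma>. bij_betw \<sigma> Ar Ar' \<and> (\<forall>a\<in>Ar. {t' (\<sigma> a), h' (\<sigma> a)} = {t a, h a})"
    and "orderings I Ar t h ol" and "orderings I Ar' t' h' ol'"
    and "is_dbracket I (JQ I Ar t h) V br" and "bracket_gens I Ar t h ol br"
    and "is_dbracket I (JQ I Ar' t' h') V br'" and "bracket_gens I Ar' t' h' ol' br'"
  shows "\<exists>\<phi>. qham_iso I (JQ I Ar t h) (JQ I Ar' t' h') V V br br'
                (Phi I t h ol) (Phi I t' h' ol') \<phi>"
proof -
  note quiver = assms(1,2) and ol = assms(4,5) and br = assms(6,7) and br' = assms(8,9)
  have fin: "finite I" "finite Ar" using quiver(1) by (auto simp: quiver_def)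
  let ?J = "JQ I Ar t h :: ('k, ('v, 'a) gen) falg set"
  let ?J' = "JQ I Ar' t' h' :: ('k, ('v, 'b) gen) falg set"
  have ideal: "is_ideal ?J" "is_ideal ?J'" unfolding JQ_def by (rule is_ideal_tideal)+
  obtain lam :: "('k, ('v, 'a) gen) falg \<Rightarrow> ('k, ('v, 'a) gen) falg endo"
    where "\<And>p q. lam (p + q) = lam p + lam q" "\<And>p q. lam (p * q) = lam p * lam q" "\<And>p. lam p = 0 \<longleftrightarrow> p \<in> ?J"
    by (rule ideal_eq_kernel[OF ideal(1)]) blast
  then interpret Q: quiver_rep I Ar t h lam using quiver(1) by unfold_locales
  obtain lam' :: "('k, ('v, 'b) gen) falg \<Rightarrow> ('k, ('v, 'b) gen) falg endo"
    where "\<And>p q. lam' (p + q) = lam' p + lam' q" "\<And>p q. lam' (p * q) = lam' p * lam' q" "\<And>p. lam' p = 0 \<longleftrightarrow> p \<in> ?J'"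
    by (rule ideal_eq_kernel[OF ideal(2)]) blast
  then interpret Q': quiver_rep I Ar' t' h' lam' using quiver(2) by unfold_locales
  obtain Lam :: "('k, ('v, 'b) gen) ftens \<Rightarrow> ('k, ('v, 'b) gen) ftens endo"
    where Lam: "\<And>p q. Lam (p + q) = Lam p + Lam q" "\<And>p q. Lam (p * q) = Lam p * Lam q"
      "\<And>p. Lam p = 0 \<longleftrightarrow> p \<in> tens_ker ?J'"
    by (rule ideal_eq_kernel[OF is_ideal_tens_ker[OF ideal(2)]]) blast
  define L where "L p = Lam (tens p 1)" for p
  define R where "R p = Lam (tens 1 p)" for p
  define D where "D p q = Lam (br' p q) + Lam (br' p q)" for p q
  define S where "S u v \<longleftrightarrow> (\<exists>U. u = Lam U \<and> v = Lam (tswap U))" for u v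
  note defs = L_def[abs_def] R_def[abs_def] D_def[abs_def] S_def[abs_def]
  have rep: "double_bracket_rep ?J' L R D S"
    unfolding defs by (rule double_bracket_rep_of_dbracket[OF ideal(2) br'(1) Lam(1,2)])
      (simp_all add: Lam(3) tswap_tens_ker)
  have D_vtx: "D (vtx s) q = 0" "D q (vtx s) = 0" if "s \<in> I" for s q
    using is_dbracket_vtx[OF br'(1) fin(1) that, of q] by (simp_all add: D_def flip: Lam(3))
  interpret reduction I Ar t h lam ?J' L R D S "Phi I t' h' ol'"
    by (intro reduction.intro reduction_axioms.intro Q.quiver_rep_axioms rep ideal(2) D_vtx)
  have formula': "D (arr b) (arr c) = bracket_formula L R dstar (dtl t' h') vtx snd (order_int I ol') arr b c"
    if "b \<in> darrows Ar'" "c \<in> darrows Ar'" for b c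
    unfolding defs
    by (rule Q'.bracket_gens_formula[OF _ br'(2) ol(2) Lam(1,2) _ _ that, where S = S])
       (use Q'.quiver_family_gens[OF rep D_vtx] in \<open>simp_all add: Lam(3) defs\<close>)

  obtain \<sigma> where \<sigma>: "bij_betw \<sigma> Ar Ar'" "\<And>a. a \<in> Ar \<Longrightarrow> {t' (\<sigma> a), h' (\<sigma> a)} = {t a, h a}"
    using assms(3) by blast
  \<comment> \<open>Arrows whose direction \<open>\<sigma>\<close> does not respect; the tails of
    matched loops always agree, so no loop lies in \<open>F\<close>. Exchanging the half-edges over
    \<open>F\<close> makes \<open>r\<close> preserve tails.\<close>
  define F where "F = {a \<in> Ar. t' (\<sigma> a) \<noteq> t a}"
  define r where "r = (\<lambda>(a, v). (\<sigma> a, if a \<in> F then \<not> v else v))"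
  have r: "bij_betw r (darrows Ar) (darrows Ar')"
  proof (rule bij_betwI')
    show "r b = r c \<longleftrightarrow> b = c" if "b \<in> darrows Ar" "c \<in> darrows Ar" for b c
      using that bij_betw_imp_inj_on[OF \<sigma>(1)] by (auto simp: r_def darrows_def inj_on_def split: if_splits)
    show "r b \<in> darrows Ar'" if "b \<in> darrows Ar" for b
      using that bij_betw_apply[OF \<sigma>(1)] by (auto simp: r_def darrows_def)
    show "\<exists>b\<in>darrows Ar. c = r b" if c: "c \<in> darrows Ar'" for c
    proof -
      obtain a where "a \<in> Ar" "fst c = \<sigma> a"
        using c bij_betw_imp_surj_on[OF \<sigma>(1)] by (auto simp: darrows_def)
      then show ?thesis
        by (intro bexI[of _ "(a, if a \<in> F then \<not> snd c else snd c)"]) (auto simp: r_def darrows_def prod_eq_iff)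
    qed
  qed
  have star: "r (dstar b) = dstar (r b)" for b
    by (cases b) (auto simp: r_def dstar_def)
  have tl: "dtl t' h' (r b) = dtl t h b" if "b \<in> darrows Ar" for b
    using that \<sigma>(2)[of "fst b"] by (auto simp: r_def F_def darrows_def dtl_def doubleton_eq_iff split: if_splits)
  have "reaches (\<lambda>b. snd (r b)) (\<lambda>s. map (inv_into (darrows Ar) r) (ol' s))
      \<and> orderings I Ar t h (\<lambda>s. map (inv_into (darrows Ar) r) (ol' s))"
    by (rule reaches_relabel[OF Q'.quiver_rep_axioms refl r star tl ol(2) formula' Phi_eq_moment])
  then have "reaches (\<lambda>b. snd (r b)) ol"
    by (elim conjE, intro reaches_order[OF _ _ _ ol(1)]) (assumption | simp only: star, simp add: dstar_def)+
  then have "reaches snd ol"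
    using fin(2) by (intro reaches_orientation[of F, OF _ _ ol(1)])
      (auto simp: F_def r_def case_prod_unfold if_distrib cong: if_cong)
  then obtain X where iso: "alg_iso ?J ?J' X"
    and X_gens: "\<And>b c. b \<in> darrows Ar \<Longrightarrow> c \<in> darrows Ar \<Longrightarrow> D (X (E b)) (X (E c))
       = bracket_formula L R dstar (dtl t h) vtx snd (order_int I ol) (\<lambda>d. X (E d)) b c"
    and X_moment: "fhom X (moment I snd ol) - Phi I t' h' ol' \<in> ?J'"
    unfolding reaches_def by blast
  have X: "X (V s) = vtx s" "p \<in> ?J \<Longrightarrow> fhom X p \<in> ?J'" for s p using iso by (auto simp: alg_iso_def)

  define LX where "LX p = L (fhom X p)" for p
  define RX where "RX p = R (fhom X p)" for p
  define D1 where "D1 p q = D (fhom X p) (fhom X q)" for p q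
  \<comment> \<open>To be compared, the brackets must take values in one ring: that of the source is
    pushed forward by \<open>thom X\<close>, that of the target is evaluated on images under
    \<open>X\<close>. Both families then share \<open>LX\<close> and \<open>RX\<close>.\<close>
  define LamX where "LamX U = Lam (thom X U)" for U
  define D2 where "D2 p q = LamX (br p q) + LamX (br p q)" for p q
  define SX where "SX u v \<longleftrightarrow> (\<exists>U. u = LamX U \<and> v = LamX (tswap U))" for u v
  have LamX: "LamX (U + W) = LamX U + LamX W" "LamX (U * W) = LamX U * LamX W"
    "U \<in> tens_ker ?J \<Longrightarrow> LamX U = 0" "LamX U = 0 \<Longrightarrow> LamX (tswap U) = 0" for U W
    using thom_tens_ker[of ?J X ?J' U] X
    by (simp_all add: LamX_def thom_add thom_mult Lam thom_tswap tswap_tens_ker)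
  have LX_eq: "LX = (\<lambda>p. LamX (tens p 1))" "RX = (\<lambda>p. LamX (tens 1 p))"
    by (simp_all add: fun_eq_iff LX_def RX_def L_def R_def LamX_def)
  have fam1: "quiver_family ?J LX RX D1 S (darrows Ar) dstar (dtl t h) vtx arr zinv"
    using family_pullback[OF iso] unfolding LX_def[abs_def] RX_def[abs_def] D1_def[abs_def] .
  have v2: "D2 (vtx s) q = 0" "D2 q (vtx s) = 0" if "s \<in> I" for s q
    using is_dbracket_vtx[OF br(1) fin(1) that, of q] by (simp_all add: D2_def LamX(3))
  have fam2: "quiver_family ?J LX RX D2 SX (darrows Ar) dstar (dtl t h) vtx arr zinv"
  proof (rule Q.quiver_family_gens)
    show "double_bracket_rep ?J LX RX D2 SX"
      unfolding LX_eq D2_def[abs_def] SX_def[abs_def]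
      by (rule double_bracket_rep_of_dbracket[OF ideal(1) br(1) LamX])
  qed (fact v2)+
  have vJ: "vtx s \<in> ?J" if "s \<notin> I" for s
    using Q.lam_outside(1)[OF that] by (simp add: Q.lam_ker)
  have v1': "D1 (vtx s) q = 0" "D1 q (vtx s) = 0" for s q
    using D_vtx X double_bracket_rep.D_J_left[OF quiver_family.axioms(1)[OF fam1] vJ]
      double_bracket_rep.D_J_right[OF quiver_family.axioms(1)[OF fam1] vJ]
    by (cases "s \<in> I"; simp add: D1_def)+
  have v2': "D2 (vtx s) q = 0" "D2 q (vtx s) = 0" for s q
    using v2 double_bracket_rep.D_J_left[OF quiver_family.axioms(1)[OF fam2] vJ]
      double_bracket_rep.D_J_right[OF quiver_family.axioms(1)[OF fam2] vJ]
    by (cases "s \<in> I"; simp)+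
  have Lam_eq: "Lam U = Lam W" if "U - W \<in> tens_ker ?J'" for U W
    using Lam(1)[of "U - W" W] Lam(3) that by simp
  \<comment> \<open>Scalars act on values as multiplication by the ring element
    \<open>Lam (sm c 1)\<close>, the same for both brackets; this provides the scalar conditions of
    uniqueness.\<close>
  have Lam_sm: "Lam (sm c U) = Lam (sm c 1) * Lam U" for c U
    by (simp add: sm_mult_left flip: Lam(2))
  have sc1: "D1 (sm c p) q = Lam (sm c 1) * D1 p q" "D1 p (sm c q) = Lam (sm c 1) * D1 p q" for c p q
    using Lam_eq[OF is_dbracketD(4)[OF br'(1)], of c "fhom X p" "fhom X q"]
      Lam_eq[OF is_dbracketD(5)[OF br'(1)], of "fhom X p" c "fhom X q"]
    by (simp_all add: D1_def D_def fhom_sm Lam_sm[symmetric] distrib_left)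
  have sc2: "D2 (sm c p) q = Lam (sm c 1) * D2 p q" "D2 p (sm c q) = Lam (sm c 1) * D2 p q" for c p q
  proof -
    have *: "LamX U = Lam (sm c 1) * LamX W" if "U - sm c W \<in> tens_ker ?J" for U W
      using LamX(1)[of "U - sm c W" "sm c W"] LamX(3)[OF that] by (simp add: LamX_def thom_sm Lam_sm[symmetric])
    show "D2 (sm c p) q = Lam (sm c 1) * D2 p q" "D2 p (sm c q) = Lam (sm c 1) * D2 p q"
      using *[OF is_dbracketD(4)[OF br(1)]] *[OF is_dbracketD(5)[OF br(1)]]
      by (simp_all add: D2_def distrib_left)
  qed
  have D12: "D1 p q = D2 p q" for p q
  proof (rule Q.bracket_unique[OF fam1 fam2 v1' v2'])
    fix b c assume bc: "b \<in> darrows Ar" "c \<in> darrows Ar"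
    have "D2 (arr b) (arr c) = bracket_formula LX RX dstar (dtl t h) vtx snd (order_int I ol) arr b c"
      unfolding D2_def LX_eq
      by (rule Q.bracket_gens_formula[OF _ br(2) ol(1) LamX(1,2,3) _ bc, where S = SX])
         (use fam2 in \<open>simp_all add: D2_def[abs_def] LX_eq\<close>)
    also have "\<dots> = D1 (arr b) (arr c)"
      using X_gens[OF bc] unfolding LX_def[abs_def] RX_def[abs_def]
      by (simp add: bracket_formula_pullback X D1_def)
    finally show "D1 (arr b) (arr c) = D2 (arr b) (arr c)" ..
  qed (simp_all add: sc1 sc2)
  have bracket: "br' (fhom X p) (fhom X q) - thom X (br p q) \<in> tens_ker ?J'" for p q
  proof -
    define W where "W = br' (fhom X p) (fhom X q) - thom X (br p q)"
    have "Lam (W + W) = 0"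
      using D12[of p q] Lam(1)[of W "thom X (br p q)"]
      by (simp add: D1_def D2_def D_def LamX_def Lam(1) W_def)
    \<comment> \<open>Undoes the doubling: in characteristic 0 the kernel element
      \<open>W + W\<close> can be halved.\<close>
    then have "sm (1 / 2) (W + W) \<in> tens_ker ?J'" by (intro tens_ker.smul) (simp add: Lam(3))
    moreover have "sm (1 / 2) (W + W) = W"
      by (simp add: sm_add flip: sm_add_left)
    ultimately show ?thesis by (simp add: W_def)
  qed
  show ?thesis
    unfolding qham_iso_def
    using X bracket X_moment alg_iso_imp[OF iso ideal(1)] is_idealD(1)[OF ideal(2)]
    by (intro exI[of _ X]) (simp add: Phi_eq_moment)
qed

end
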